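(* Let $N\ge 6$. Every tracial central linear functional on $\mathrm{Pol}(H_N^+)$ is a linear combination of the counit $\varepsilon$, the character $\varepsilon_{alt}$ and the Haar state $h$, and therefore extends to a bounded functional on $C^u(H_N^+)$.
   Context: For a compact quantum group $\mathbb{G}$ with Hopf $*$-algebra $\mathrm{Pol}(\mathbb{G})$ and unitary irreducible representatives $U^\alpha=(U^\alpha_{ij})_{i,j=1}^{d_\alpha}$, $\alpha\in\mathrm{Irr}(\mathbb{G})$: a linear functional $\phi:\mathrm{Pol}(\mathbb{G})\to\mathbb{C}$ is tracial if $\phi(ab)=\phi(ba)$ for all $a,b$, and central if for each $\alpha$ there is $c_\alpha\in\mathbb{C}$ with $\phi(U^\alpha_{ij})=c_\alpha\delta_{ij}$ for all $i,j$. The counit satisfies $\varepsilon(U^\alpha_{ij})=\delta_{ij}$; the Haar state $h$ satisfies $h(1)=1$ and $h(U^\alpha_{ij})=0$ for all nontrivial $\alpha$. $C^u(\mathbb{G})$ is the universal $C^*$-completion of $\mathrm{Pol}(\mathbb{G})$. The quantum hyperoctahedral group $H_N^+$: $\mathrm{Pol}(H_N^+)$ is the universal unital $*$-algebra generated by elements $u_{ij}$, $1\le i,j\le N$, with $u_{ij}^*=u_{ij}$, $u_{ij}u_{ik}=\delta_{jk}u_{ij}^2$, $u_{ij}u_{kj}=\delta_{ik}u_{ij}^2$, and such that the elements $p_{ij}=u_{ij}^2$ satisfy $p_{ij}=p_{ij}^*$, $p_{ij}p_{il}=\delta_{jl}p_{ij}$, $p_{ij}p_{lj}=\delta_{il}p_{ij}$,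 $\sum_k p_{kj}=1=\sum_k p_{ik}$; the coproduct is $\Delta(u_{ij})=\sum_k u_{ik}\otimes u_{kj}$. The character $\varepsilon_{alt}:\mathrm{Pol}(H_N^+)\to\mathbb{C}$ is the unique unital $*$-homomorphism with $\varepsilon_{alt}(u_{ij})=-\delta_{ij}$. *)

theory Defs
  imports
    "HOL-Analysis.Analysis"
    "HOL-Library.Poly_Mapping"
    "HOL-Library.Nonpos_Ints"
    "Jordan_Normal_Form.Matrix"
begin


section \<open>Complex unital *-algebras\<close>

class complex_vector = ab_group_add +
  fixes scaleC :: "complex \<Rightarrow> 'a \<Rightarrow> 'a" (infixr \<open>*\<^sub>C\<close> 75)
  assumes scaleC_add_right: "c *\<^sub>C (x + y) = c *\<^sub>C x + c *\<^sub>C y"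
    and scaleC_add_left: "(c + d) *\<^sub>C x = c *\<^sub>C x + d *\<^sub>C x"
    and scaleC_scaleC: "c *\<^sub>C d *\<^sub>C x = (c * d) *\<^sub>C x"
    and scaleC_one: "1 *\<^sub>C x = x"

class complex_star_algebra = complex_vector + ring_1 +
  fixes star :: "'a \<Rightarrow> 'a"
  assumes mult_scaleC_left: "(c *\<^sub>C x) * y = c *\<^sub>C (x * y)"
    and mult_scaleC_right: "x * (c *\<^sub>C y) = c *\<^sub>C (x * y)"
    and star_add: "star (x + y) = star x + star y"
    and star_scaleC: "star (c *\<^sub>C x) = cnj c *\<^sub>C star x"
    and star_mult: "star (x * y) = star y * star x"
    and star_star: "star (star x) = x"

definition clinear :: "('a::complex_vector \<Rightarrow> 'b::complex_vector) \<Rightarrow> bool" where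
  "clinear f \<longleftrightarrow> (\<forall>x y. f (x + y) = f x + f y) \<and> (\<forall>c x. f (c *\<^sub>C x) = c *\<^sub>C f x)"

definition star_hom :: "('a::complex_star_algebra \<Rightarrow> 'b::complex_star_algebra) \<Rightarrow> bool" where
  "star_hom f \<longleftrightarrow> clinear f \<and> f 1 = 1 \<and> (\<forall>x y. f (x * y) = f x * f y)
     \<and> (\<forall>x. f (star x) = star (f x))"

lemma clinear_scaleC_module: "vector_space (scaleC :: complex \<Rightarrow> 'a::complex_vector \<Rightarrow> 'a)"
  by unfold_locales (simp_all add: scaleC_add_right scaleC_add_left scaleC_scaleC scaleC_one)

lemma scaleC_zero_right [simp]: "c *\<^sub>C (0::'a::complex_vector) = 0"
  using scaleC_add_right[of c 0 "0::'a"] by simp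

lemma scaleC_zero_left [simp]: "0 *\<^sub>C (x::'a::complex_vector) = 0"
  using scaleC_add_left[of 0 0 x] by simp

lemma scaleC_minus_one: "(-1) *\<^sub>C (x::'a::complex_vector) = - x"
  using scaleC_add_left[of 1 "-1" x] by (simp add: scaleC_one eq_neg_iff_add_eq_0 add.commute)

lemma scaleC_minus_right: "c *\<^sub>C (- x::'a::complex_vector) = - (c *\<^sub>C x)"
  using scaleC_add_right[of c x "-x"] by (simp add: eq_neg_iff_add_eq_0 add.commute)

lemma scaleC_diff_right: "c *\<^sub>C (x - y::'a::complex_vector) = c *\<^sub>C x - c *\<^sub>C y"
  using scaleC_add_right[of c x "-y"] by (simp add: scaleC_minus_right)

lemma scaleC_sum_right: "c *\<^sub>C (\<Sum>i\<in>A. f i::'a::complex_vector) = (\<Sum>i\<in>A. c *\<^sub>C f i)"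
  by (induction A rule: infinite_finite_induct) (simp_all add: scaleC_add_right)

lemma star_zero [simp]: "star (0::'a::complex_star_algebra) = 0"
  using star_add[of 0 "0::'a"] by simp

lemma star_minus: "star (- x::'a::complex_star_algebra) = - star x"
  using star_add[of x "-x"] by (simp add: eq_neg_iff_add_eq_0 add.commute)

lemma star_diff: "star (x - y::'a::complex_star_algebra) = star x - star y"
  using star_add[of x "-y"] by (simp add: star_minus)

lemma star_one [simp]: "star (1::'a::complex_star_algebra) = 1"
proof -
  have "star 1 = star (1::'a) * star (star 1)" by (simp add: star_star)
  also have "\<dots> = star (star 1 * 1::'a)" by (simp only: star_mult)
  also have "\<dots> = 1" by (simp add: star_star)
  finally show ?thesis .
qed

lemma star_sum: "star (\<Sum>i\<in>A. f i::'a::complex_star_algebra) = (\<Sum>i\<in>A. star (f i))"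
  by (induction A rule: infinite_finite_induct) (simp_all add: star_add)

lemma clinear_add: "clinear f \<Longrightarrow> f (x + y) = f x + f y"
  and clinear_scaleC: "clinear f \<Longrightarrow> f (c *\<^sub>C x) = c *\<^sub>C f x"
  by (simp_all add: clinear_def)

lemma clinear_zero: "clinear f \<Longrightarrow> f 0 = 0"
  using clinear_scaleC[of f 0 0] by simp

lemma clinear_diff: "clinear f \<Longrightarrow> f (x - y) = f x - f y"
  using clinear_add[of f "x - y" y] by simp

lemma clinear_sum: "clinear f \<Longrightarrow> f (\<Sum>i\<in>A. g i) = (\<Sum>i\<in>A. f (g i))"
  by (induction A rule: infinite_finite_induct) (simp_all add: clinear_zero clinear_add)

lemma star_hom_clinear: "star_hom f \<Longrightarrow> clinear f"
  and star_hom_one: "star_hom f \<Longrightarrow> f 1 = 1"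
  and star_hom_mult: "star_hom f \<Longrightarrow> f (x * y) = f x * f y"
  and star_hom_star: "star_hom f \<Longrightarrow> f (star x) = star (f x)"
  by (simp_all add: star_hom_def)

instantiation complex :: complex_star_algebra
begin
definition scaleC_complex :: "complex \<Rightarrow> complex \<Rightarrow> complex" where "scaleC_complex = (*)"
definition star_complex :: "complex \<Rightarrow> complex" where "star_complex = cnj"
instance by standard (simp_all add: scaleC_complex_def star_complex_def algebra_simps)
end


section \<open>Monoid *-algebras\<close>

text \<open>Monoids are written additively, since \<^typ>\<open>'m \<Rightarrow>\<^sub>0 complex\<close> carries the
  convolution product, i.e. is the monoid algebra, for additive (not necessarily commutative)
  monoids.\<close>

class involutive_monoid = monoid_add +
  fixes flip :: "'a \<Rightarrow> 'a"
  assumes flip_add: "flip (a + b) = flip b + flip a"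
    and flip_flip: "flip (flip a) = a"

lemma flip_zero [simp]: "flip (0::'a::involutive_monoid) = 0"
  by (metis add.left_neutral add.right_neutral flip_add flip_flip)

lemma flip_eq_iff: "flip a = b \<longleftrightarrow> a = flip (b::'a::involutive_monoid)"
  by (metis flip_flip)

instantiation poly_mapping :: (type, complex_vector) complex_vector
begin
lift_definition scaleC_poly_mapping :: "complex \<Rightarrow> ('a \<Rightarrow>\<^sub>0 'b) \<Rightarrow> 'a \<Rightarrow>\<^sub>0 'b"
  is "\<lambda>c f m. c *\<^sub>C f m"
  by (rule finite_subset) auto
instance
  by standard (transfer; simp add: fun_eq_iff scaleC_add_right scaleC_add_left scaleC_scaleC scaleC_one)+
end

lemma lookup_scaleC: "Poly_Mapping.lookup (c *\<^sub>C p) m = c *\<^sub>C Poly_Mapping.lookup p m"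
  by transfer simp

lemma scaleC_single: "c *\<^sub>C Poly_Mapping.single m d = Poly_Mapping.single m (c *\<^sub>C d)"
  by (rule poly_mapping_eqI) (simp add: lookup_scaleC lookup_single when_def)

lemma poly_mapping_single_induct:
  assumes "P 0" "\<And>m c. P (Poly_Mapping.single m c)" "\<And>x y. P x \<Longrightarrow> P y \<Longrightarrow> P (x + y)"
  shows "P (p :: 'm \<Rightarrow>\<^sub>0 'b::ab_group_add)"
proof -
  have eq: "(\<Sum>m\<in>Poly_Mapping.keys p. Poly_Mapping.single m (Poly_Mapping.lookup p m)) = p"
    by (rule poly_mapping_eqI) (auto simp: lookup_sum lookup_single when_def in_keys_iff)
  have "P (\<Sum>m\<in>A. Poly_Mapping.single m (Poly_Mapping.lookup p m))" for A
    by (induction A rule: infinite_finite_induct) (auto intro: assms)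
  from this[of "Poly_Mapping.keys p"] show ?thesis by (simp add: eq)
qed

lift_definition star_pm :: "('m::involutive_monoid \<Rightarrow>\<^sub>0 'b::complex_star_algebra) \<Rightarrow> 'm \<Rightarrow>\<^sub>0 'b"
  is "\<lambda>f m. star (f (flip m))"
proof -
  fix f :: "'m \<Rightarrow> 'b" assume "finite {m. f m \<noteq> 0}"
  moreover have "{m. star (f (flip m)) \<noteq> 0} \<subseteq> flip ` {m. f m \<noteq> 0}"
  proof
    fix m assume "m \<in> {m. star (f (flip m)) \<noteq> 0}"
    then have "f (flip m) \<noteq> 0" by auto
    then show "m \<in> flip ` {m. f m \<noteq> 0}"
      by (intro image_eqI[of _ _ "flip m"]) (simp_all add: flip_flip)
  qed
  ultimately show "finite {m. star (f (flip m)) \<noteq> 0}"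
    by (meson finite_imageI finite_subset)
qed

lemma star_pm_single: "star_pm (Poly_Mapping.single m c) = Poly_Mapping.single (flip m) (star c)"
  by (rule poly_mapping_eqI) (transfer, auto simp: when_def flip_eq_iff)

lemma star_pm_add: "star_pm (p + q) = star_pm p + star_pm q"
  by transfer (simp add: star_add)

lemma star_pm_zero: "star_pm 0 = 0"
  by transfer simp

instantiation poly_mapping :: (involutive_monoid, complex_star_algebra) complex_star_algebra
begin
definition star_poly_mapping :: "('a \<Rightarrow>\<^sub>0 'b) \<Rightarrow> 'a \<Rightarrow>\<^sub>0 'b"
  where "star_poly_mapping = star_pm"
instance
proof
  fix c :: complex and x y :: "'a \<Rightarrow>\<^sub>0 'b"
  show "(c *\<^sub>C x) * y = c *\<^sub>C (x * y)"
  proof (induction x rule: poly_mapping_single_induct)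
    case (2 m d)
    show ?case
      by (induction y rule: poly_mapping_single_induct)
        (simp_all add: scaleC_single mult_single mult_scaleC_left distrib_left scaleC_add_right)
  qed (simp_all add: distrib_right scaleC_add_right)
  show "x * (c *\<^sub>C y) = c *\<^sub>C (x * y)"
  proof (induction x rule: poly_mapping_single_induct)
    case (2 m d)
    show ?case
      by (induction y rule: poly_mapping_single_induct)
        (simp_all add: scaleC_single mult_single mult_scaleC_right distrib_left scaleC_add_right)
  qed (simp_all add: distrib_right scaleC_add_right)
  show "star (x + y) = star x + star y"
    by (simp add: star_poly_mapping_def star_pm_add)
  show "star (c *\<^sub>C x) = cnj c *\<^sub>C star x"
    unfolding star_poly_mapping_def by transfer (simp add: star_scaleC)
  show "star (star x) = x"
    unfolding star_poly_mapping_def by transfer (simp add: star_star flip_flip)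
  show "star (x * y) = star y * star x"
    unfolding star_poly_mapping_def
  proof (induction x rule: poly_mapping_single_induct)
    case (2 m d)
    show ?case
      by (induction y rule: poly_mapping_single_induct)
        (simp_all add: star_pm_single star_pm_zero star_pm_add mult_single star_mult flip_add
          distrib_left distrib_right)
  qed (simp_all add: distrib_right distrib_left star_pm_zero star_pm_add)
qed
end

lemma star_single: "star (Poly_Mapping.single m c) = Poly_Mapping.single (flip m) (star c)"
  by (simp add: star_poly_mapping_def star_pm_single)

definition free_lin :: "('m \<Rightarrow> 'v::complex_vector) \<Rightarrow> ('m \<Rightarrow>\<^sub>0 complex) \<Rightarrow> 'v" where
  "free_lin f p = (\<Sum>m\<in>Poly_Mapping.keys p. Poly_Mapping.lookup p m *\<^sub>C f m)"

lemma free_lin_superset: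
  "finite S \<Longrightarrow> Poly_Mapping.keys p \<subseteq> S \<Longrightarrow> free_lin f p = (\<Sum>m\<in>S. Poly_Mapping.lookup p m *\<^sub>C f m)"
  unfolding free_lin_def by (intro sum.mono_neutral_left) (auto simp: in_keys_iff)

lemma free_lin_single [simp]: "free_lin f (Poly_Mapping.single m c) = c *\<^sub>C f m"
  using free_lin_superset[of "{m}" "Poly_Mapping.single m c" f] by (simp add: lookup_single)

lemma free_lin_add: "free_lin f (p + q) = free_lin f p + free_lin f q"
proof -
  let ?S = "Poly_Mapping.keys p \<union> Poly_Mapping.keys q"
  have "Poly_Mapping.keys (p + q) \<subseteq> ?S" by (rule keys_add)
  then have "free_lin f (p + q) = (\<Sum>m\<in>?S. Poly_Mapping.lookup (p + q) m *\<^sub>C f m)"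
    by (intro free_lin_superset) auto
  also have "\<dots> = free_lin f p + free_lin f q"
    by (simp add: lookup_add scaleC_add_left sum.distrib free_lin_superset[of ?S])
  finally show ?thesis .
qed

lemma free_lin_zero [simp]: "free_lin f 0 = 0"
  by (simp add: free_lin_def)

lemma free_lin_one: "free_lin f 1 = f 0"
  by (metis free_lin_single single_one scaleC_one)

lemma clinear_free_lin: "clinear (free_lin f)"
  unfolding clinear_def
proof (intro conjI allI)
  fix c p
  show "free_lin f (c *\<^sub>C p) = c *\<^sub>C free_lin f p"
    by (induction p rule: poly_mapping_single_induct)
      (simp_all add: scaleC_single free_lin_add scaleC_add_right scaleC_complex_def scaleC_scaleC)
qed (rule free_lin_add)

lemma star_hom_free_lin:
  fixes f :: "'m::involutive_monoid \<Rightarrow> 'b::complex_star_algebra"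
  assumes "f 0 = 1" "\<And>a b. f (a + b) = f a * f b" "\<And>a. f (flip a) = star (f a)"
  shows "star_hom (free_lin f)"
  unfolding star_hom_def
proof (intro conjI allI)
  show "clinear (free_lin f)" by (rule clinear_free_lin)
  show "free_lin f 1 = 1"
    by (simp add: free_lin_one assms)
  fix x y :: "'m \<Rightarrow>\<^sub>0 complex"
  show "free_lin f (x * y) = free_lin f x * free_lin f y"
  proof (induction x rule: poly_mapping_single_induct)
    case (2 m d)
    show ?case
      by (induction y rule: poly_mapping_single_induct)
        (simp_all add: mult_single assms mult_scaleC_left mult_scaleC_right scaleC_scaleC
          distrib_left free_lin_add mult.commute[of d])
  qed (simp_all add: distrib_right free_lin_add)
  show "free_lin f (star x) = star (free_lin f x)"
    by (induction x rule: poly_mapping_single_induct)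
      (simp_all add: star_single star_complex_def assms star_scaleC free_lin_add star_add)
qed


section \<open>*-algebras given by generators and relations\<close>

inductive_set star_ideal :: "'a::complex_star_algebra set \<Rightarrow> 'a set" for R where
  star_ideal_zero: "0 \<in> star_ideal R"
| star_ideal_base: "r \<in> R \<Longrightarrow> r \<in> star_ideal R"
| star_ideal_add: "x \<in> star_ideal R \<Longrightarrow> y \<in> star_ideal R \<Longrightarrow> x + y \<in> star_ideal R"
| star_ideal_left: "x \<in> star_ideal R \<Longrightarrow> a * x \<in> star_ideal R"
| star_ideal_right: "x \<in> star_ideal R \<Longrightarrow> x * a \<in> star_ideal R"
| star_ideal_star: "x \<in> star_ideal R \<Longrightarrow> star x \<in> star_ideal R"

lemma star_ideal_minus: "x \<in> star_ideal R \<Longrightarrow> - x \<in> star_ideal R"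
  using star_ideal_left[of x R "-1"] by simp

lemma star_ideal_diff: "x \<in> star_ideal R \<Longrightarrow> y \<in> star_ideal R \<Longrightarrow> x - y \<in> star_ideal R"
  using star_ideal_add[OF _ star_ideal_minus] by fastforce

lemma star_ideal_scaleC: "x \<in> star_ideal R \<Longrightarrow> c *\<^sub>C x \<in> star_ideal R"
  using star_ideal_left[of x R "c *\<^sub>C 1"] by (simp add: mult_scaleC_left)

lemma star_hom_star_ideal:
  assumes "star_hom f" "\<And>r. r \<in> R \<Longrightarrow> f r = 0" "x \<in> star_ideal R"
  shows "f x = 0"
  using assms(3)
  by induction (simp_all add: assms(2) clinear_zero clinear_add star_hom_clinear[OF assms(1)]
      star_hom_mult[OF assms(1)] star_hom_star[OF assms(1)])

lemma equivp_star_ideal: "equivp (\<lambda>x y. x - y \<in> star_ideal R)"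
proof (rule equivpI)
  show "reflp (\<lambda>x y. x - y \<in> star_ideal R)"
    by (rule reflpI) (simp add: star_ideal_zero)
  show "symp (\<lambda>x y. x - y \<in> star_ideal R)"
    by (rule sympI) (metis minus_diff_eq star_ideal_minus)
  show "transp (\<lambda>x y. x - y \<in> star_ideal R)"
  proof (rule transpI)
    fix x y z assume "x - y \<in> star_ideal R" "y - z \<in> star_ideal R"
    then have "(x - y) + (y - z) \<in> star_ideal R" by (rule star_ideal_add)
    then show "x - z \<in> star_ideal R" by simp
  qed
qed

text \<open>The class is one of involutive monoids: the dummy type is inferred to have that sort,
  which cannot be named here because the axiom refers to the monoid algebra.\<close>
class presentation =
  fixes relators :: "(_ \<Rightarrow>\<^sub>0 complex) set"
  assumes one_notin_star_ideal: "1 \<notin> star_ideal relators"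

quotient_type (overloaded) 'm presented = "'m::presentation \<Rightarrow>\<^sub>0 complex" /
  "\<lambda>x y. x - y \<in> star_ideal relators"
  morphisms rep_presented abs_presented
  by (rule equivp_star_ideal)

instantiation presented :: (presentation) complex_star_algebra
begin
lift_definition zero_presented :: "'a presented" is 0 .
lift_definition one_presented :: "'a presented" is 1 .
lift_definition plus_presented :: "'a presented \<Rightarrow> 'a presented \<Rightarrow> 'a presented" is "(+)"
  by (drule (1) star_ideal_add) (simp add: algebra_simps)
lift_definition uminus_presented :: "'a presented \<Rightarrow> 'a presented" is uminus
  by (drule star_ideal_minus) (simp add: algebra_simps)
lift_definition minus_presented :: "'a presented \<Rightarrow> 'a presented \<Rightarrow> 'a presented" is "(-)"
  by (drule (1) star_ideal_diff) (simp add: algebra_simps)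
lift_definition times_presented :: "'a presented \<Rightarrow> 'a presented \<Rightarrow> 'a presented" is "(*)"
proof -
  fix a a' b b' :: "'a \<Rightarrow>\<^sub>0 complex"
  assume "a - a' \<in> star_ideal relators" "b - b' \<in> star_ideal relators"
  then have "(a - a') * b + a' * (b - b') \<in> star_ideal relators"
    by (intro star_ideal_add star_ideal_left star_ideal_right)
  then show "a * b - a' * b' \<in> star_ideal relators" by (simp add: algebra_simps)
qed
lift_definition scaleC_presented :: "complex \<Rightarrow> 'a presented \<Rightarrow> 'a presented" is scaleC
  by (drule star_ideal_scaleC) (simp add: scaleC_diff_right)
lift_definition star_presented :: "'a presented \<Rightarrow> 'a presented" is star
  by (drule star_ideal_star) (simp add: star_diff)
instance
proof
  show "(0::'a presented) \<noteq> 1"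
    by transfer (use star_ideal_minus one_notin_star_ideal in force)
qed (transfer; simp add: algebra_simps star_ideal_zero scaleC_add_right scaleC_add_left
      scaleC_scaleC scaleC_one mult_scaleC_left mult_scaleC_right star_add star_scaleC
      star_mult star_star)+
end

lift_definition gen :: "'m::presentation \<Rightarrow> 'm presented" is "\<lambda>m. Poly_Mapping.single m 1" .

text \<open>The extension of \<^term>\<open>f\<close> to the presented algebra, meaningful if \<^term>\<open>free_lin f\<close>
  vanishes on the relations.\<close>
definition presented_ext :: "('m::presentation \<Rightarrow> 'v::complex_vector) \<Rightarrow> 'm presented \<Rightarrow> 'v" where
  "presented_ext f x = free_lin f (rep_presented x)"

lemma presented_ext_abs:
  assumes "\<And>p. p \<in> star_ideal relators \<Longrightarrow> free_lin f p = 0"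
  shows "presented_ext f (abs_presented p) = free_lin f p"
proof -
  have "rep_presented (abs_presented p) - p \<in> star_ideal relators"
    by (rule Quotient3_rep_abs[OF Quotient3_presented])(simp add: star_ideal_zero)
  from assms[OF this] show ?thesis
    by (simp add: presented_ext_def clinear_diff[OF clinear_free_lin])
qed

lemma presented_ext_gen:
  assumes "\<And>p. p \<in> star_ideal relators \<Longrightarrow> free_lin f p = 0"
  shows "presented_ext f (gen m) = f m"
  using presented_ext_abs[of f "Poly_Mapping.single m 1", OF assms]
  by (simp add: gen.abs_eq scaleC_one)

lemma clinear_presented_ext:
  assumes "\<And>p. p \<in> star_ideal relators \<Longrightarrow> free_lin f p = 0"
  shows "clinear (presented_ext f)"
  unfolding clinear_def
proof (intro conjI allI)
  fix x y :: "'a presented" and c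
  obtain p q where "x = abs_presented p" "y = abs_presented q"
    by (metis Quotient3_abs_rep[OF Quotient3_presented])
  then show "presented_ext f (x + y) = presented_ext f x + presented_ext f y"
    "presented_ext f (c *\<^sub>C x) = c *\<^sub>C presented_ext f x"
    by (simp_all add: plus_presented.abs_eq scaleC_presented.abs_eq presented_ext_abs[OF assms]
        clinear_add[OF clinear_free_lin] clinear_scaleC[OF clinear_free_lin])
qed

lemma star_hom_presented_ext:
  fixes f :: "'m::presentation \<Rightarrow> 'b::complex_star_algebra"
  assumes "f 0 = 1" "\<And>a b. f (a + b) = f a * f b" "\<And>a. f (flip a) = star (f a)"
    and "\<And>r. r \<in> relators \<Longrightarrow> free_lin f r = 0"
  shows "star_hom (presented_ext f)" "presented_ext f (gen m) = f m"
proof -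
  have hom: "star_hom (free_lin f)" by (rule star_hom_free_lin) (fact assms)+
  have kill: "\<And>p. p \<in> star_ideal relators \<Longrightarrow> free_lin f p = 0"
    by (rule star_hom_star_ideal[OF hom assms(4)])
  show "presented_ext f (gen m) = f m" by (rule presented_ext_gen[OF kill])
  show "star_hom (presented_ext f)"
    unfolding star_hom_def
  proof (intro conjI allI)
    show "clinear (presented_ext f)" by (rule clinear_presented_ext[OF kill])
    show "presented_ext f 1 = 1"
      by (simp add: one_presented.abs_eq presented_ext_abs[OF kill] star_hom_one[OF hom])
    fix x y :: "'m presented"
    obtain p q where "x = abs_presented p" "y = abs_presented q"
      by (metis Quotient3_abs_rep[OF Quotient3_presented])
    then show "presented_ext f (x * y) = presented_ext f x * presented_ext f y"
      "presented_ext f (star x) = star (presented_ext f x)"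
      by (simp_all add: times_presented.abs_eq star_presented.abs_eq presented_ext_abs[OF kill]
          star_hom_mult[OF hom] star_hom_star[OF hom])
  qed
qed

lemma presented_induct [case_names zero gen add]:
  assumes "P 0" "\<And>c m. P (c *\<^sub>C gen m)" "\<And>x y. P x \<Longrightarrow> P y \<Longrightarrow> P (x + y)"
  shows "P (x :: 'm::presentation presented)"
proof -
  have "P (abs_presented p)" for p
  proof (induction p rule: poly_mapping_single_induct)
    case 1
    then show ?case using assms(1) by (simp add: zero_presented.abs_eq)
  next
    case (2 m c)
    have "c *\<^sub>C gen m = abs_presented (Poly_Mapping.single m c)"
      by (simp add: gen.abs_eq scaleC_presented.abs_eq scaleC_single scaleC_complex_def)
    then show ?case using assms(2)[of c m] by simp
  next
    case (3 x y)
    then show ?case using assms(3) by (simp add: plus_presented.abs_eq[symmetric])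
  qed
  then show ?thesis by (metis Quotient3_abs_rep[OF Quotient3_presented])
qed

lemma gen_add: "gen (a + b) = gen a * gen b"
  by transfer (simp add: mult_single star_ideal_zero)

lemma gen_zero: "gen 0 = 1"
  by transfer (simp add: star_ideal_zero)

lemma gen_flip: "gen (flip a) = star (gen a)"
  by transfer (simp add: star_single star_complex_def star_ideal_zero)


section \<open>The algebraic tensor product\<close>

datatype ('a, 'b) elementary = Elem 'a 'b

instantiation elementary :: (complex_star_algebra, complex_star_algebra) involutive_monoid
begin
definition zero_elementary :: "('a, 'b) elementary" where "0 = Elem 1 1"
fun plus_elementary :: "('a, 'b) elementary \<Rightarrow> ('a, 'b) elementary \<Rightarrow> ('a, 'b) elementary" where
  "Elem a b + Elem c d = Elem (a * c) (b * d)"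
fun flip_elementary :: "('a, 'b) elementary \<Rightarrow> ('a, 'b) elementary" where
  "flip (Elem a b) = Elem (star a) (star b)"
instance
proof
  fix x y z :: "('a, 'b) elementary"
  show "x + y + z = x + (y + z)" by (cases x; cases y; cases z) (simp add: mult.assoc)
  show "0 + x = x" "x + 0 = x" by (cases x; simp add: zero_elementary_def)+
  show "flip (x + y) = flip y + flip x" by (cases x; cases y) (simp add: star_mult)
  show "flip (flip x) = x" by (cases x) (simp add: star_star)
qed
end

definition tensor_relators ::
  "(('a::complex_star_algebra, 'b::complex_star_algebra) elementary \<Rightarrow>\<^sub>0 complex) set" where
  "tensor_relators =
     (let e = (\<lambda>a b. Poly_Mapping.single (Elem a b) 1) in
        {e (a + a') b - e a b - e a' b | a a' b. True}
      \<union> {e a (b + b') - e a b - e a b' | a b b'. True}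
      \<union> {e (c *\<^sub>C a) b - c *\<^sub>C e a b | c a b. True}
      \<union> {e a (c *\<^sub>C b) - c *\<^sub>C e a b | c a b. True})"

definition cbilinear ::
  "(('a::complex_vector, 'b::complex_vector) elementary \<Rightarrow> 'v::complex_vector) \<Rightarrow> bool" where
  "cbilinear \<beta> \<longleftrightarrow> (\<forall>b. clinear (\<lambda>a. \<beta> (Elem a b))) \<and> (\<forall>a. clinear (\<lambda>b. \<beta> (Elem a b)))"

lemma cbilinear_kills_tensor_relators:
  assumes "cbilinear \<beta>" "r \<in> tensor_relators"
  shows "free_lin \<beta> r = 0"
  using assms
  by (auto simp: tensor_relators_def Let_def cbilinear_def clinear_diff[OF clinear_free_lin]
      clinear_scaleC[OF clinear_free_lin] scaleC_one clinear_def)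

lemma star_tensor_relators: "r \<in> tensor_relators \<Longrightarrow> star r \<in> tensor_relators"
  unfolding tensor_relators_def Let_def Un_iff
  apply (elim disjE)
  subgoal
    apply (rule disjI1, rule disjI1, rule disjI1)
    apply (clarsimp simp: star_diff star_single star_complex_def star_add)
    apply blast
    done
  subgoal
    apply (rule disjI1, rule disjI1, rule disjI2)
    apply (clarsimp simp: star_diff star_single star_complex_def star_add)
    apply blast
    done
  subgoal
    apply (rule disjI1, rule disjI2)
    apply (clarsimp simp: star_diff star_single star_complex_def star_scaleC)
    apply blast
    done
  subgoal
    apply (rule disjI2)
    apply (clarsimp simp: star_diff star_single star_complex_def star_scaleC)
    apply blast
    done
  done

lemma free_lin_single_mult:
  "free_lin f (Poly_Mapping.single m c * p) = c *\<^sub>C free_lin (\<lambda>x. f (m + x)) p"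
  by (induction p rule: poly_mapping_single_induct)
    (simp_all add: mult_single scaleC_scaleC distrib_left free_lin_add scaleC_add_right)

lemma free_lin_mult_single:
  "free_lin f (p * Poly_Mapping.single m c) = c *\<^sub>C free_lin (\<lambda>x. f (x + m)) p"
  by (induction p rule: poly_mapping_single_induct)
    (simp_all add: mult_single scaleC_scaleC distrib_right free_lin_add scaleC_add_right mult.commute)

lemma cbilinear_kills_tensor_ideal:
  fixes \<beta> :: "('a::complex_star_algebra, 'b::complex_star_algebra) elementary \<Rightarrow> 'v::complex_vector"
  assumes "cbilinear \<beta>" "p \<in> star_ideal tensor_relators"
  shows "free_lin \<beta> p = 0"
proof -
  define K where "K = {p. \<forall>\<beta>::('a, 'b) elementary \<Rightarrow> 'v. cbilinear \<beta> \<longrightarrow> free_lin \<beta> p = 0}"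
  have K_zero: "0 \<in> K" and K_add: "\<And>x y. x \<in> K \<Longrightarrow> y \<in> K \<Longrightarrow> x + y \<in> K"
    by (simp_all add: K_def free_lin_add)
  have K_left: "x * y \<in> K" if "y \<in> K" for x y
  proof (induction x rule: poly_mapping_single_induct)
    case (2 m c)
    obtain a b where m: "m = Elem a b" by (cases m)
    have "cbilinear (\<lambda>x. \<beta> (m + x))" if "cbilinear \<beta>" for \<beta> :: "('a, 'b) elementary \<Rightarrow> 'v"
      using that unfolding cbilinear_def clinear_def m
      by (simp add: distrib_left mult_scaleC_right)
    then show ?case using that by (simp add: K_def free_lin_single_mult)
  qed (simp_all add: distrib_right K_zero K_add)
  have K_right: "y * x \<in> K" if "y \<in> K" for x y
  proof (induction x rule: poly_mapping_single_induct)
    case (2 m c)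
    obtain a b where m: "m = Elem a b" by (cases m)
    have "cbilinear (\<lambda>x. \<beta> (x + m))" if "cbilinear \<beta>" for \<beta> :: "('a, 'b) elementary \<Rightarrow> 'v"
      using that unfolding cbilinear_def clinear_def m
      by (simp add: distrib_right mult_scaleC_left)
    then show ?case using that by (simp add: K_def free_lin_mult_single)
  qed (simp_all add: distrib_left K_zero K_add)
  from assms(2) have "p \<in> K \<and> star p \<in> K"
  proof induction
    case (star_ideal_base r)
    then show ?case
      by (simp add: K_def cbilinear_kills_tensor_relators star_tensor_relators)
  qed (simp_all add: K_zero K_add K_left K_right star_add star_mult star_star)
  then show ?thesis using assms(1) by (simp add: K_def)
qed

lemma exists_unital_functional:
  "\<exists>f :: 'a::complex_star_algebra \<Rightarrow> complex. clinear f \<and> f 1 = 1"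
proof -
  interpret V: vector_space "scaleC :: complex \<Rightarrow> 'a \<Rightarrow> 'a" by (rule clinear_scaleC_module)
  interpret C: vector_space "(*) :: complex \<Rightarrow> complex \<Rightarrow> complex"
    by unfold_locales (simp_all add: algebra_simps)
  interpret VC: vector_space_pair "scaleC :: complex \<Rightarrow> 'a \<Rightarrow> 'a" "(*) :: complex \<Rightarrow> complex \<Rightarrow> complex" ..
  have "V.independent {1::'a}" by simp
  then obtain g where g: "Vector_Spaces.linear scaleC (*) g" "g (1::'a) = (1::complex)"
    using VC.linear_independent_extend[of "{1}" "\<lambda>_. 1"] by auto
  then have "clinear g"
    by (simp add: clinear_def scaleC_complex_def Vector_Spaces.linear.axioms
        VC.linear_add VC.linear_scale)
  with g(2) show ?thesis by blast
qed

instantiation elementary :: (complex_star_algebra, complex_star_algebra) presentation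
begin
definition relators_elementary :: "(('a, 'b) elementary \<Rightarrow>\<^sub>0 complex) set" where
  "relators_elementary = tensor_relators"
instance
proof
  obtain f :: "'a \<Rightarrow> complex" and g :: "'b \<Rightarrow> complex"
    where fg: "clinear f" "f 1 = 1" "clinear g" "g 1 = 1"
    using exists_unital_functional by metis
  define \<beta> where "\<beta> = (\<lambda>e. case e of Elem a b \<Rightarrow> f a * g b)"
  have "cbilinear \<beta>"
    using fg by (simp add: cbilinear_def clinear_def \<beta>_def scaleC_complex_def algebra_simps)
  moreover have "free_lin \<beta> 1 = 1"
    using fg by (simp add: free_lin_one \<beta>_def zero_elementary_def)
  ultimately show "(1 :: ('a, 'b) elementary \<Rightarrow>\<^sub>0 complex) \<notin> star_ideal relators"
    using cbilinear_kills_tensor_ideal[of \<beta> 1] by (auto simp: relators_elementary_def)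
qed
end

text \<open>Since \<^const>\<open>tensor_relators\<close> is stable under the multiplication of elementary tensors,
  the ideal it generates is its linear span, so this is the usual tensor product of vector spaces,
  with product \<open>(a \<otimes> b)(c \<otimes> d) = ac \<otimes> bd\<close> and involution \<open>(a \<otimes> b)* = a* \<otimes> b*\<close>.\<close>
type_synonym ('a, 'b) tensor = "('a, 'b) elementary presented"

definition tensor ::
  "'a::complex_star_algebra \<Rightarrow> 'b::complex_star_algebra \<Rightarrow> ('a, 'b) tensor" (infixr \<open>\<otimes>\<^sub>t\<close> 70)
  where "a \<otimes>\<^sub>t b = gen (Elem a b)"

lemma tensor_mult: "(a \<otimes>\<^sub>t b) * (c \<otimes>\<^sub>t d) = (a * c) \<otimes>\<^sub>t (b * d)"
  by (simp add: tensor_def gen_add[symmetric])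

lemma tensor_one: "1 \<otimes>\<^sub>t 1 = 1"
  by (simp add: tensor_def gen_zero[symmetric] zero_elementary_def)

lemma tensor_star: "star (a \<otimes>\<^sub>t b) = star a \<otimes>\<^sub>t star b"
  by (simp add: tensor_def gen_flip[symmetric])

lemma abs_presented_tensor: "abs_presented (Poly_Mapping.single (Elem a b) 1) = a \<otimes>\<^sub>t b"
  by (simp add: tensor_def gen.abs_eq)

lemma abs_presented_eq_0: "p \<in> star_ideal relators \<Longrightarrow> abs_presented p = 0"
  by (simp add: zero_presented.abs_eq presented.abs_eq_iff)

lemma tensor_add_left: "(a + a') \<otimes>\<^sub>t b = a \<otimes>\<^sub>t b + a' \<otimes>\<^sub>t b"
proof -
  have "abs_presented (Poly_Mapping.single (Elem (a + a') b) 1 - Poly_Mapping.single (Elem a b) 1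
      - Poly_Mapping.single (Elem a' b) 1) = 0"
    by (rule abs_presented_eq_0, rule star_ideal_base)
      (force simp: relators_elementary_def tensor_relators_def)
  then show ?thesis
    by (simp add: minus_presented.abs_eq[symmetric] plus_presented.abs_eq[symmetric]
        abs_presented_tensor algebra_simps)
qed

lemma tensor_add_right: "a \<otimes>\<^sub>t (b + b') = a \<otimes>\<^sub>t b + a \<otimes>\<^sub>t b'"
proof -
  have "abs_presented (Poly_Mapping.single (Elem a (b + b')) 1 - Poly_Mapping.single (Elem a b) 1
      - Poly_Mapping.single (Elem a b') 1) = 0"
    by (rule abs_presented_eq_0, rule star_ideal_base)
      (force simp: relators_elementary_def tensor_relators_def)
  then show ?thesis
    by (simp add: minus_presented.abs_eq[symmetric] plus_presented.abs_eq[symmetric]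
        abs_presented_tensor algebra_simps)
qed

lemma tensor_scaleC_left: "(c *\<^sub>C a) \<otimes>\<^sub>t b = c *\<^sub>C (a \<otimes>\<^sub>t b)"
proof -
  have "abs_presented (Poly_Mapping.single (Elem (c *\<^sub>C a) b) 1
      - c *\<^sub>C Poly_Mapping.single (Elem a b) 1) = 0"
    by (rule abs_presented_eq_0, rule star_ideal_base)
      (unfold relators_elementary_def tensor_relators_def Let_def, blast)
  then show ?thesis
    by (simp add: minus_presented.abs_eq[symmetric] scaleC_presented.abs_eq[symmetric]
        abs_presented_tensor)
qed

lemma tensor_scaleC_right: "a \<otimes>\<^sub>t (c *\<^sub>C b) = c *\<^sub>C (a \<otimes>\<^sub>t b)"
proof -
  have "abs_presented (Poly_Mapping.single (Elem a (c *\<^sub>C b)) 1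
      - c *\<^sub>C Poly_Mapping.single (Elem a b) 1) = 0"
    by (rule abs_presented_eq_0, rule star_ideal_base)
      (unfold relators_elementary_def tensor_relators_def Let_def, blast)
  then show ?thesis
    by (simp add: minus_presented.abs_eq[symmetric] scaleC_presented.abs_eq[symmetric]
        abs_presented_tensor)
qed

lemma tensor_zero_left [simp]: "0 \<otimes>\<^sub>t b = 0"
  using tensor_add_left[of 0 0 b] by simp

lemma tensor_zero_right [simp]: "a \<otimes>\<^sub>t 0 = 0"
  using tensor_add_right[of a 0 0] by simp

lemma tensor_sum_left: "(\<Sum>i\<in>A. f i) \<otimes>\<^sub>t b = (\<Sum>i\<in>A. f i \<otimes>\<^sub>t b)"
  by (induction A rule: infinite_finite_induct) (simp_all add: tensor_add_left)

lemma tensor_sum_right: "a \<otimes>\<^sub>t (\<Sum>i\<in>A. f i) = (\<Sum>i\<in>A. a \<otimes>\<^sub>t f i)"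
  by (induction A rule: infinite_finite_induct) (simp_all add: tensor_add_right)

text \<open>The slice maps \<open>\<phi> \<otimes> id\<close> and \<open>id \<otimes> \<phi>\<close> of a linear functional \<open>\<phi>\<close>.\<close>

definition slice_left ::
  "('a::complex_star_algebra \<Rightarrow> complex) \<Rightarrow> ('a, 'b::complex_star_algebra) tensor \<Rightarrow> 'b" where
  "slice_left \<phi> = presented_ext (\<lambda>e. case e of Elem a b \<Rightarrow> \<phi> a *\<^sub>C b)"

definition slice_right ::
  "('b::complex_star_algebra \<Rightarrow> complex) \<Rightarrow> ('a::complex_star_algebra, 'b) tensor \<Rightarrow> 'a" where
  "slice_right \<phi> = presented_ext (\<lambda>e. case e of Elem a b \<Rightarrow> \<phi> b *\<^sub>C a)"

lemma cbilinear_presented_ext: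
  assumes "cbilinear \<beta>"
  shows "clinear (presented_ext \<beta>)" "presented_ext \<beta> (a \<otimes>\<^sub>t b) = \<beta> (Elem a b)"
  using cbilinear_kills_tensor_ideal[OF assms]
  by (auto simp: tensor_def relators_elementary_def intro!: clinear_presented_ext presented_ext_gen)

lemma slice_left:
  assumes "clinear \<phi>"
  shows "clinear (slice_left \<phi>)" "slice_left \<phi> (a \<otimes>\<^sub>t b) = \<phi> a *\<^sub>C b"
proof -
  have "cbilinear (\<lambda>e. case e of Elem a b \<Rightarrow> \<phi> a *\<^sub>C b)"
    using assms by (simp add: cbilinear_def clinear_def scaleC_add_left scaleC_add_right
        scaleC_scaleC scaleC_complex_def mult.commute)
  from cbilinear_presented_ext[OF this]
  show "clinear (slice_left \<phi>)" "slice_left \<phi> (a \<otimes>\<^sub>t b) = \<phi> a *\<^sub>C b"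
    by (simp_all add: slice_left_def)
qed

lemma slice_right:
  assumes "clinear \<phi>"
  shows "clinear (slice_right \<phi>)" "slice_right \<phi> (a \<otimes>\<^sub>t b) = \<phi> b *\<^sub>C a"
proof -
  have "cbilinear (\<lambda>e. case e of Elem a b \<Rightarrow> \<phi> b *\<^sub>C a)"
    using assms by (simp add: cbilinear_def clinear_def scaleC_add_left scaleC_add_right
        scaleC_scaleC scaleC_complex_def mult.commute)
  from cbilinear_presented_ext[OF this]
  show "clinear (slice_right \<phi>)" "slice_right \<phi> (a \<otimes>\<^sub>t b) = \<phi> b *\<^sub>C a"
    by (simp_all add: slice_right_def)
qed


section \<open>The *-algebra of the quantum hyperoctahedral group\<close>

text \<open>The index type \<^typ>\<open>'n\<close> has \<open>N\<close> elements. A family \<open>u\<close> satisfies the defining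
  relations iff all these elements vanish.\<close>
definition hyp_relators :: "('n::finite \<Rightarrow> 'n \<Rightarrow> 'a::complex_star_algebra) \<Rightarrow> 'a set" where
  "hyp_relators u =
     {star (u i j) - u i j | i j. True}
   \<union> {u i j * u i k - (if j = k then (u i j)\<^sup>2 else 0) | i j k. True}
   \<union> {u i j * u k j - (if i = k then (u i j)\<^sup>2 else 0) | i j k. True}
   \<union> {star ((u i j)\<^sup>2) - (u i j)\<^sup>2 | i j. True}
   \<union> {(u i j)\<^sup>2 * (u i l)\<^sup>2 - (if j = l then (u i j)\<^sup>2 else 0) | i j l. True}
   \<union> {(u i j)\<^sup>2 * (u l j)\<^sup>2 - (if i = l then (u i j)\<^sup>2 else 0) | i j l. True}
   \<union> {(\<Sum>k\<in>UNIV. (u k j)\<^sup>2) - 1 | j. True}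
   \<union> {(\<Sum>k\<in>UNIV. (u i k)\<^sup>2) - 1 | i. True}"

text \<open>A letter \<open>((i, j), s)\<close> stands for \<open>u\<^bsub>ij\<^esub>\<close> if \<open>s\<close> is false and for its adjoint if
  \<open>s\<close> is true; words multiply by concatenation.\<close>
datatype 'n hyp_word = Word "(('n \<times> 'n) \<times> bool) list"

instantiation hyp_word :: (type) involutive_monoid
begin
definition zero_hyp_word :: "'a hyp_word" where "0 = Word []"
fun plus_hyp_word :: "'a hyp_word \<Rightarrow> 'a hyp_word \<Rightarrow> 'a hyp_word" where
  "Word v + Word w = Word (v @ w)"
fun flip_hyp_word :: "'a hyp_word \<Rightarrow> 'a hyp_word" where
  "flip (Word w) = Word (rev (map (\<lambda>(x, s). (x, \<not> s)) w))"
instance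
proof
  fix x y z :: "'a hyp_word"
  show "x + y + z = x + (y + z)" by (cases x; cases y; cases z) simp
  show "0 + x = x" "x + 0 = x" by (cases x; simp add: zero_hyp_word_def)+
  show "flip (x + y) = flip y + flip x" by (cases x; cases y) simp
  have "map ((\<lambda>(x, s). (x, \<not> s)) \<circ> (\<lambda>(x, s). (x, \<not> s))) w = w" for w :: "(('a \<times> 'a) \<times> bool) list"
    by (rule map_idI) auto
  then show "flip (flip x) = x" by (cases x) (simp add: rev_map)
qed
end

fun hyp_eval :: "('n \<Rightarrow> 'n \<Rightarrow> 'a::complex_star_algebra) \<Rightarrow> 'n hyp_word \<Rightarrow> 'a" where
  "hyp_eval v (Word w) = prod_list (map (\<lambda>((i, j), s). if s then star (v i j) else v i j) w)"

lemma hyp_eval_zero: "hyp_eval v 0 = 1"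
  by (simp add: zero_hyp_word_def)

lemma hyp_eval_add: "hyp_eval v (a + b) = hyp_eval v a * hyp_eval v b"
  by (cases a; cases b) simp

lemma hyp_eval_flip: "hyp_eval v (flip a) = star (hyp_eval v a)"
proof (cases a)
  case (Word w)
  have "hyp_eval v (flip (Word w)) = star (hyp_eval v (Word w))"
    by (induction w) (auto simp: star_mult star_star)
  then show ?thesis using Word by simp
qed

lemmas star_hom_free_lin_hyp_eval =
  star_hom_free_lin[of "hyp_eval v" for v, OF hyp_eval_zero hyp_eval_add hyp_eval_flip]

definition hyp_letter :: "'n \<Rightarrow> 'n \<Rightarrow> 'n hyp_word \<Rightarrow>\<^sub>0 complex" where
  "hyp_letter i j = Poly_Mapping.single (Word [((i, j), False)]) 1"

lemma star_hom_diff: "star_hom f \<Longrightarrow> f (x - y) = f x - f y"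
  and star_hom_add: "star_hom f \<Longrightarrow> f (x + y) = f x + f y"
  and star_hom_sum: "star_hom f \<Longrightarrow> f (\<Sum>i\<in>A. g i) = (\<Sum>i\<in>A. f (g i))"
  and star_hom_zero: "star_hom f \<Longrightarrow> f 0 = 0"
  and star_hom_power2: "star_hom f \<Longrightarrow> f (x\<^sup>2) = (f x)\<^sup>2"
  by (simp_all add: star_hom_clinear clinear_diff clinear_add clinear_sum clinear_zero
      star_hom_mult power2_eq_square)

lemma star_hom_hyp_relators:
  assumes "star_hom f" "r \<in> hyp_relators v"
  shows "f r \<in> hyp_relators (\<lambda>i j. f (v i j))"
proof -
  note h = star_hom_diff[OF assms(1)] star_hom_sum[OF assms(1)] star_hom_zero[OF assms(1)]
    star_hom_power2[OF assms(1)] star_hom_mult[OF assms(1)] star_hom_star[OF assms(1)]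
    star_hom_one[OF assms(1)] if_distrib[of f]
  from assms(2) show ?thesis
    unfolding hyp_relators_def Un_iff
    by (elim disjE CollectE exE conjE; simp only: h; blast)
qed

lemma hyp_relators_diag:
  assumes "c * c = (1::complex)" "cnj c = c"
  shows "hyp_relators (\<lambda>i j::'n::finite. if i = j then c else 0) \<subseteq> {0}"
proof -
  have "(if i = j then c else 0)\<^sup>2 = (if i = j then 1 else 0)" for i j :: 'n
    using assms by (simp add: power2_eq_square)
  then show ?thesis
    using assms by (auto simp: hyp_relators_def star_complex_def power2_eq_square)
qed

instantiation hyp_word :: (finite) presentation
begin
definition relators_hyp_word :: "('a hyp_word \<Rightarrow>\<^sub>0 complex) set" where
  "relators_hyp_word = hyp_relators hyp_letter"
instance
proof
  let ?v = "\<lambda>i j::'a. if i = j then (1::complex) else 0"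
  let ?f = "free_lin (hyp_eval ?v)"
  have hom: "star_hom ?f" by (rule star_hom_free_lin_hyp_eval)
  have "?f (hyp_letter i j) = ?v i j" for i j
    by (simp add: hyp_letter_def scaleC_one)
  then have "?f r = 0" if "r \<in> relators" for r
    using star_hom_hyp_relators[OF hom, of r hyp_letter] hyp_relators_diag[of 1] that
    by (auto simp: relators_hyp_word_def)
  then show "(1 :: 'a hyp_word \<Rightarrow>\<^sub>0 complex) \<notin> star_ideal relators"
    using star_hom_star_ideal[OF hom, of relators 1] star_hom_one[OF hom] by auto
qed
end

type_synonym 'n pol_hyp = "'n hyp_word presented"

definition u_gen :: "'n::finite \<Rightarrow> 'n \<Rightarrow> 'n pol_hyp" where
  "u_gen i j = gen (Word [((i, j), False)])"

text \<open>The extension of \<open>u\<^bsub>ij\<^esub> \<mapsto> v\<^bsub>ij\<^esub>\<close> to a unital *-homomorphism.\<close>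
definition hyp_ext :: "('n::finite \<Rightarrow> 'n \<Rightarrow> 'a::complex_star_algebra) \<Rightarrow> 'n pol_hyp \<Rightarrow> 'a" where
  "hyp_ext v = presented_ext (hyp_eval v)"

lemma star_hom_hyp_ext:
  assumes "hyp_relators v \<subseteq> {0}"
  shows "star_hom (hyp_ext v)" "hyp_ext v (u_gen i j) = v i j"
proof -
  have hom: "star_hom (free_lin (hyp_eval v))" by (rule star_hom_free_lin_hyp_eval)
  have "free_lin (hyp_eval v) (hyp_letter i j) = v i j" for i j
    by (simp add: hyp_letter_def scaleC_one)
  then have "free_lin (hyp_eval v) r = 0" if "r \<in> relators" for r
    using star_hom_hyp_relators[OF hom, of r hyp_letter] that assms
    by (auto simp: relators_hyp_word_def)
  note * = star_hom_presented_ext[of "hyp_eval v", OF hyp_eval_zero hyp_eval_add hyp_eval_flip this]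
  show "star_hom (hyp_ext v)" unfolding hyp_ext_def by (rule *(1))
  show "hyp_ext v (u_gen i j) = v i j" by (simp add: hyp_ext_def u_gen_def *(2))
qed

lemma hyp_hom_unique:
  fixes f g :: "'n::finite pol_hyp \<Rightarrow> 'a::complex_star_algebra"
  assumes "star_hom f" "star_hom g" "\<And>i j. f (u_gen i j) = g (u_gen i j)"
  shows "f = g"
proof
  fix x
  have eq: "f (gen (Word w)) = g (gen (Word w))" for w
  proof (induction w)
    case Nil
    show ?case using star_hom_one[OF assms(1)] star_hom_one[OF assms(2)]
      by (simp add: zero_hyp_word_def[symmetric] gen_zero)
  next
    case (Cons l w)
    obtain i j s where l: "l = ((i, j), s)" by (metis prod.exhaust)
    have "gen (Word [l]) = (if s then star (u_gen i j) else u_gen i j)"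
      by (simp add: l u_gen_def gen_flip[symmetric])
    then have "f (gen (Word [l])) = g (gen (Word [l]))"
      by (simp add: assms(3) star_hom_star[OF assms(1)] star_hom_star[OF assms(2)])
    moreover have "gen (Word (l # w)) = gen (Word [l]) * gen (Word w)"
      by (simp add: gen_add[symmetric])
    ultimately show ?case
      by (simp add: star_hom_mult[OF assms(1)] star_hom_mult[OF assms(2)] Cons)
  qed
  show "f x = g x"
  proof (induction x rule: presented_induct)
    case (gen c m)
    then show ?case using eq
      by (cases m) (simp add: star_hom_clinear[OF assms(1)] star_hom_clinear[OF assms(2)]
          clinear_scaleC)
  qed (simp_all add: star_hom_zero star_hom_add assms(1,2))
qed

lemma hyp_relators_u: "hyp_relators (u_gen :: 'n::finite \<Rightarrow> _) \<subseteq> {0}"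
proof
  fix r assume r: "r \<in> hyp_relators (u_gen :: 'n \<Rightarrow> _)"
  have hom: "star_hom (abs_presented :: _ \<Rightarrow> 'n pol_hyp)"
    by (simp add: star_hom_def clinear_def plus_presented.abs_eq scaleC_presented.abs_eq
        times_presented.abs_eq star_presented.abs_eq one_presented.abs_eq)
  have u_gen: "u_gen i j = abs_presented (hyp_letter i j)" for i j :: 'n
    by (simp add: u_gen_def hyp_letter_def gen.abs_eq)
  note h = star_hom_diff[OF hom, symmetric] star_hom_sum[OF hom, symmetric]
    star_hom_power2[OF hom, symmetric] star_hom_mult[OF hom, symmetric]
    star_hom_star[OF hom, symmetric] star_hom_one[OF hom, symmetric]
    star_hom_zero[OF hom, symmetric] if_distrib[of abs_presented, symmetric]
  have "\<exists>p \<in> relators. r = abs_presented p"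
    using r unfolding hyp_relators_def Un_iff u_gen relators_hyp_word_def
    by (elim disjE CollectE exE conjE; simp only: h; blast)
  then show "r \<in> {0}"
    using abs_presented_eq_0 star_ideal_base by auto
qed


section \<open>Coproduct, counit and the alternating character\<close>

lemma hyp_relators_iff:
  "hyp_relators v \<subseteq> {0} \<longleftrightarrow>
     (\<forall>i j. star (v i j) = v i j)
   \<and> (\<forall>i j k. v i j * v i k = (if j = k then (v i j)\<^sup>2 else 0))
   \<and> (\<forall>i j k. v i j * v k j = (if i = k then (v i j)\<^sup>2 else 0))
   \<and> (\<forall>i j. star ((v i j)\<^sup>2) = (v i j)\<^sup>2)
   \<and> (\<forall>i j l. (v i j)\<^sup>2 * (v i l)\<^sup>2 = (if j = l then (v i j)\<^sup>2 else 0))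
   \<and> (\<forall>i j l. (v i j)\<^sup>2 * (v l j)\<^sup>2 = (if i = l then (v i j)\<^sup>2 else 0))
   \<and> (\<forall>j. (\<Sum>k\<in>UNIV. (v k j)\<^sup>2) = 1)
   \<and> (\<forall>i. (\<Sum>k\<in>UNIV. (v i k)\<^sup>2) = 1)"
proof -
  have *: "{f x | x. True} \<subseteq> {0} \<longleftrightarrow> (\<forall>x. f x = 0)" for f :: "'x \<Rightarrow> 'r::zero" by auto
  have **: "{f x y | x y. True} \<subseteq> {0} \<longleftrightarrow> (\<forall>x y. f x y = 0)" for f :: "'x \<Rightarrow> 'y \<Rightarrow> 'r::zero" by auto
  have ***: "{f x y z | x y z. True} \<subseteq> {0} \<longleftrightarrow> (\<forall>x y z. f x y z = 0)"
    for f :: "'x \<Rightarrow> 'y \<Rightarrow> 'z \<Rightarrow> 'r::zero" by auto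
  show ?thesis
    unfolding hyp_relators_def Un_subset_iff * ** *** right_minus_eq by (simp only: conj_assoc)
qed

lemmas u_rels = hyp_relators_u[unfolded hyp_relators_iff]

lemma star_u: "star (u_gen i j) = u_gen i j" using u_rels by blast
lemma u_row: "u_gen i j * u_gen i k = (if j = k then (u_gen i j)\<^sup>2 else 0)" using u_rels by blast
lemma u_col: "u_gen i j * u_gen k j = (if i = k then (u_gen i j)\<^sup>2 else 0)" using u_rels by blast
lemma p_row: "(u_gen i j)\<^sup>2 * (u_gen i l)\<^sup>2 = (if j = l then (u_gen i j)\<^sup>2 else 0)" using u_rels by blast
lemma p_col: "(u_gen i j)\<^sup>2 * (u_gen l j)\<^sup>2 = (if i = l then (u_gen i j)\<^sup>2 else 0)" using u_rels by blast
lemma p_sum_col: "(\<Sum>k\<in>UNIV. (u_gen k j)\<^sup>2) = 1" using u_rels by blast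
lemma p_sum_row: "(\<Sum>k\<in>UNIV. (u_gen i k)\<^sup>2) = 1" using u_rels by blast

definition comult :: "'n::finite pol_hyp \<Rightarrow> ('n pol_hyp, 'n pol_hyp) tensor" where
  "comult = hyp_ext (\<lambda>i j. \<Sum>k\<in>UNIV. u_gen i k \<otimes>\<^sub>t u_gen k j)"

definition counit :: "'n::finite pol_hyp \<Rightarrow> complex" where
  "counit = hyp_ext (\<lambda>i j. if i = j then 1 else 0)"

definition eps_alt :: "'n::finite pol_hyp \<Rightarrow> complex" where
  "eps_alt = hyp_ext (\<lambda>i j. if i = j then -1 else 0)"

lemma hyp_relators_comult:
  "hyp_relators (\<lambda>i j::'n::finite. \<Sum>k\<in>UNIV. u_gen i k \<otimes>\<^sub>t u_gen k j) \<subseteq> {0}"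
proof -
  define v where "v = (\<lambda>i j::'n. \<Sum>k\<in>UNIV. u_gen i k \<otimes>\<^sub>t u_gen k j)"
  have star: "star (v i j) = v i j" for i j
    by (simp add: v_def star_sum tensor_star star_u)
  have prod: "(\<Sum>k\<in>UNIV. a k \<otimes>\<^sub>t b k) * (\<Sum>k\<in>UNIV. c k \<otimes>\<^sub>t d k)
      = (\<Sum>k\<in>UNIV. \<Sum>m\<in>UNIV. (a k * c m) \<otimes>\<^sub>t (b k * d m))"
    for a b c d :: "'n \<Rightarrow> 'n pol_hyp"
    by (simp add: sum_product tensor_mult)
  have delta: "(\<Sum>m\<in>UNIV. (if k = m then x else 0) \<otimes>\<^sub>t f m) = x \<otimes>\<^sub>t f k"
    "(\<Sum>m\<in>UNIV. f m \<otimes>\<^sub>t (if k = m then x else 0)) = f k \<otimes>\<^sub>t x"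
    for k :: 'n and x :: "'n pol_hyp" and f :: "'n \<Rightarrow> 'n pol_hyp"
    by (subst sum.remove[of _ k]; simp)+
  have row: "v i j * v i l = (if j = l then \<Sum>k\<in>UNIV. (u_gen i k)\<^sup>2 \<otimes>\<^sub>t (u_gen k j)\<^sup>2 else 0)" for i j l
    by (simp add: v_def prod u_row delta)
  have col: "v i j * v l j = (if i = l then \<Sum>k\<in>UNIV. (u_gen i k)\<^sup>2 \<otimes>\<^sub>t (u_gen k j)\<^sup>2 else 0)" for i j l
    by (simp add: v_def prod u_col delta)
  have sq: "(v i j)\<^sup>2 = (\<Sum>k\<in>UNIV. (u_gen i k)\<^sup>2 \<otimes>\<^sub>t (u_gen k j)\<^sup>2)" for i j
    using row[of i j j] by (simp add: power2_eq_square)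
  have prow: "(v i j)\<^sup>2 * (v i l)\<^sup>2 = (if j = l then (v i j)\<^sup>2 else 0)" for i j l
    by (simp add: sq prod p_row delta)
  have pcol: "(v i j)\<^sup>2 * (v l j)\<^sup>2 = (if i = l then (v i j)\<^sup>2 else 0)" for i j l
    by (simp add: sq prod p_col delta)
  have scol: "(\<Sum>k\<in>UNIV. (v k j)\<^sup>2) = 1" for j
    unfolding sq
    by (subst sum.swap) (simp add: tensor_sum_left[symmetric] p_sum_col tensor_sum_right[symmetric] tensor_one)
  have srow: "(\<Sum>k\<in>UNIV. (v i k)\<^sup>2) = 1" for i
    unfolding sq
    by (subst sum.swap) (simp add: tensor_sum_right[symmetric] p_sum_row tensor_sum_left[symmetric] tensor_one)
  have row': "v i j * v i l = (if j = l then (v i j)\<^sup>2 else 0)"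
    and col': "v i j * v l j = (if i = l then (v i j)\<^sup>2 else 0)" for i j l
    by (simp_all only: row col sq)
  have star2: "star ((v i j)\<^sup>2) = (v i j)\<^sup>2" for i j
    by (simp add: power2_eq_square star_mult star)
  have "hyp_relators v \<subseteq> {0}"
    unfolding hyp_relators_iff using star row' col' star2 prow pcol scol srow by blast
  then show ?thesis by (simp add: v_def)
qed

lemma star_hom_comult: "star_hom comult"
  unfolding comult_def by (rule star_hom_hyp_ext(1)[OF hyp_relators_comult])

lemma comult_u: "comult (u_gen i j) = (\<Sum>k\<in>UNIV. u_gen i k \<otimes>\<^sub>t u_gen k j)"
  unfolding comult_def by (rule star_hom_hyp_ext(2)[OF hyp_relators_comult])

lemma star_hom_counit: "star_hom counit"
  unfolding counit_def by (rule star_hom_hyp_ext(1)[OF hyp_relators_diag]) simp_all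

lemma counit_u: "counit (u_gen i j) = (if i = j then 1 else 0)"
  unfolding counit_def by (rule star_hom_hyp_ext(2)[OF hyp_relators_diag]) simp_all

lemma star_hom_eps_alt: "star_hom eps_alt"
  unfolding eps_alt_def by (rule star_hom_hyp_ext(1)[OF hyp_relators_diag]) simp_all

lemma eps_alt_u: "eps_alt (u_gen i j) = (if i = j then -1 else 0)"
  unfolding eps_alt_def by (rule star_hom_hyp_ext(2)[OF hyp_relators_diag]) simp_all


section \<open>Representations, Haar state, tracial and central functionals\<close>

definition adj_mat :: "'a::complex_star_algebra mat \<Rightarrow> 'a mat" where
  "adj_mat U = map_mat star (transpose_mat U)"

definition scalar_mat :: "complex mat \<Rightarrow> 'a::complex_star_algebra mat" where
  "scalar_mat T = map_mat (\<lambda>c. c *\<^sub>C 1) T"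

definition unitary_mat :: "'a::complex_star_algebra mat \<Rightarrow> bool" where
  "unitary_mat U \<longleftrightarrow> square_mat U
     \<and> U * adj_mat U = 1\<^sub>m (dim_row U) \<and> adj_mat U * U = 1\<^sub>m (dim_row U)"

definition unitary_rep ::
  "('a::complex_star_algebra \<Rightarrow> ('a, 'a) tensor) \<Rightarrow> 'a mat \<Rightarrow> bool" where
  "unitary_rep \<Delta> U \<longleftrightarrow> unitary_mat U
     \<and> (\<forall>i<dim_row U. \<forall>j<dim_row U.
          \<Delta> (U $$ (i, j)) = (\<Sum>k<dim_row U. U $$ (i, k) \<otimes>\<^sub>t U $$ (k, j)))"

text \<open>The range of an orthogonal projection \<open>e\<close> is an invariant subspace iff
  \<open>(e \<otimes> 1) U (e \<otimes> 1) = U (e \<otimes> 1)\<close>.\<close>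
definition irreducible_rep ::
  "('a::complex_star_algebra \<Rightarrow> ('a, 'a) tensor) \<Rightarrow> 'a mat \<Rightarrow> bool" where
  "irreducible_rep \<Delta> U \<longleftrightarrow> unitary_rep \<Delta> U \<and> 0 < dim_row U
     \<and> (\<forall>e \<in> carrier_mat (dim_row U) (dim_row U).
          adj_mat e = e \<and> e * e = e \<and> scalar_mat e * U * scalar_mat e = U * scalar_mat e
          \<longrightarrow> e = 0\<^sub>m (dim_row U) (dim_row U) \<or> e = 1\<^sub>m (dim_row U))"

definition equivalent_rep :: "'a::complex_star_algebra mat \<Rightarrow> 'a mat \<Rightarrow> bool" where
  "equivalent_rep U V \<longleftrightarrow> dim_row U = dim_row V
     \<and> (\<exists>T \<in> carrier_mat (dim_row U) (dim_row U).
          unitary_mat T \<and> scalar_mat T * U = V * scalar_mat T)"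

text \<open>One representative from each equivalence class of irreducible unitary representations.\<close>
definition irr_representatives ::
  "('a::complex_star_algebra \<Rightarrow> ('a, 'a) tensor) \<Rightarrow> 'a mat set \<Rightarrow> bool" where
  "irr_representatives \<Delta> Irr \<longleftrightarrow> (\<forall>U\<in>Irr. irreducible_rep \<Delta> U)
     \<and> (\<forall>V. irreducible_rep \<Delta> V \<longrightarrow> (\<exists>!U. U \<in> Irr \<and> equivalent_rep U V))"

text \<open>The state that is invariant from the left and from the right.\<close>
definition haar_state ::
  "('a::complex_star_algebra \<Rightarrow> ('a, 'a) tensor) \<Rightarrow> ('a \<Rightarrow> complex) \<Rightarrow> bool" where
  "haar_state \<Delta> h \<longleftrightarrow> clinear h \<and> h 1 = 1 \<and> (\<forall>a. h (star a * a) \<in> \<real>\<^sub>\<ge>\<^sub>0)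
     \<and> (\<forall>a. slice_left h (\<Delta> a) = h a *\<^sub>C 1 \<and> slice_right h (\<Delta> a) = h a *\<^sub>C 1)"

definition tracial :: "('a::complex_star_algebra \<Rightarrow> complex) \<Rightarrow> bool" where
  "tracial \<phi> \<longleftrightarrow> (\<forall>a b. \<phi> (a * b) = \<phi> (b * a))"

definition central :: "'a::complex_star_algebra mat set \<Rightarrow> ('a \<Rightarrow> complex) \<Rightarrow> bool" where
  "central Irr \<phi> \<longleftrightarrow> (\<forall>U\<in>Irr. \<exists>c. \<forall>i<dim_row U. \<forall>j<dim_row U.
     \<phi> (U $$ (i, j)) = (if i = j then c else 0))"


section \<open>The universal C*-algebra\<close>

definition cstar_seminorm :: "('a::complex_star_algebra \<Rightarrow> real) \<Rightarrow> bool" where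
  "cstar_seminorm p \<longleftrightarrow>
     (\<forall>x y. p (x + y) \<le> p x + p y) \<and> (\<forall>c x. p (c *\<^sub>C x) = cmod c * p x)
   \<and> (\<forall>x y. p (x * y) \<le> p x * p y) \<and> (\<forall>x. p (star x * x) = (p x)\<^sup>2)"

text \<open>The C*-seminorms are the functions \<open>x \<mapsto> \<parallel>\<pi>(x)\<parallel>\<close> for *-representations \<open>\<pi>\<close>
  on Hilbert spaces, so this is the universal C*-seminorm.\<close>
definition unorm :: "'a::complex_star_algebra \<Rightarrow> real" where
  "unorm x = Sup {p x | p. cstar_seminorm p}"

context
  fixes p :: "'a::complex_star_algebra \<Rightarrow> real"
  assumes p: "cstar_seminorm p"
begin

lemma cs_add: "p (x + y) \<le> p x + p y"
  and cs_scaleC: "p (c *\<^sub>C x) = cmod c * p x"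
  and cs_mult: "p (x * y) \<le> p x * p y"
  and cs_star_mult: "p (star x * x) = (p x)\<^sup>2"
  using p by (auto simp: cstar_seminorm_def)

lemma cs_zero: "p 0 = 0"
  using cs_scaleC[of 0 0] by simp

lemma cs_minus: "p (- x) = p x"
  using cs_scaleC[of "-1" x] by (simp add: scaleC_minus_one)

lemma cs_nonneg: "0 \<le> p x"
  using cs_add[of x "- x"] by (simp add: cs_zero cs_minus)

lemma cs_diff: "p (x - y) \<le> p x + p y"
  using cs_add[of x "- y"] by (simp add: cs_minus)

lemma cs_diff_commute: "p (x - y) = p (y - x)"
  using cs_minus[of "x - y"] by simp

lemma cs_star: "p (star x) = p x"
proof -
  have *: "p x \<le> p (star x)" for x
  proof (cases "p x = 0")
    case False
    have "p x * p x \<le> p (star x) * p x"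
      using cs_mult[of "star x" x] by (simp add: cs_star_mult power2_eq_square)
    with False show ?thesis using cs_nonneg[of x] by simp
  qed (simp add: cs_nonneg)
  from *[of x] *[of "star x"] show ?thesis by (simp add: star_star)
qed

lemma cs_projection: "star x * x = x \<Longrightarrow> p x \<le> 1"
  using cs_star_mult[of x] by (auto simp: power2_eq_square)

lemma cs_one: "p 1 \<le> 1"
  by (rule cs_projection) simp

lemma cs_triangle: "p (x - z) \<le> p (x - y) + p (y - z)"
  using cs_add[of "x - y" "y - z"] by simp

lemma cs_abs_diff: "\<bar>p x - p y\<bar> \<le> p (x - y)"
  using cs_add[of "x - y" y] cs_add[of "y - x" x] cs_diff_commute[of x y] by simp

lemma cs_mult_diff: "p (x * y - x' * y') \<le> p (x - x') * p y + p x' * p (y - y')"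
proof -
  have "x * y - x' * y' = (x - x') * y + x' * (y - y')" by (simp add: algebra_simps)
  then show ?thesis
    using cs_add[of "(x - x') * y" "x' * (y - y')"] cs_mult[of "x - x'" y] cs_mult[of x' "y - y'"]
    by simp
qed

end

lemma cstar_seminorm_zero: "cstar_seminorm (\<lambda>_. 0)"
  by (simp add: cstar_seminorm_def)

lemma cstar_seminorm_counit: "cstar_seminorm (\<lambda>x. cmod (counit x))"
  unfolding cstar_seminorm_def
  by (simp add: star_hom_mult[OF star_hom_counit] star_hom_star[OF star_hom_counit]
      clinear_add[OF star_hom_clinear[OF star_hom_counit]]
      clinear_scaleC[OF star_hom_clinear[OF star_hom_counit]]
      scaleC_complex_def star_complex_def norm_mult norm_triangle_ineq power2_eq_square)

lemma cs_u_le: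
  assumes p: "cstar_seminorm p"
  shows "p (u_gen i j) \<le> 1"
proof -
  have "star ((u_gen i j)\<^sup>2) * (u_gen i j)\<^sup>2 = (u_gen i j)\<^sup>2"
    using p_row[of i j j] by (simp add: power2_eq_square star_mult star_u)
  from cs_projection[OF p this] have "p (star (u_gen i j) * u_gen i j) \<le> 1"
    by (simp add: power2_eq_square star_u)
  then show ?thesis
    using cs_nonneg[OF p] by (simp add: cs_star_mult[OF p] power_le_one_iff)
qed

lemma cs_bounded: "\<exists>K. \<forall>p. cstar_seminorm p \<longrightarrow> p x \<le> K"
  for x :: "'n::finite pol_hyp"
proof (induction x rule: presented_induct)
  case zero
  have "p 0 \<le> 0" if "cstar_seminorm p" for p :: "'n pol_hyp \<Rightarrow> real"
    using cs_zero[OF that] by simp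
  then show ?case by blast
next
  case (gen c m)
  have "p (gen (Word w)) \<le> 1" if p: "cstar_seminorm p" for w and p :: "'n pol_hyp \<Rightarrow> real"
  proof (induction w)
    case Nil
    then show ?case using cs_one[OF p] by (simp add: gen_zero zero_hyp_word_def[symmetric])
  next
    case (Cons l w)
    obtain i j s where l: "l = ((i, j), s)" by (metis prod.exhaust)
    have "gen (Word [l]) = u_gen i j"
      using star_u[of i j] by (cases s) (simp_all add: l u_gen_def gen_flip[symmetric])
    moreover have "gen (Word (l # w)) = gen (Word [l]) * gen (Word w)"
      by (simp add: gen_add[symmetric])
    ultimately have "p (gen (Word (l # w))) \<le> p (u_gen i j) * p (gen (Word w))"
      using cs_mult[OF p] by simp
    also have "\<dots> \<le> 1"
      using cs_u_le[OF p, of i j] Cons by (intro mult_le_one cs_nonneg[OF p])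
    finally show ?case .
  qed
  then have "p (gen m) \<le> 1" if "cstar_seminorm p" for p
    using that by (cases m) auto
  then have "p (c *\<^sub>C gen m) \<le> cmod c" if "cstar_seminorm p" for p
    using that by (simp add: cs_scaleC[OF that] mult_left_le)
  then show ?case by blast
next
  case (add x y)
  then obtain K L where "p x \<le> K" "p y \<le> L" if "cstar_seminorm p" for p by metis
  then have "p (x + y) \<le> K + L" if "cstar_seminorm p" for p
    using cs_add[OF that, of x y] that by fastforce
  then show ?case by blast
qed

lemma cs_le_unorm: "cstar_seminorm p \<Longrightarrow> p x \<le> unorm x" for x :: "'n::finite pol_hyp"
proof -
  assume "cstar_seminorm p"
  moreover obtain K where "\<forall>p. cstar_seminorm p \<longrightarrow> p x \<le> K" using cs_bounded[of x] by blast
  ultimately show ?thesis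
    unfolding unorm_def by (intro cSup_upper bdd_aboveI[of _ K]) auto
qed

lemma unorm_le: "(\<And>p. cstar_seminorm p \<Longrightarrow> p x \<le> K) \<Longrightarrow> unorm x \<le> K"
  unfolding unorm_def by (intro cSup_least) (use cstar_seminorm_zero in auto)

lemma cstar_seminorm_unorm: "cstar_seminorm (unorm :: 'n::finite pol_hyp \<Rightarrow> real)"
  unfolding cstar_seminorm_def
proof (intro conjI allI)
  fix x y :: "'n pol_hyp" and c
  have nonneg: "0 \<le> unorm x" for x :: "'n pol_hyp"
    using cs_le_unorm[OF cstar_seminorm_zero] .
  show "unorm (x + y) \<le> unorm x + unorm y"
  proof (rule unorm_le)
    fix p :: "'n pol_hyp \<Rightarrow> real" assume p: "cstar_seminorm p"
    have "p (x + y) \<le> p x + p y" by (rule cs_add[OF p])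
    also have "\<dots> \<le> unorm x + unorm y" by (intro add_mono cs_le_unorm p)
    finally show "p (x + y) \<le> unorm x + unorm y" .
  qed
  have scale_le: "unorm (c *\<^sub>C x) \<le> cmod c * unorm x" for c and x :: "'n pol_hyp"
  proof (rule unorm_le)
    fix p :: "'n pol_hyp \<Rightarrow> real" assume p: "cstar_seminorm p"
    have "p (c *\<^sub>C x) = cmod c * p x" by (rule cs_scaleC[OF p])
    also have "\<dots> \<le> cmod c * unorm x" by (intro mult_left_mono cs_le_unorm p norm_ge_zero)
    finally show "p (c *\<^sub>C x) \<le> cmod c * unorm x" .
  qed
  show "unorm (c *\<^sub>C x) = cmod c * unorm x"
  proof (cases "c = 0")
    case True
    then show ?thesis using scale_le[of c x] nonneg[of "c *\<^sub>C x"] by simp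
  next
    case False
    have "unorm x \<le> cmod (inverse c) * unorm (c *\<^sub>C x)"
      using scale_le[of "inverse c" "c *\<^sub>C x"] False by (simp add: scaleC_scaleC scaleC_one)
    from mult_left_mono[OF this, of "cmod c"] have "cmod c * unorm x \<le> unorm (c *\<^sub>C x)"
      using False by (simp add: norm_inverse mult.assoc[symmetric])
    with scale_le[of c x] show ?thesis by simp
  qed
  show "unorm (x * y) \<le> unorm x * unorm y"
  proof (rule unorm_le)
    fix p :: "'n pol_hyp \<Rightarrow> real" assume p: "cstar_seminorm p"
    have "p (x * y) \<le> p x * p y" by (rule cs_mult[OF p])
    also have "\<dots> \<le> unorm x * unorm y"
      by (intro mult_mono cs_le_unorm p cs_nonneg[OF p] nonneg)
    finally show "p (x * y) \<le> unorm x * unorm y" .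
  qed
  show "unorm (star x * x) = (unorm x)\<^sup>2"
  proof (rule antisym)
    show "unorm (star x * x) \<le> (unorm x)\<^sup>2"
    proof (rule unorm_le)
      fix p :: "'n pol_hyp \<Rightarrow> real" assume p: "cstar_seminorm p"
      have "p (star x * x) = (p x)\<^sup>2" by (rule cs_star_mult[OF p])
      also have "\<dots> \<le> (unorm x)\<^sup>2" by (intro power_mono cs_le_unorm p cs_nonneg[OF p])
      finally show "p (star x * x) \<le> (unorm x)\<^sup>2" .
    qed
    have "unorm x \<le> sqrt (unorm (star x * x))"
    proof (rule unorm_le)
      fix p :: "'n pol_hyp \<Rightarrow> real" assume p: "cstar_seminorm p"
      have "(p x)\<^sup>2 \<le> unorm (star x * x)"
        using cs_le_unorm[OF p, of "star x * x"] by (simp add: cs_star_mult[OF p])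
      then show "p x \<le> sqrt (unorm (star x * x))" by (rule real_le_rsqrt)
    qed
    then show "(unorm x)\<^sup>2 \<le> unorm (star x * x)"
      using nonneg by (metis power_mono real_sqrt_pow2)
  qed
qed

lemmas un_simps =
  cs_zero[OF cstar_seminorm_unorm] cs_minus[OF cstar_seminorm_unorm]
  cs_scaleC[OF cstar_seminorm_unorm] cs_star[OF cstar_seminorm_unorm]
  cs_star_mult[OF cstar_seminorm_unorm] cs_nonneg[OF cstar_seminorm_unorm]

lemmas un_add = cs_add[OF cstar_seminorm_unorm]
lemmas un_mult = cs_mult[OF cstar_seminorm_unorm]
lemmas un_nonneg = cs_nonneg[OF cstar_seminorm_unorm]
lemmas un_mult_diff = cs_mult_diff[OF cstar_seminorm_unorm]
lemmas un_triangle = cs_triangle[OF cstar_seminorm_unorm]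
lemmas un_commute = cs_diff_commute[OF cstar_seminorm_unorm]
lemmas un_abs_diff = cs_abs_diff[OF cstar_seminorm_unorm]

lemma un_one: "unorm (1 :: 'n::finite pol_hyp) = 1"
  using cs_one[OF cstar_seminorm_unorm[where 'n = 'n]]
    cs_le_unorm[OF cstar_seminorm_counit, of "1 :: 'n pol_hyp"]
  by (simp add: star_hom_one[OF star_hom_counit])

definition un_Cauchy :: "(nat \<Rightarrow> 'n::finite pol_hyp) \<Rightarrow> bool" where
  "un_Cauchy X \<longleftrightarrow> (\<forall>e>0. \<exists>N. \<forall>m\<ge>N. \<forall>n\<ge>N. unorm (X m - X n) < e)"

definition un_rel :: "(nat \<Rightarrow> 'n::finite pol_hyp) \<Rightarrow> (nat \<Rightarrow> 'n pol_hyp) \<Rightarrow> bool" where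
  "un_rel X Y \<longleftrightarrow> un_Cauchy X \<and> un_Cauchy Y \<and> (\<lambda>n. unorm (X n - Y n)) \<longlonglongrightarrow> 0"

lemma un_CauchyI:
  assumes "un_Cauchy X" "0 \<le> K" "\<And>m n. unorm (Y m - Y n) \<le> K * unorm (X m - X n)"
  shows "un_Cauchy Y"
  unfolding un_Cauchy_def
proof (intro allI impI)
  fix e :: real assume "0 < e"
  then have "0 < e / (K + 1)" using assms(2) by simp
  then obtain N where N: "\<And>m n. m \<ge> N \<Longrightarrow> n \<ge> N \<Longrightarrow> unorm (X m - X n) < e / (K + 1)"
    using assms(1) unfolding un_Cauchy_def by blast
  have "unorm (Y m - Y n) < e" if "m \<ge> N" "n \<ge> N" for m n
  proof -
    have "unorm (Y m - Y n) \<le> K * unorm (X m - X n)" by (rule assms(3))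
    also have "\<dots> \<le> K * (e / (K + 1))"
      using N[OF that] assms(2) by (intro mult_left_mono) auto
    also have "\<dots> < e" using \<open>0 < e\<close> assms(2) by (simp add: field_simps)
    finally show ?thesis .
  qed
  then show "\<exists>N. \<forall>m\<ge>N. \<forall>n\<ge>N. unorm (Y m - Y n) < e" by blast
qed

lemma un_CauchyI2:
  assumes "un_Cauchy X" "un_Cauchy Y" "0 \<le> K" "0 \<le> L"
    and "\<And>m n. unorm (Z m - Z n) \<le> K * unorm (X m - X n) + L * unorm (Y m - Y n)"
  shows "un_Cauchy Z"
  unfolding un_Cauchy_def
proof (intro allI impI)
  fix e :: real assume "0 < e"
  define d where "d = e / (K + L + 1)"
  have d: "0 < d" "(K + L) * d < e"
    using \<open>0 < e\<close> assms(3,4) by (simp_all add: d_def field_simps)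
  obtain N where N: "\<And>m n. m \<ge> N \<Longrightarrow> n \<ge> N \<Longrightarrow> unorm (X m - X n) < d"
    using assms(1) d(1) unfolding un_Cauchy_def by blast
  obtain M where M: "\<And>m n. m \<ge> M \<Longrightarrow> n \<ge> M \<Longrightarrow> unorm (Y m - Y n) < d"
    using assms(2) d(1) unfolding un_Cauchy_def by blast
  have "unorm (Z m - Z n) < e" if "m \<ge> max M N" "n \<ge> max M N" for m n
  proof -
    have "unorm (Z m - Z n) \<le> K * unorm (X m - X n) + L * unorm (Y m - Y n)" by (rule assms(5))
    also have "\<dots> \<le> K * d + L * d"
      using N[of m n] M[of m n] that assms(3,4) by (intro add_mono mult_left_mono) auto
    also have "\<dots> < e" using d(2) by (simp add: algebra_simps)
    finally show ?thesis .
  qed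
  then show "\<exists>N. \<forall>m\<ge>N. \<forall>n\<ge>N. unorm (Z m - Z n) < e" by blast
qed

lemma un_Cauchy_const: "un_Cauchy (\<lambda>_. a)"
  by (simp add: un_Cauchy_def un_simps)

lemma un_Cauchy_bounded:
  assumes "un_Cauchy X"
  obtains K where "0 \<le> K" "\<And>n. unorm (X n) \<le> K"
proof -
  obtain N where N: "\<And>m n. m \<ge> N \<Longrightarrow> n \<ge> N \<Longrightarrow> unorm (X m - X n) < 1"
    using assms unfolding un_Cauchy_def by (elim allE[of _ 1]) auto
  define K where "K = (\<Sum>n\<le>N. unorm (X n)) + 1"
  have le: "unorm (X n) \<le> (\<Sum>n\<le>N. unorm (X n))" if "n \<le> N" for n
    using that by (intro member_le_sum) (auto simp: un_nonneg)
  have "unorm (X n) \<le> K" for n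
  proof (cases "n \<le> N")
    case True
    then show ?thesis using le[of n] by (simp add: K_def)
  next
    case False
    have "unorm (X n) \<le> unorm (X n - X N) + unorm (X N)"
      using un_add[of "X n - X N" "X N"] by simp
    also have "\<dots> \<le> K" using N[of n N] False le[of N] by (simp add: K_def)
    finally show ?thesis .
  qed
  moreover have "0 \<le> K" by (auto simp: K_def intro!: add_nonneg_nonneg sum_nonneg un_nonneg)
  ultimately show thesis using that by blast
qed

lemma un_convergent: "un_Cauchy X \<Longrightarrow> convergent (\<lambda>n. unorm (X n))"
proof (rule real_Cauchy_convergent, rule metric_CauchyI)
  fix e :: real assume "un_Cauchy X" "0 < e"
  then obtain N where "\<forall>m\<ge>N. \<forall>n\<ge>N. unorm (X m - X n) < e"
    unfolding un_Cauchy_def by blast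
  then show "\<exists>M. \<forall>m\<ge>M. \<forall>n\<ge>M. dist (unorm (X m)) (unorm (X n)) < e"
    unfolding dist_real_def using le_less_trans[OF un_abs_diff] by blast
qed

lemma null_squeeze:
  fixes f g :: "nat \<Rightarrow> real"
  assumes "g \<longlonglongrightarrow> 0" "\<And>n. 0 \<le> f n" "\<And>n. f n \<le> g n"
  shows "f \<longlonglongrightarrow> 0"
  by (rule tendsto_sandwich[OF _ _ tendsto_const assms(1)]) (use assms in auto)

lemma un_rel_refl: "un_Cauchy X \<Longrightarrow> un_rel X X"
  by (simp add: un_rel_def un_simps)

lemma un_rel_lipschitz:
  assumes "un_rel X X'" "0 \<le> K"
    and "\<And>m n. unorm (f (X m) - f (X n)) \<le> K * unorm (X m - X n)"
    and "\<And>m n. unorm (f (X' m) - f (X' n)) \<le> K * unorm (X' m - X' n)"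
    and "\<And>n. unorm (f (X n) - f (X' n)) \<le> K * unorm (X n - X' n)"
  shows "un_rel (\<lambda>n. f (X n)) (\<lambda>n. f (X' n))"
proof -
  have "(\<lambda>n. K * unorm (X n - X' n)) \<longlonglongrightarrow> 0"
    using assms(1) by (auto simp: un_rel_def intro!: tendsto_mult_right_zero)
  then have "(\<lambda>n. unorm (f (X n) - f (X' n))) \<longlonglongrightarrow> 0"
    by (rule null_squeeze) (use assms in \<open>auto simp: un_nonneg\<close>)
  then show ?thesis
    using assms un_CauchyI[of X K "\<lambda>n. f (X n)"] un_CauchyI[of X' K "\<lambda>n. f (X' n)"]
    by (auto simp: un_rel_def)
qed

lemma un_rel_lipschitz2:
  assumes "un_rel X X'" "un_rel Y Y'" "0 \<le> K" "0 \<le> L"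
    and "\<And>m n. unorm (f (X m) (Y m) - f (X n) (Y n)) \<le> K * unorm (X m - X n) + L * unorm (Y m - Y n)"
    and "\<And>m n. unorm (f (X' m) (Y' m) - f (X' n) (Y' n))
      \<le> K * unorm (X' m - X' n) + L * unorm (Y' m - Y' n)"
    and "\<And>n. unorm (f (X n) (Y n) - f (X' n) (Y' n)) \<le> K * unorm (X n - X' n) + L * unorm (Y n - Y' n)"
  shows "un_rel (\<lambda>n. f (X n) (Y n)) (\<lambda>n. f (X' n) (Y' n))"
proof -
  have "(\<lambda>n. K * unorm (X n - X' n) + L * unorm (Y n - Y' n)) \<longlonglongrightarrow> 0"
    using assms(1,2) by (auto simp: un_rel_def intro!: tendsto_add_zero tendsto_mult_right_zero)
  then have "(\<lambda>n. unorm (f (X n) (Y n) - f (X' n) (Y' n))) \<longlonglongrightarrow> 0"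
    by (rule null_squeeze) (use assms in \<open>auto simp: un_nonneg\<close>)
  then show ?thesis
    using assms un_CauchyI2[of X Y K L "\<lambda>n. f (X n) (Y n)"]
      un_CauchyI2[of X' Y' K L "\<lambda>n. f (X' n) (Y' n)"]
    by (auto simp: un_rel_def)
qed

lemma un_rel_add: "un_rel X X' \<Longrightarrow> un_rel Y Y' \<Longrightarrow> un_rel (\<lambda>n. X n + Y n) (\<lambda>n. X' n + Y' n)"
  by (rule un_rel_lipschitz2[where f = "(+)" and K = 1 and L = 1])
    (auto simp: add_diff_add un_add)

lemma un_rel_uminus: "un_rel X X' \<Longrightarrow> un_rel (\<lambda>n. - X n) (\<lambda>n. - X' n)"
  by (rule un_rel_lipschitz[where f = uminus and K = 1]) (auto simp: un_commute)

lemma un_rel_diff: "un_rel X X' \<Longrightarrow> un_rel Y Y' \<Longrightarrow> un_rel (\<lambda>n. X n - Y n) (\<lambda>n. X' n - Y' n)"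
  using un_rel_add[OF _ un_rel_uminus, of X X' Y Y'] by simp

lemma un_rel_scaleC: "un_rel X X' \<Longrightarrow> un_rel (\<lambda>n. c *\<^sub>C X n) (\<lambda>n. c *\<^sub>C X' n)"
  by (rule un_rel_lipschitz[where f = "scaleC c" and K = "cmod c"])
    (auto simp: scaleC_diff_right[symmetric] un_simps)

lemma un_rel_star: "un_rel X X' \<Longrightarrow> un_rel (\<lambda>n. star (X n)) (\<lambda>n. star (X' n))"
  by (rule un_rel_lipschitz[where f = star and K = 1]) (auto simp: star_diff[symmetric] un_simps)

lemma un_rel_mult:
  fixes X :: "nat \<Rightarrow> 'n::finite pol_hyp"
  assumes "un_rel X X'" "un_rel Y Y'"
  shows "un_rel (\<lambda>n. X n * Y n) (\<lambda>n. X' n * Y' n)"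
proof -
  have C: "un_Cauchy X" "un_Cauchy X'" "un_Cauchy Y" "un_Cauchy Y'"
    using assms by (simp_all add: un_rel_def)
  obtain K where K: "0 \<le> K" "\<And>n. unorm (X n) \<le> K" 
    using un_Cauchy_bounded[OF C(1)] by blast
  obtain K' where K': "0 \<le> K'" "\<And>n. unorm (X' n) \<le> K'" 
    using un_Cauchy_bounded[OF C(2)] by blast
  obtain L where L: "0 \<le> L" "\<And>n. unorm (Y n) \<le> L" 
    using un_Cauchy_bounded[OF C(3)] by blast
  obtain L' where L': "0 \<le> L'" "\<And>n. unorm (Y' n) \<le> L'" 
    using un_Cauchy_bounded[OF C(4)] by blast
  have bound: "unorm (x * y - x' * y') \<le> (L + L') * unorm (x - x') + (K + K') * unorm (y - y')"
    if "unorm y \<le> L + L'" "unorm x' \<le> K + K'" for x y x' y' :: "'n pol_hyp"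
  proof -
    have "unorm (x - x') * unorm y \<le> (L + L') * unorm (x - x')"
      using mult_left_mono[OF that(1) un_nonneg[of "x - x'"]] by (simp add: mult.commute)
    moreover have "unorm x' * unorm (y - y') \<le> (K + K') * unorm (y - y')"
      using that(2) by (intro mult_right_mono un_nonneg)
    ultimately show ?thesis using un_mult_diff[of x y x' y'] by linarith
  qed
  have "unorm (X n) \<le> K + K'" "unorm (X' n) \<le> K + K'" "unorm (Y n) \<le> L + L'"
    "unorm (Y' n) \<le> L + L'" for n
    using K(1) K(2)[of n] K'(1) K'(2)[of n] L(1) L(2)[of n] L'(1) L'(2)[of n] by linarith+
  note le = this
  show ?thesis
    by (rule un_rel_lipschitz2[where f = "(*)" and K = "L + L'" and L = "K + K'", OF assms])
      (use K(1) K'(1) L(1) L'(1) le in \<open>auto intro: bound\<close>)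
qed

lemma part_equivp_un_rel: "part_equivp (un_rel :: (nat \<Rightarrow> 'n::finite pol_hyp) \<Rightarrow> _)"
proof (rule part_equivpI)
  show "\<exists>X::nat \<Rightarrow> 'n pol_hyp. un_rel X X" using un_rel_refl[OF un_Cauchy_const] by blast
  show "symp (un_rel :: (nat \<Rightarrow> 'n pol_hyp) \<Rightarrow> _)" by (rule sympI) (simp add: un_rel_def un_commute)
  show "transp (un_rel :: (nat \<Rightarrow> 'n pol_hyp) \<Rightarrow> _)"
  proof (rule transpI)
    fix X Y Z :: "nat \<Rightarrow> 'n pol_hyp"
    assume *: "un_rel X Y" "un_rel Y Z"
    then have "(\<lambda>n. unorm (X n - Y n) + unorm (Y n - Z n)) \<longlonglongrightarrow> 0"
      by (auto simp: un_rel_def intro!: tendsto_add_zero)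
    then have "(\<lambda>n. unorm (X n - Z n)) \<longlonglongrightarrow> 0"
      by (rule null_squeeze) (auto simp: un_nonneg un_triangle)
    with * show "un_rel X Z" by (simp add: un_rel_def)
  qed
qed

text \<open>\<open>C\<^sup>u\<close>: Cauchy sequences of \<open>Pol\<close> for the universal C*-seminorm, modulo null sequences.\<close>

quotient_type (overloaded) 'n cu_hyp = "nat \<Rightarrow> 'n::finite pol_hyp" / partial: un_rel
  morphisms rep_cu abs_cu
  by (rule part_equivp_un_rel)

lifting_forget presented.lifting

lift_definition to_cu :: "'n::finite pol_hyp \<Rightarrow> 'n cu_hyp" is "\<lambda>a _. a"
  by (rule un_rel_refl[OF un_Cauchy_const])

class cstar_algebra = complex_star_algebra + real_normed_algebra_1 + banach +
  assumes scaleR_scaleC: "scaleR r x = of_real r *\<^sub>C x"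
    and norm_scaleC: "norm (c *\<^sub>C x) = cmod c * norm x"
    and norm_star_mult: "norm (star x * x) = (norm x)\<^sup>2"

instantiation cu_hyp :: (finite) complex_star_algebra
begin
lift_definition zero_cu_hyp :: "'a cu_hyp" is "\<lambda>_. 0" by (rule un_rel_refl[OF un_Cauchy_const])
lift_definition one_cu_hyp :: "'a cu_hyp" is "\<lambda>_. 1" by (rule un_rel_refl[OF un_Cauchy_const])
lift_definition plus_cu_hyp :: "'a cu_hyp \<Rightarrow> 'a cu_hyp \<Rightarrow> 'a cu_hyp"
  is "\<lambda>X Y n. X n + Y n" by (rule un_rel_add)
lift_definition uminus_cu_hyp :: "'a cu_hyp \<Rightarrow> 'a cu_hyp" is "\<lambda>X n. - X n" by (rule un_rel_uminus)
lift_definition minus_cu_hyp :: "'a cu_hyp \<Rightarrow> 'a cu_hyp \<Rightarrow> 'a cu_hyp"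
  is "\<lambda>X Y n. X n - Y n" by (rule un_rel_diff)
lift_definition times_cu_hyp :: "'a cu_hyp \<Rightarrow> 'a cu_hyp \<Rightarrow> 'a cu_hyp"
  is "\<lambda>X Y n. X n * Y n" by (rule un_rel_mult)
lift_definition scaleC_cu_hyp :: "complex \<Rightarrow> 'a cu_hyp \<Rightarrow> 'a cu_hyp"
  is "\<lambda>c X n. c *\<^sub>C X n" by (rule un_rel_scaleC)
lift_definition star_cu_hyp :: "'a cu_hyp \<Rightarrow> 'a cu_hyp" is "\<lambda>X n. star (X n)" by (rule un_rel_star)

instance
proof
  fix a b c :: "'a cu_hyp" and z w :: complex
  show "a * b * c = a * (b * c)"
    by transfer (simp add: mult.assoc un_rel_mult)
  show "1 * a = a" "a * 1 = a" by (transfer; simp)+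
  show "(a + b) * c = a * c + b * c"
    by transfer (simp add: distrib_right un_rel_mult un_rel_add)
  show "a * (b + c) = a * b + a * c"
    by transfer (simp add: distrib_left un_rel_mult un_rel_add)
  show "a + b + c = a + (b + c)" by transfer (simp add: add.assoc un_rel_add)
  show "a + b = b + a" by transfer (simp add: add.commute un_rel_add)
  show "0 + a = a" by transfer simp
  show "- a + a = 0" by transfer (simp add: un_rel_refl[OF un_Cauchy_const])
  show "a - b = a + - b" by transfer (simp add: un_rel_diff)
  show "(0::'a cu_hyp) \<noteq> 1" by transfer (simp add: un_rel_def un_simps un_one LIMSEQ_const_iff)
  show "z *\<^sub>C (a + b) = z *\<^sub>C a + z *\<^sub>C b"
    by transfer (simp add: scaleC_add_right un_rel_scaleC un_rel_add)
  show "(z + w) *\<^sub>C a = z *\<^sub>C a + w *\<^sub>C a"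
    by transfer (simp add: scaleC_add_left un_rel_scaleC un_rel_add)
  show "z *\<^sub>C w *\<^sub>C a = (z * w) *\<^sub>C a"
    by transfer (simp add: scaleC_scaleC un_rel_scaleC)
  show "1 *\<^sub>C a = a" by transfer (simp add: scaleC_one)
  show "(z *\<^sub>C a) * b = z *\<^sub>C (a * b)"
    by transfer (simp add: mult_scaleC_left un_rel_scaleC un_rel_mult)
  show "a * (z *\<^sub>C b) = z *\<^sub>C (a * b)"
    by transfer (simp add: mult_scaleC_right un_rel_scaleC un_rel_mult)
  show "star (a + b) = star a + star b"
    by transfer (simp add: star_add un_rel_star un_rel_add)
  show "star (z *\<^sub>C a) = cnj z *\<^sub>C star a"
    by transfer (simp add: star_scaleC un_rel_star un_rel_scaleC)
  show "star (a * b) = star b * star a"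
    by transfer (simp add: star_mult un_rel_star un_rel_mult)
  show "star (star a) = a" by transfer (simp add: star_star)
qed
end

instantiation cu_hyp :: (finite) real_normed_vector
begin
lift_definition norm_cu_hyp :: "'a cu_hyp \<Rightarrow> real" is "\<lambda>X. lim (\<lambda>n. unorm (X n))"
proof -
  fix X Y :: "nat \<Rightarrow> 'a pol_hyp" assume XY: "un_rel X Y"
  have "(\<lambda>n. unorm (X n) - unorm (Y n)) \<longlonglongrightarrow> 0"
    by (rule tendsto_rabs_zero_cancel, rule null_squeeze[of "\<lambda>n. unorm (X n - Y n)"])
      (use XY in \<open>auto simp: un_rel_def un_abs_diff\<close>)
  moreover have "(\<lambda>n. unorm (Y n)) \<longlonglongrightarrow> lim (\<lambda>n. unorm (Y n))"
    using XY un_convergent convergent_LIMSEQ_iff by (auto simp: un_rel_def)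
  ultimately have "(\<lambda>n. unorm (X n)) \<longlonglongrightarrow> lim (\<lambda>n. unorm (Y n))"
    using tendsto_add by fastforce
  then show "lim (\<lambda>n. unorm (X n)) = lim (\<lambda>n. unorm (Y n))" by (rule limI)
qed
definition scaleR_cu_hyp :: "real \<Rightarrow> 'a cu_hyp \<Rightarrow> 'a cu_hyp" where
  "scaleR_cu_hyp r x = of_real r *\<^sub>C x"
definition dist_cu_hyp :: "'a cu_hyp \<Rightarrow> 'a cu_hyp \<Rightarrow> real" where
  "dist_cu_hyp x y = norm (x - y)"
definition sgn_cu_hyp :: "'a cu_hyp \<Rightarrow> 'a cu_hyp" where
  "sgn_cu_hyp x = scaleR (inverse (norm x)) x"
definition uniformity_cu_hyp :: "('a cu_hyp \<times> 'a cu_hyp) filter" where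
  "uniformity_cu_hyp = (INF e\<in>{0 <..}. principal {(x, y). dist x y < e})"
definition open_cu_hyp :: "'a cu_hyp set \<Rightarrow> bool" where
  "open_cu_hyp U \<longleftrightarrow> (\<forall>x\<in>U. eventually (\<lambda>(x', y). x' = x \<longrightarrow> y \<in> U) uniformity)"

lemma norm_abs_cu: "un_Cauchy X \<Longrightarrow> (\<lambda>n. unorm (X n)) \<longlonglongrightarrow> norm (abs_cu X)"
  by (simp add: norm_cu_hyp.abs_eq un_rel_refl un_convergent convergent_LIMSEQ_iff[symmetric])

lemma cu_exhaust: obtains X where "un_Cauchy X" "x = abs_cu X"
  by (metis Quotient3_cu_hyp Quotient3_abs_rep Quotient3_rep_reflp un_rel_def)

lemma un_Cauchy_ops:
  assumes "un_Cauchy X" "un_Cauchy Y"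
  shows "un_Cauchy (\<lambda>n. X n + Y n)" "un_Cauchy (\<lambda>n. X n * Y n)" "un_Cauchy (\<lambda>n. c *\<^sub>C X n)"
    "un_Cauchy (\<lambda>n. star (X n))" "un_Cauchy (\<lambda>n. X n - Y n)"
  using un_rel_add[OF assms[THEN un_rel_refl]] un_rel_mult[OF assms[THEN un_rel_refl]]
    un_rel_scaleC[OF un_rel_refl[OF assms(1)]] un_rel_star[OF un_rel_refl[OF assms(1)]]
    un_rel_diff[OF assms[THEN un_rel_refl]]
  by (simp_all add: un_rel_def)

lemma norm_cu_scaleC: "norm (c *\<^sub>C x) = cmod c * norm x" for x :: "'a cu_hyp"
proof -
  obtain X where X: "un_Cauchy X" "x = abs_cu X" by (rule cu_exhaust)
  have "(\<lambda>n. unorm (c *\<^sub>C X n)) \<longlonglongrightarrow> norm (c *\<^sub>C x)"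
    using norm_abs_cu[OF un_Cauchy_ops(3)[OF X(1) X(1)]] X
    by (simp add: scaleC_cu_hyp.abs_eq un_rel_refl)
  moreover have "(\<lambda>n. cmod c * unorm (X n)) \<longlonglongrightarrow> cmod c * norm x"
    using norm_abs_cu[OF X(1)] X(2) by (auto intro: tendsto_mult_left)
  ultimately show ?thesis by (simp add: un_simps LIMSEQ_unique)
qed

instance
proof
  fix x y :: "'a cu_hyp" and a b :: real and U :: "'a cu_hyp set"
  show "a *\<^sub>R (x + y) = a *\<^sub>R x + a *\<^sub>R y" by (simp add: scaleR_cu_hyp_def scaleC_add_right)
  show "(a + b) *\<^sub>R x = a *\<^sub>R x + b *\<^sub>R x" by (simp add: scaleR_cu_hyp_def scaleC_add_left)
  show "a *\<^sub>R b *\<^sub>R x = (a * b) *\<^sub>R x" by (simp add: scaleR_cu_hyp_def scaleC_scaleC)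
  show "1 *\<^sub>R x = x" by (simp add: scaleR_cu_hyp_def scaleC_one)
  show "dist x y = norm (x - y)" by (rule dist_cu_hyp_def)
  show "sgn x = inverse (norm x) *\<^sub>R x" by (rule sgn_cu_hyp_def)
  show "uniformity = (INF e\<in>{0 <..}. principal {(x::'a cu_hyp, y). dist x y < e})"
    by (rule uniformity_cu_hyp_def)
  show "open U \<longleftrightarrow> (\<forall>x\<in>U. \<forall>\<^sub>F (x', y) in uniformity. x' = x \<longrightarrow> y \<in> U)"
    by (rule open_cu_hyp_def)
  obtain X where X: "un_Cauchy X" "x = abs_cu X" by (rule cu_exhaust)
  obtain Y where Y: "un_Cauchy Y" "y = abs_cu Y" by (rule cu_exhaust)
  show "norm x = 0 \<longleftrightarrow> x = 0"
  proof
    assume "norm x = 0"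
    then have "un_rel X (\<lambda>_. 0)"
      using norm_abs_cu[OF X(1)] X by (simp add: un_rel_def un_Cauchy_const)
    then show "x = 0" using X(2) Quotient3_rel_abs[OF Quotient3_cu_hyp]
      by (simp add: zero_cu_hyp.abs_eq)
  next
    assume "x = 0"
    then show "norm x = 0" using norm_cu_scaleC[of 0 x] by simp
  qed
  show "norm (x + y) \<le> norm x + norm y"
  proof (rule LIMSEQ_le)
    show "(\<lambda>n. unorm (X n + Y n)) \<longlonglongrightarrow> norm (x + y)"
      using norm_abs_cu[OF un_Cauchy_ops(1)[OF X(1) Y(1)]] X Y
      by (simp add: plus_cu_hyp.abs_eq un_rel_refl)
    show "(\<lambda>n. unorm (X n) + unorm (Y n)) \<longlonglongrightarrow> norm x + norm y"
      unfolding X(2) Y(2) by (intro tendsto_add norm_abs_cu X Y)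
  qed (auto simp: un_add)
  show "norm (a *\<^sub>R x) = \<bar>a\<bar> * norm x" by (simp add: scaleR_cu_hyp_def norm_cu_scaleC)
qed
end

lemma norm_to_cu: "norm (to_cu a) = unorm a"
  by (simp add: to_cu.abs_eq norm_cu_hyp.abs_eq un_rel_refl un_Cauchy_const lim_const)

lemma star_hom_to_cu: "star_hom to_cu"
  unfolding star_hom_def clinear_def
  by (simp add: to_cu.abs_eq plus_cu_hyp.abs_eq scaleC_cu_hyp.abs_eq one_cu_hyp.abs_eq
      times_cu_hyp.abs_eq star_cu_hyp.abs_eq un_rel_refl un_Cauchy_const)

lemma to_cu_diff: "to_cu (a - b) = to_cu a - to_cu b"
  by (rule star_hom_diff[OF star_hom_to_cu])

lemma to_cu_tendsto:
  assumes "un_Cauchy X"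
  shows "(\<lambda>n. to_cu (X n)) \<longlonglongrightarrow> abs_cu X"
proof (rule metric_LIMSEQ_I)
  fix e :: real assume "0 < e"
  then have "0 < e / 2" by simp
  then obtain N where N: "\<And>m n. m \<ge> N \<Longrightarrow> n \<ge> N \<Longrightarrow> unorm (X m - X n) < e / 2"
    using assms unfolding un_Cauchy_def by blast
  have "dist (to_cu (X n)) (abs_cu X) < e" if "n \<ge> N" for n
  proof -
    have "(\<lambda>m. unorm (X n - X m)) \<longlonglongrightarrow> norm (to_cu (X n) - abs_cu X)"
      using norm_abs_cu[OF un_Cauchy_ops(5)[OF un_Cauchy_const assms]] assms
      by (simp add: to_cu.abs_eq minus_cu_hyp.abs_eq un_rel_refl un_Cauchy_const)
    moreover have "\<forall>m\<ge>N. unorm (X n - X m) \<le> e / 2" using N[OF that] less_imp_le by blast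
    ultimately have "norm (to_cu (X n) - abs_cu X) \<le> e / 2" by (meson LIMSEQ_le_const2)
    then show ?thesis using \<open>0 < e\<close> by (simp add: dist_norm)
  qed
  then show "\<exists>N. \<forall>n\<ge>N. dist (to_cu (X n)) (abs_cu X) < e" by blast
qed

lemma dense_to_cu: "closure (range to_cu) = (UNIV :: 'n::finite cu_hyp set)"
proof -
  have "x \<in> closure (range to_cu)" for x :: "'n cu_hyp"
  proof -
    obtain X where "un_Cauchy X" "x = abs_cu X" by (rule cu_exhaust)
    then show ?thesis
      unfolding closure_sequential
      by (intro exI[of _ "\<lambda>n. to_cu (X n)"]) (simp add: to_cu_tendsto)
  qed
  then show ?thesis by blast
qed

instance cu_hyp :: (finite) cstar_algebra
proof
  fix x y :: "'a cu_hyp" and r :: real and c :: complex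
  show "r *\<^sub>R x = of_real r *\<^sub>C x" by (rule scaleR_cu_hyp_def)
  show "norm (c *\<^sub>C x) = cmod c * norm x" by (rule norm_cu_scaleC)
  show "(r *\<^sub>R x) * y = r *\<^sub>R (x * y)" "x * (r *\<^sub>R y) = r *\<^sub>R (x * y)"
    by (simp_all add: scaleR_cu_hyp_def mult_scaleC_left mult_scaleC_right)
  show "norm (1::'a cu_hyp) = 1"
    using norm_to_cu[of "1::'a pol_hyp"] by (simp add: star_hom_one[OF star_hom_to_cu] un_one)
  obtain X where X: "un_Cauchy X" "x = abs_cu X" by (rule cu_exhaust)
  obtain Y where Y: "un_Cauchy Y" "y = abs_cu Y" by (rule cu_exhaust)
  show "norm (x * y) \<le> norm x * norm y"
  proof (rule LIMSEQ_le)
    show "(\<lambda>n. unorm (X n * Y n)) \<longlonglongrightarrow> norm (x * y)"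
      using norm_abs_cu[OF un_Cauchy_ops(2)[OF X(1) Y(1)]] X Y
      by (simp add: times_cu_hyp.abs_eq un_rel_refl)
    show "(\<lambda>n. unorm (X n) * unorm (Y n)) \<longlonglongrightarrow> norm x * norm y"
      unfolding X(2) Y(2) by (intro tendsto_mult norm_abs_cu X Y)
  qed (auto simp: un_mult)
  have "(\<lambda>n. unorm (star (X n) * X n)) \<longlonglongrightarrow> norm (star x * x)"
    using norm_abs_cu[OF un_Cauchy_ops(2)[OF un_Cauchy_ops(4)[OF X(1) X(1)] X(1)]] X
    by (simp add: times_cu_hyp.abs_eq star_cu_hyp.abs_eq un_rel_refl un_Cauchy_ops(4))
  moreover have "(\<lambda>n. (unorm (X n))\<^sup>2) \<longlonglongrightarrow> (norm x)\<^sup>2"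
    unfolding X(2) by (intro tendsto_power norm_abs_cu X)
  ultimately show "norm (star x * x) = (norm x)\<^sup>2" by (simp add: un_simps LIMSEQ_unique)
next
  fix F :: "nat \<Rightarrow> 'a cu_hyp" assume F: "Cauchy F"
  have "\<exists>a. dist (F n) (to_cu a) < inverse (real (Suc n))" for n
  proof -
    have "F n \<in> closure (range to_cu)" by (simp add: dense_to_cu)
    moreover have "0 < inverse (real (Suc n))" by simp
    ultimately show ?thesis unfolding closure_approachable by (auto simp: dist_commute)
  qed
  then obtain a where a: "\<And>n. dist (F n) (to_cu (a n)) < inverse (real (Suc n))" by metis
  have "(\<lambda>n. dist (F n) (to_cu (a n))) \<longlonglongrightarrow> 0"
    by (rule null_squeeze[OF LIMSEQ_inverse_real_of_nat]) (use a less_imp_le in auto)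
  then have close: "(\<lambda>n. F n - to_cu (a n)) \<longlonglongrightarrow> 0"
    by (simp add: dist_norm tendsto_norm_zero_iff)
  have "Cauchy (\<lambda>n. to_cu (a n))"
  proof (rule metric_CauchyI)
    fix e :: real assume "0 < e"
    then have e: "0 < e / 3" by simp
    obtain M where M: "\<And>m n. m \<ge> M \<Longrightarrow> n \<ge> M \<Longrightarrow> dist (F m) (F n) < e / 3"
      using metric_CauchyD[OF F e] by blast
    obtain N where N: "\<And>n. n \<ge> N \<Longrightarrow> dist (F n) (to_cu (a n)) < e / 3"
      using metric_LIMSEQ_D[OF close e] by (auto simp: dist_norm)
    have "dist (to_cu (a m)) (to_cu (a n)) < e" if "m \<ge> max M N" "n \<ge> max M N" for m n
      using M[of m n] N[of m] N[of n] that
        dist_triangle[of "to_cu (a m)" "to_cu (a n)" "F m"]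
        dist_triangle[of "F m" "to_cu (a n)" "F n"]
      by (simp add: dist_commute)
    then show "\<exists>N. \<forall>m\<ge>N. \<forall>n\<ge>N. dist (to_cu (a m)) (to_cu (a n)) < e" by blast
  qed
  then have "un_Cauchy a"
    unfolding un_Cauchy_def Cauchy_def by (simp add: dist_norm to_cu_diff[symmetric] norm_to_cu)
  then have "(\<lambda>n. to_cu (a n)) \<longlonglongrightarrow> abs_cu a" by (rule to_cu_tendsto)
  from tendsto_add[OF close this] have "F \<longlonglongrightarrow> abs_cu a" by simp
  then show "convergent F" by (rule convergentI)
qed

end

theory Submission
  imports Defs
begin

text \<open>
  Entrywise evaluation of \<open>u\<^bsub>ij\<^esub>\<close> and \<open>p\<^bsub>ij\<^esub>\<close> on tensor powers turns a functional into a family of matrices,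
  one for each word \<open>z\<close> in the two letters. If the functional is central, these matrices are intertwiners.
  The orthogonal projections onto the span of the noncrossing vectors are compatible with the
  defining relations, hence define a functional on \<open>Pol(H\<^sub>N\<^sup>+)\<close>, and this functional shows that every
  fixed vector of a tensor power is noncrossing. By Frobenius reciprocity an intertwiner therefore acts by a
  scalar \<open>c\<^sub>z\<close> on the vectors that are orthogonal to everything coming from shorter words, and the
  scalars \<open>c\<^sub>z\<close> determine the functional.
  Rotating a word under the trace, so that its two ends meet and merge, shows that \<open>c\<^sub>z\<close> depends, for
  nonempty \<open>z\<close>, only on the parity of the number of letters \<open>u\<close> in \<open>z\<close>; this uses three disjoint pairs of
  indices, whence \<open>N \<ge> 6\<close>. The scalars of \<open>\<epsilon>\<close>, \<open>\<epsilon>\<^sub>a\<^sub>l\<^sub>t\<close> and \<open>h\<close> are \<open>1\<close>, the sign of the parity, and \<open>0\<close> on nonempty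
  words, so a linear combination of the three matches. Boundedness of \<open>h\<close> comes from its GNS seminorm.
\<close>

section \<open>Sums over tuples\<close>

text \<open>Words use both letters, although \<open>u\<close> alone generates, because contracting
  two neighbouring letters must give a word again: \<open>u * u\<close> is \<open>p\<close>. Labels
  multiply by exclusive or, so the relevant noncrossing partitions have an even number of letters
  \<open>u\<close> in every block. The first obstacle is an upper bound for the fixed vectors. It
  needs a functional on the presented algebra that sees noncrossing vectors only; projections supply
  it because the noncrossing span is stable under doubling and inserting coordinates and under the
  adjoints of these maps. The second obstacle is to compare scalars of words of different length.
  Merging two ends replaces the test function \<open>d 6 7\<close> by its square, whose sum is not
  zero, so the merged vector is no longer primitive. It is still an eigenvector, and a nonzero
  pairing with a primitive eigenvector of the transposed matrix forces equal eigenvalues. Two pairs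
  of points alternate along the word; the third is reserved for the ends. Centrality is given on
  irreducible representatives only and is carried over to words by complete reducibility, for which
  the antipode is built.\<close>

abbreviation tuples :: "nat \<Rightarrow> 'a list set" where
  "tuples n \<equiv> {x. length x = n}"

lemma finite_tuples [simp]: "finite (tuples n :: 'a::finite list set)"
  using finite_lists_length_eq[of "UNIV :: 'a set" n] by simp

lemma sum_tuples_Suc:
  "(\<Sum>x\<in>tuples (Suc n). f x) = (\<Sum>a\<in>UNIV. \<Sum>x\<in>tuples n. f ((a::'a::finite) # x))"
proof -
  have "(\<Sum>a\<in>UNIV. \<Sum>x\<in>tuples n. f (a # x)) = (\<Sum>(a, x)\<in>UNIV \<times> tuples n. f (a # x))"
    by (simp add: sum.cartesian_product)
  also have "\<dots> = (\<Sum>x\<in>tuples (Suc n). f x)"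
    by (rule sum.reindex_bij_witness[of _ "\<lambda>x. (hd x, tl x)" "\<lambda>(a, x). a # x"])
      (auto simp: length_Suc_conv)
  finally show ?thesis ..
qed

lemma sum_tuples_add:
  "(\<Sum>x\<in>tuples (m + n). f x) = (\<Sum>x\<in>tuples m. \<Sum>y\<in>tuples n. f ((x::'a::finite list) @ y))"
  by (induction m arbitrary: f) (simp_all add: sum_tuples_Suc)

lemma sum_tuples_1: "(\<Sum>x\<in>tuples (Suc 0). f x) = (\<Sum>a\<in>UNIV. f [a::'a::finite])"
  by (simp add: sum_tuples_Suc)

lemma sum_tuples_snoc:
  "(\<Sum>x\<in>tuples (Suc n). f x) = (\<Sum>x\<in>tuples n. \<Sum>a\<in>UNIV. f (x @ [a::'a::finite]))"
  using sum_tuples_add[of f n "Suc 0"] by (simp add: sum_tuples_1)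

lemma sum_tuples_rev:
  "(\<Sum>x\<in>tuples n. f (rev x)) = (\<Sum>x\<in>tuples n. f (x::'a::finite list))"
  by (rule sum.reindex_bij_witness[of _ rev rev]) auto

lemma sum_tuples_delta:
  "(y::'a::finite list) \<in> tuples n \<Longrightarrow> (\<Sum>x\<in>tuples n. (if x = y then f x else 0)) = f y"
  by (simp add: sum.delta')


section \<open>Words in the generators and their squares\<close>

text \<open>The flag is the parity of the exponent. Since the cube of \<open>u_gen i j\<close> is
  \<open>u_gen i j\<close>, powers at one position multiply by exclusive or of flags, and
  \<open>False\<close> marks the idempotent.\<close>

definition letter :: "bool \<Rightarrow> 'n::finite \<Rightarrow> 'n \<Rightarrow> 'n pol_hyp" where
  "letter t i j = (if t then u_gen i j else (u_gen i j)\<^sup>2)"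

text \<open>Multiply the row relation for row \<open>i\<close> by \<open>u_gen i j\<close>:
  orthogonality within the row leaves only the summand \<open>k = j\<close>.\<close>

lemma u_mult_u2: "u_gen i j * (u_gen i j)\<^sup>2 = (u_gen i j :: 'n::finite pol_hyp)"
proof -
  have "u_gen i j = u_gen i j * (\<Sum>k\<in>UNIV. (u_gen i k)\<^sup>2)" by (simp add: p_sum_row)
  also have "\<dots> = (\<Sum>k\<in>UNIV. u_gen i j * u_gen i k * u_gen i k)"
    by (simp add: sum_distrib_left power2_eq_square mult.assoc)
  also have "\<dots> = (\<Sum>k\<in>UNIV. if k = j then u_gen i j * (u_gen i j)\<^sup>2 else 0)"
  proof (rule sum.cong)
    fix k show "u_gen i j * u_gen i k * u_gen i k = (if k = j then u_gen i j * (u_gen i j)\<^sup>2 else 0)"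
    proof (cases "k = j")
      case True
      then show ?thesis by (simp only: simp_thms if_True power2_eq_square mult.assoc)
    next
      case False
      then show ?thesis by (simp add: u_row)
    qed
  qed simp
  finally show ?thesis by simp
qed

lemma u_orth_row: "j \<noteq> k \<Longrightarrow> u_gen i j * u_gen i k = 0"
  and u_orth_col: "i \<noteq> k \<Longrightarrow> u_gen i j * u_gen k j = 0"
  by (simp_all add: u_row u_col)

lemma letter_row:
  "letter s i j * letter t i k = (if j = k then letter (s \<noteq> t) i j else (0 :: 'n::finite pol_hyp))"
proof (cases "j = k")
  case True
  have "(u_gen i j)\<^sup>2 * u_gen i j = u_gen i j"
    using u_mult_u2[of i j] by (simp only: power2_eq_square mult.assoc)
  moreover have "u_gen i j * u_gen i j = (u_gen i j)\<^sup>2" by (simp only: power2_eq_square)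
  moreover have "(u_gen i j)\<^sup>2 * (u_gen i j)\<^sup>2 = (u_gen i j)\<^sup>2" using p_row[of i j j] by simp
  ultimately show ?thesis
    using True by (cases s; cases t) (simp_all only: letter_def u_mult_u2 simp_thms if_True if_False)
next
  case False
  then have "u_gen i j * u_gen i k = 0" by (rule u_orth_row)
  then have "u_gen i j * (u_gen i k * x) = 0" for x by (simp add: mult.assoc[symmetric])
  then show ?thesis
    using False \<open>u_gen i j * u_gen i k = 0\<close>
    by (cases s; cases t) (simp_all add: letter_def power2_eq_square mult.assoc)
qed

lemma letter_col:
  "letter s i j * letter t k j = (if i = k then letter (s \<noteq> t) i j else (0 :: 'n::finite pol_hyp))"
proof (cases "i = k")
  case True
  then show ?thesis using letter_row[of s i j t j] by simp
next
  case False
  then have "u_gen i j * u_gen k j = 0" by (rule u_orth_col)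
  then have "u_gen i j * (u_gen k j * x) = 0" for x by (simp add: mult.assoc[symmetric])
  then show ?thesis
    using False \<open>u_gen i j * u_gen k j = 0\<close>
    by (cases s; cases t) (simp_all add: letter_def power2_eq_square mult.assoc)
qed

lemma letter_sum_row: "(\<Sum>j\<in>UNIV. letter False i j) = (1 :: 'n::finite pol_hyp)"
  and letter_sum_col: "(\<Sum>i\<in>UNIV. letter False i j) = (1 :: 'n::finite pol_hyp)"
  by (simp_all add: letter_def p_sum_row p_sum_col)

lemma star_letter: "star (letter t i j) = letter t i j"
  by (simp add: letter_def star_u power2_eq_square star_mult)

lemma comult_letter: "comult (letter t i j) = (\<Sum>k\<in>UNIV. letter t i k \<otimes>\<^sub>t letter t k j)"
proof (cases t)
  case False
  have "comult ((u_gen i j)\<^sup>2) = (\<Sum>k\<in>UNIV. \<Sum>m\<in>UNIV. (u_gen i k * u_gen i m) \<otimes>\<^sub>t (u_gen k j * u_gen m j))"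
    by (simp add: star_hom_mult[OF star_hom_comult] comult_u power2_eq_square sum_product tensor_mult)
  also have "\<dots> = (\<Sum>k\<in>UNIV. \<Sum>m\<in>UNIV. if m = k then (u_gen i k)\<^sup>2 \<otimes>\<^sub>t (u_gen k j)\<^sup>2 else 0)"
  proof (intro sum.cong refl)
    fix k m
    show "(u_gen i k * u_gen i m) \<otimes>\<^sub>t (u_gen k j * u_gen m j)
      = (if m = k then (u_gen i k)\<^sup>2 \<otimes>\<^sub>t (u_gen k j)\<^sup>2 else 0)"
    proof (cases "m = k")
      case True
      then show ?thesis by (simp only: simp_thms if_True power2_eq_square)
    next
      case False
      then show ?thesis by (simp add: u_orth_row[OF False[symmetric]])
    qed
  qed
  finally show ?thesis using False by (simp add: letter_def)
qed (simp add: letter_def comult_u)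

text \<open>The coefficient at \<open>(x, y)\<close> of the tensor product of the representations
  \<open>u\<close> and \<open>p\<close> named by the letters of \<open>z\<close>.\<close>

fun word :: "bool list \<Rightarrow> 'n::finite list \<Rightarrow> 'n list \<Rightarrow> 'n pol_hyp" where
  "word [] [] [] = 1"
| "word (t # z) (i # x) (j # y) = letter t i j * word z x y"
| "word _ _ _ = 0"

lemma word_append:
  "length x = length z \<Longrightarrow> length y = length z
    \<Longrightarrow> word (z @ z') (x @ x') (y @ y') = word z x y * word z' x' y'"
proof (induction z arbitrary: x y)
  case (Cons t z)
  then show ?case by (cases x; cases y) (simp_all add: mult.assoc)
qed simp

lemma word_merge_row:
  assumes "length x = length z" "length x' = length z"
  shows "word (z @ s # t # z') (x @ a # a # y) (x' @ b # c # y')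
    = (if b = c then word (z @ (s \<noteq> t) # z') (x @ a # y) (x' @ b # y') else 0)"
  using assms letter_row[of s a b t c] by (simp add: word_append mult.assoc[symmetric])

lemma word_merge_col:
  assumes "length x = length z" "length x' = length z"
  shows "word (z @ s # t # z') (x @ a # d # y) (x' @ b # b # y')
    = (if a = d then word (z @ (s \<noteq> t) # z') (x @ a # y) (x' @ b # y') else 0)"
  using assms letter_col[of s a b t d] by (simp add: word_append mult.assoc[symmetric])

lemma comult_word:
  "length x = length z \<Longrightarrow> length y = length z
    \<Longrightarrow> comult (word z x y) = (\<Sum>a\<in>tuples (length z). word z x a \<otimes>\<^sub>t word z a y)"
proof (induction z arbitrary: x y)
  case Nil
  then show ?case by (simp add: star_hom_one[OF star_hom_comult] tensor_one)
next
  case (Cons t z)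
  then obtain i x' j y' where "x = i # x'" "y = j # y'" by (metis length_Suc_conv length_Cons)
  with Cons show ?case
    by (simp add: star_hom_mult[OF star_hom_comult] comult_letter sum_product tensor_mult
        sum_tuples_Suc)
qed

text \<open>Unitarity of the tensor product. Letters are self-adjoint, so the adjoint of a word is
  the reversed word; it is written as a word, not with \<open>star\<close>, because Frobenius
  reciprocity needs it as a word.\<close>

lemma word_cancel:
  "length x = length z \<Longrightarrow> length y = length z
    \<Longrightarrow> (\<Sum>b\<in>tuples (length z). word z x b * word (rev z) (rev y) (rev b)) = (if x = y then 1 else 0)"
proof (induction z arbitrary: x y)
  case (Cons t z)
  then obtain i x' j y' where xy: "x = i # x'" "y = j # y'" by (metis length_Suc_conv length_Cons)
  have len: "length x' = length z" "length y' = length z" using Cons.prems xy by simp_all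
  have "(\<Sum>b\<in>tuples (length (t # z)). word (t # z) x b * word (rev (t # z)) (rev y) (rev b))
    = (\<Sum>a\<in>UNIV. \<Sum>b\<in>tuples (length z). letter t i a * (word z x' b * word (rev z) (rev y') (rev b)) * letter t j a)"
    unfolding xy length_Cons sum_tuples_Suc
    by (intro sum.cong refl) (use len in \<open>simp add: word_append mult.assoc\<close>)
  also have "\<dots> = (\<Sum>a\<in>UNIV. letter t i a * (if x' = y' then 1 else 0) * letter t j a)"
    using Cons.IH[OF len] by (simp add: sum_distrib_left[symmetric] sum_distrib_right[symmetric])
  also have "\<dots> = (if x' = y' then (\<Sum>a\<in>UNIV. letter t i a * letter t j a) else 0)"
    by simp
  also have "\<dots> = (if x = y then 1 else 0)"
    using letter_sum_row[of j] by (simp add: xy letter_col)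
  finally show ?case .
qed simp

section \<open>Noncrossing vectors\<close>

definition del :: "nat \<Rightarrow> 'a list \<Rightarrow> 'a list" where
  "del m x = take m x @ drop (Suc m) x"

definition put :: "nat \<Rightarrow> 'a \<Rightarrow> 'a list \<Rightarrow> 'a list" where
  "put m a x = take m x @ a # drop m x"

definition dup :: "nat \<Rightarrow> 'a list \<Rightarrow> 'a list" where
  "dup m x = take (Suc m) x @ drop m x"

lemma length_del [simp]: "m < length x \<Longrightarrow> length (del m x) = length x - 1"
  and length_put [simp]: "m \<le> length x \<Longrightarrow> length (put m a x) = Suc (length x)"
  and length_dup [simp]: "m < length x \<Longrightarrow> length (dup m x) = Suc (length x)"
  by (simp_all add: del_def put_def dup_def)

lemma nth_del: "m < length x \<Longrightarrow> i < length x - 1 \<Longrightarrow> del m x ! i = (if i < m then x ! i else x ! Suc i)"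
  by (auto simp: del_def nth_append)

lemma nth_put: "m \<le> length x \<Longrightarrow> i < Suc (length x)
    \<Longrightarrow> put m a x ! i = (if i < m then x ! i else if i = m then a else x ! (i - 1))"
  by (auto simp: put_def nth_append nth_Cons')

lemma nth_dup: "m < length x \<Longrightarrow> i < Suc (length x)
    \<Longrightarrow> dup m x ! i = (if i \<le> m then x ! i else x ! (i - 1))"
  by (auto simp: dup_def nth_append)

lemma del_put_same: "m \<le> length x \<Longrightarrow> del m (put m a x) = x"
  by (simp add: del_def put_def)

lemma del_put_Suc: "m < length x \<Longrightarrow> del m (put (Suc m) (x ! m) x) = x"
  by (intro nth_equalityI) (auto simp: nth_del nth_put)

lemma del_put_lt: "m < k \<Longrightarrow> k \<le> length x \<Longrightarrow> del k (put m a x) = put m a (del (k - 1) x)"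
  by (intro nth_equalityI) (auto simp: nth_del nth_put)

lemma del_put_gt: "k < m \<Longrightarrow> m \<le> length x \<Longrightarrow> del k (put m a x) = put (m - 1) a (del k x)"
  by (intro nth_equalityI) (auto simp: nth_del nth_put)

lemma del_dup_same: "m < length x \<Longrightarrow> k = m \<or> k = Suc m \<Longrightarrow> del k (dup m x) = x"
  by (intro nth_equalityI) (auto simp: nth_del nth_dup le_less_Suc_eq)

lemma del_dup_lt: "k < m \<Longrightarrow> m < length x \<Longrightarrow> del k (dup m x) = dup (m - 1) (del k x)"
  by (intro nth_equalityI) (auto simp: nth_del nth_dup)

lemma del_dup_gt: "Suc m < k \<Longrightarrow> k \<le> length x \<Longrightarrow> del k (dup m x) = dup m (del (k - 1) x)"
  by (intro nth_equalityI) (auto simp: nth_del nth_dup)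

text \<open>\<open>ins\<close> creates a singleton block and \<open>spl\<close> doubles a point
  within its block. \<open>cap\<close> and \<open>mrg\<close> are the adjoints of these maps:
  summing out a coordinate and restricting to a diagonal.\<close>

definition ins :: "nat \<Rightarrow> ('a list \<Rightarrow> 'b) \<Rightarrow> 'a list \<Rightarrow> 'b" where
  "ins m \<eta> x = \<eta> (del m x)"

definition spl :: "nat \<Rightarrow> ('a list \<Rightarrow> 'b::zero) \<Rightarrow> 'a list \<Rightarrow> 'b" where
  "spl m \<eta> x = (if x ! m = x ! Suc m then \<eta> (del m x) else 0)"

definition cap :: "nat \<Rightarrow> ('a::finite list \<Rightarrow> 'b::comm_monoid_add) \<Rightarrow> 'a list \<Rightarrow> 'b" where
  "cap m \<eta> x = (\<Sum>a\<in>UNIV. \<eta> (put m a x))"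

definition mrg :: "nat \<Rightarrow> ('a list \<Rightarrow> 'b) \<Rightarrow> 'a list \<Rightarrow> 'b" where
  "mrg m \<eta> x = \<eta> (dup m x)"

text \<open>The span of the indicator vectors of noncrossing partitions whose blocks contain an even
  number of \<open>True\<close>. A nonempty noncrossing partition has a block that is an interval;
  removing it if it is a singleton, or merging two of its neighbours, shows that the two moves reach
  every partition. Partitions themselves therefore never appear. \<open>nc_cong\<close> is present
  because only tuples of the right length matter.\<close>

inductive nc :: "bool list \<Rightarrow> ('n::finite list \<Rightarrow> real) \<Rightarrow> bool" where
  nc_Nil: "nc [] (\<lambda>_. 1)"
| nc_ins: "nc z \<eta> \<Longrightarrow> m \<le> length z \<Longrightarrow> nc (put m False z) (ins m \<eta>)"
| nc_spl: "nc z \<eta> \<Longrightarrow> m < length z \<Longrightarrow> z ! m = (s \<noteq> t)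
    \<Longrightarrow> nc ((put m s z)[Suc m := t]) (spl m \<eta>)"
| nc_zero: "nc z (\<lambda>_. 0)"
| nc_add: "nc z \<eta> \<Longrightarrow> nc z \<zeta> \<Longrightarrow> nc z (\<lambda>x. \<eta> x + \<zeta> x)"
| nc_scale: "nc z \<eta> \<Longrightarrow> nc z (\<lambda>x. c * \<eta> x)"
| nc_cong: "nc z \<eta> \<Longrightarrow> (\<And>x. length x = length z \<Longrightarrow> \<eta> x = \<zeta> x) \<Longrightarrow> nc z \<zeta>"

section \<open>Commutation of the two moves with their adjoints\<close>

context
  fixes m k :: nat and x :: "'a::finite list" and \<eta> :: "'a list \<Rightarrow> real"
begin

lemma cap_ins_same: "m \<le> length x \<Longrightarrow> cap m (ins m \<eta>) x = real CARD('a) * \<eta> x"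
  by (simp add: cap_def ins_def del_put_same)

lemma cap_ins_lt:
  "m < k \<Longrightarrow> k \<le> length x \<Longrightarrow> cap m (ins k \<eta>) x = ins (k - 1) (cap m \<eta>) x"
  by (simp add: cap_def ins_def del_put_lt)

lemma cap_ins_gt:
  "k < m \<Longrightarrow> m \<le> length x \<Longrightarrow> cap m (ins k \<eta>) x = ins k (cap (m - 1) \<eta>) x"
  by (simp add: cap_def ins_def del_put_gt)

text \<open>Counit law of the Frobenius algebra of functions on the index set: of two copies of a
  point, either may be summed out.\<close>

lemma cap_spl_same:
  assumes "m = k \<or> m = Suc k" "k < length x"
  shows "cap m (spl k \<eta>) x = \<eta> x"
proof -
  have "spl k \<eta> (put m b x) = (if b = x ! k then \<eta> x else 0)" for b
    using assms by (auto simp: spl_def nth_put del_put_same del_put_Suc)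
  then show ?thesis by (simp add: cap_def)
qed

lemma cap_spl_lt:
  "m < k \<Longrightarrow> k < length x \<Longrightarrow> cap m (spl k \<eta>) x = spl (k - 1) (cap m \<eta>) x"
  by (auto simp: cap_def spl_def del_put_lt nth_put)

lemma cap_spl_gt:
  "Suc k < m \<Longrightarrow> m \<le> length x \<Longrightarrow> cap m (spl k \<eta>) x = spl k (cap (m - 1) \<eta>) x"
  by (auto simp: cap_def spl_def del_put_gt nth_put)

lemma mrg_ins_same: "m < length x \<Longrightarrow> k = m \<or> k = Suc m \<Longrightarrow> mrg m (ins k \<eta>) x = \<eta> x"
  by (simp add: mrg_def ins_def del_dup_same)

lemma mrg_ins_gt: "k < m \<Longrightarrow> m < length x \<Longrightarrow> mrg m (ins k \<eta>) x = ins k (mrg (m - 1) \<eta>) x"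
  by (simp add: mrg_def ins_def del_dup_lt)

lemma mrg_ins_lt:
  "Suc m < k \<Longrightarrow> k \<le> length x \<Longrightarrow> mrg m (ins k \<eta>) x = ins (k - 1) (mrg m \<eta>) x"
  by (simp add: mrg_def ins_def del_dup_gt)

lemma mrg_spl_same: "m < length x \<Longrightarrow> mrg m (spl m \<eta>) x = \<eta> x"
  by (simp add: mrg_def spl_def del_dup_same nth_dup)

text \<open>Frobenius law: one of the two copies is merged with its outer neighbour. Together with
  \<open>mrg_spl_pred\<close> this treats the positions where the moves overlap without
  cancelling.\<close>

lemma mrg_spl_Suc: "Suc k < length x \<Longrightarrow> mrg (Suc k) (spl k \<eta>) x = spl k (mrg k \<eta>) x"
  by (simp add: mrg_def spl_def del_dup_lt nth_dup)

lemma mrg_spl_pred: "Suc m < length x \<Longrightarrow> mrg m (spl (Suc m) \<eta>) x = spl m (mrg m \<eta>) x"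
proof -
  assume a: "Suc m < length x"
  have "del (Suc m) (dup m x) = x" using a by (simp add: del_dup_same)
  moreover have "x ! m = x ! Suc m \<Longrightarrow> dup m (del m x) = x"
    using a by (intro nth_equalityI) (auto simp: nth_del nth_dup le_less_Suc_eq le_eq_less_or_eq)
  ultimately show ?thesis using a by (auto simp: mrg_def spl_def nth_dup)
qed

lemma mrg_spl_gt:
  "Suc k < m \<Longrightarrow> m < length x \<Longrightarrow> mrg m (spl k \<eta>) x = spl k (mrg (m - 1) \<eta>) x"
  by (auto simp: mrg_def spl_def del_dup_lt nth_dup)

lemma mrg_spl_lt:
  "Suc m < k \<Longrightarrow> k < length x \<Longrightarrow> mrg m (spl k \<eta>) x = spl (k - 1) (mrg m \<eta>) x"
  by (auto simp: mrg_def spl_def del_dup_gt nth_dup)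

end


section \<open>Stability of the noncrossing span under the adjoint maps\<close>

lemma nc_eq:
  "nc z \<eta> \<Longrightarrow> z = z' \<Longrightarrow> (\<And>x. length x = length z' \<Longrightarrow> \<eta> x = \<zeta> x) \<Longrightarrow> nc z' \<zeta>"
  using nc_cong by blast

text \<open>Label bookkeeping, here and in \<open>types_spl\<close> and \<open>types_cap\<close>: on
  the two sides of each commutation rule the words carry the same labels.\<close>

lemma types_ins:
  shows "m < length z \<Longrightarrow> k = m \<or> k = Suc m \<Longrightarrow> (del m (put k b z))[m := w] = z[m := w]"
    and "k < m \<Longrightarrow> m < length z
      \<Longrightarrow> put k b ((del (m - 1) z)[m - 1 := w]) = (del m (put k b z))[m := w]"
    and "Suc m < k \<Longrightarrow> k \<le> length z
      \<Longrightarrow> put (k - 1) b ((del m z)[m := w]) = (del m (put k b z))[m := w]"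
  by (intro nth_equalityI; auto simp: nth_del nth_put nth_list_update)+

lemma types_spl:
  shows "m < length z \<Longrightarrow> (del m ((put m s z)[Suc m := t]))[m := w] = z[m := w]"
    and "Suc k < length z \<Longrightarrow> (put k s ((del k z)[k := v]))[Suc k := w]
      = (del (Suc k) ((put k s z)[Suc k := t]))[Suc k := w]"
    and "Suc m < length z \<Longrightarrow> (put m w ((del m z)[m := v]))[Suc m := t]
      = (del m ((put (Suc m) s z)[Suc (Suc m) := t]))[m := w]"
    and "Suc k < m \<Longrightarrow> m < length z \<Longrightarrow> (put k s ((del (m - 1) z)[m - 1 := w]))[Suc k := t]
      = (del m ((put k s z)[Suc k := t]))[m := w]"
    and "Suc m < k \<Longrightarrow> k < length z \<Longrightarrow> (put (k - 1) s ((del m z)[m := w]))[Suc (k - 1) := t]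
      = (del m ((put k s z)[Suc k := t]))[m := w]"
  by (intro nth_equalityI; auto simp: nth_del nth_put nth_list_update)+

lemma types_cap:
  shows "k < length z \<Longrightarrow> m = k \<Longrightarrow> del m ((put k s z)[Suc k := t]) = z[k := t]"
    and "k < length z \<Longrightarrow> m = Suc k \<Longrightarrow> del m ((put k s z)[Suc k := t]) = z[k := s]"
    and "m < k \<Longrightarrow> k < length z
      \<Longrightarrow> (put (k - 1) s (del m z))[Suc (k - 1) := t] = del m ((put k s z)[Suc k := t])"
    and "Suc k < m \<Longrightarrow> m \<le> length z
      \<Longrightarrow> (put k s (del (m - 1) z))[Suc k := t] = del m ((put k s z)[Suc k := t])"
  by (intro nth_equalityI; auto simp: nth_del nth_put nth_list_update)+

lemma nc_cap_ins:
  fixes \<eta> :: "'n::finite list \<Rightarrow> real"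
  assumes "nc z \<eta>" "k \<le> length z" "m < length (put k False z)" "\<not> put k False z ! m"
    and IH: "\<And>m. m < length z \<Longrightarrow> \<not> z ! m \<Longrightarrow> nc (del m z) (cap m \<eta>)"
  shows "nc (del m (put k False z)) (cap m (ins k \<eta>))"
proof -
  consider "m = k" | "m < k" | "k < m" by linarith
  then show ?thesis
  proof cases
    case 1
    then show ?thesis
      using assms by (intro nc_eq[OF nc_scale[OF assms(1), of "real CARD('n)"]]) (simp_all add: del_put_same cap_ins_same)
  next
    case 2
    with assms have "nc (put (k - 1) False (del m z)) (ins (k - 1) (cap m \<eta>))"
      by (intro nc_ins IH) (auto simp: nth_put)
    then show ?thesis
      by (rule nc_eq) (use assms 2 in \<open>simp_all add: del_put_gt cap_ins_lt\<close>)
  next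
    case 3
    with assms have "nc (put k False (del (m - 1) z)) (ins k (cap (m - 1) \<eta>))"
      by (intro nc_ins IH) (auto simp: nth_put)
    then show ?thesis
      by (rule nc_eq) (use assms 3 in \<open>simp_all add: del_put_lt cap_ins_gt\<close>)
  qed
qed

lemma nc_cap_spl:
  assumes "nc z \<eta>" "k < length z" "z ! k = (s \<noteq> t)" "m < Suc (length z)"
    and m: "\<not> (put k s z)[Suc k := t] ! m"
    and IH: "\<And>m. m < length z \<Longrightarrow> \<not> z ! m \<Longrightarrow> nc (del m z) (cap m \<eta>)"
  shows "nc (del m ((put k s z)[Suc k := t])) (cap m (spl k \<eta>))"
proof -
  consider "m = k \<or> m = Suc k" | "m < k" | "Suc k < m" by linarith
  then show ?thesis
  proof cases
    case 1
    have "z = del m ((put k s z)[Suc k := t])"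
      using 1
    proof
      assume "m = k"
      \<comment> \<open>The point summed out is labelled \<open>False\<close>, so the surviving copy
        inherits the label of the original point.\<close>
      moreover from this m assms(2,3) have "t = z ! k" by (simp add: nth_put)
      ultimately show ?thesis using assms(2) by (simp add: types_cap(1))
    next
      assume "m = Suc k"
      moreover from this m assms(2,3) have "s = z ! k" by (simp add: nth_put)
      ultimately show ?thesis using assms(2) by (simp add: types_cap(2))
    qed
    then show ?thesis
      using assms 1 by (intro nc_eq[OF assms(1)]) (simp_all add: cap_spl_same)
  next
    case 2
    with assms have "nc ((put (k - 1) s (del m z))[Suc (k - 1) := t]) (spl (k - 1) (cap m \<eta>))"
      by (intro nc_spl IH) (auto simp: nth_put nth_del nth_list_update)
    moreover have "(put (k - 1) s (del m z))[Suc (k - 1) := t] = del m ((put k s z)[Suc k := t])"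
      using assms(2,4) 2 by (intro types_cap) auto
    ultimately show ?thesis
      by (rule nc_eq) (use assms 2 in \<open>simp_all add: cap_spl_lt\<close>)
  next
    case 3
    with assms have "nc ((put k s (del (m - 1) z))[Suc k := t]) (spl k (cap (m - 1) \<eta>))"
      by (intro nc_spl IH) (auto simp: nth_put nth_del nth_list_update)
    moreover have "(put k s (del (m - 1) z))[Suc k := t] = del m ((put k s z)[Suc k := t])"
      using assms(2,4) 3 by (intro types_cap) auto
    ultimately show ?thesis
      by (rule nc_eq) (use assms 3 in \<open>simp_all add: cap_spl_gt\<close>)
  qed
qed

text \<open>Away from the point summed out the moves commute with \<open>cap\<close>; at that point
  they cancel, up to the factor \<open>N\<close>. The point has to be labelled \<open>False\<close>,
  since removing a \<open>True\<close> would leave a block of odd parity.\<close>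

lemma nc_cap: "nc z \<eta> \<Longrightarrow> m < length z \<Longrightarrow> \<not> z ! m \<Longrightarrow> nc (del m z) (cap m \<eta>)"
proof (induction z \<eta> arbitrary: m rule: nc.induct)
  case (nc_ins z \<eta> k)
  then show ?case by (intro nc_cap_ins) auto
next
  case (nc_spl z \<eta> k s t)
  then show ?case by (intro nc_cap_spl) auto
next
  case (nc_zero z)
  then show ?case by (simp add: cap_def nc.nc_zero)
next
  case (nc_add z \<eta> \<zeta>)
  then show ?case by (auto simp: cap_def sum.distrib intro: nc_eq[OF nc.nc_add])
next
  case (nc_scale z \<eta> c)
  then show ?case by (auto simp: cap_def sum_distrib_left[symmetric] intro: nc_eq[OF nc.nc_scale])
next
  case (nc_cong z \<eta> \<zeta>)
  then show ?case by (auto simp: cap_def intro!: sum.cong nc_eq[OF nc_cong.IH])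
qed simp

lemma nc_mrg_ins:
  assumes "nc z \<eta>" "k \<le> length z" "m < length z"
    and IH: "\<And>m. Suc m < length z \<Longrightarrow> nc ((del m z)[m := (z ! m \<noteq> z ! Suc m)]) (mrg m \<eta>)"
  defines "z' \<equiv> put k False z"
  shows "nc ((del m z')[m := (z' ! m \<noteq> z' ! Suc m)]) (mrg m (ins k \<eta>))"
proof -
  consider "k = m \<or> k = Suc m" | "k < m" | "Suc m < k" by linarith
  then show ?thesis
  proof cases
    case 1
    have "z = (del m z')[m := (z' ! m \<noteq> z' ! Suc m)]"
      using assms(2,3) 1 types_ins(1)[of m z k False "z ! m"] by (auto simp: z'_def nth_put)
    then show ?thesis
      using assms(2,3) 1 by (intro nc_eq[OF assms(1)]) (auto simp: mrg_ins_same z'_def)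
  next
    case 2
    with assms(1-3) have "nc (put k False ((del (m - 1) z)[m - 1 := (z ! (m - 1) \<noteq> z ! Suc (m - 1))]))
        (ins k (mrg (m - 1) \<eta>))"
      by (intro nc_ins IH) auto
    moreover have "put k False ((del (m - 1) z)[m - 1 := (z ! (m - 1) \<noteq> z ! Suc (m - 1))])
        = (del m z')[m := (z' ! m \<noteq> z' ! Suc m)]"
      using assms(2,3) 2 types_ins(2)[of k m z False "z ! (m - 1) \<noteq> z ! m"]
      by (simp add: z'_def nth_put)
    ultimately show ?thesis
      by (rule nc_eq) (use assms(2,3) 2 in \<open>simp_all add: mrg_ins_gt z'_def\<close>)
  next
    case 3
    with assms(1-3) have "nc (put (k - 1) False ((del m z)[m := (z ! m \<noteq> z ! Suc m)]))
        (ins (k - 1) (mrg m \<eta>))"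
      by (intro nc_ins IH) auto
    moreover have "put (k - 1) False ((del m z)[m := (z ! m \<noteq> z ! Suc m)])
        = (del m z')[m := (z' ! m \<noteq> z' ! Suc m)]"
      using assms(2,3) 3 types_ins(3)[of m k z False "z ! m \<noteq> z ! Suc m"]
      by (simp add: z'_def nth_put)
    ultimately show ?thesis
      by (rule nc_eq) (use assms(2,3) 3 in \<open>simp_all add: mrg_ins_lt z'_def\<close>)
  qed
qed

lemma nc_mrg_spl:
  assumes "nc z \<eta>" "k < length z" "z ! k = (s \<noteq> t)" "m < length z"
    and IH: "\<And>m. Suc m < length z \<Longrightarrow> nc ((del m z)[m := (z ! m \<noteq> z ! Suc m)]) (mrg m \<eta>)"
  defines "z' \<equiv> (put k s z)[Suc k := t]"
  shows "nc ((del m z')[m := (z' ! m \<noteq> z' ! Suc m)]) (mrg m (spl k \<eta>))"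
proof -
  consider "m = k" | "m = Suc k" | "k = Suc m" | "Suc k < m" | "Suc m < k" by linarith
  then show ?thesis
  proof cases
    case 1
    have "(z' ! m \<noteq> z' ! Suc m) = z ! m" using assms(2,3) 1 by (simp add: z'_def nth_put)
    then have "z = (del m z')[m := (z' ! m \<noteq> z' ! Suc m)]"
      using assms(2) 1 types_spl(1)[of m z s t "z ! m"] by (simp only: z'_def list_update_id)
    then show ?thesis
      using assms(2,3) 1 by (intro nc_eq[OF assms(1)]) (auto simp: mrg_spl_same z'_def)
  next
    case 2
    have "nc ((put k s ((del k z)[k := (z ! k \<noteq> z ! Suc k)]))[Suc k := (t \<noteq> z ! Suc k)])
        (spl k (mrg k \<eta>))"
      by (intro nc_spl IH) (use assms(2-4) 2 in auto)
    moreover have "(put k s ((del k z)[k := (z ! k \<noteq> z ! Suc k)]))[Suc k := (t \<noteq> z ! Suc k)]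
        = (del m z')[m := (z' ! m \<noteq> z' ! Suc m)]"
      using assms(2-4) 2 types_spl(2)[of k z s "z ! k \<noteq> z ! Suc k" "t \<noteq> z ! Suc k" t]
      by (simp add: z'_def nth_put)
    ultimately show ?thesis
      by (rule nc_eq) (use assms(2-4) 2 in \<open>simp_all add: mrg_spl_Suc z'_def\<close>)
  next
    case 3
    have "nc ((put m (z ! m \<noteq> s) ((del m z)[m := (z ! m \<noteq> z ! Suc m)]))[Suc m := t])
        (spl m (mrg m \<eta>))"
      by (intro nc_spl IH) (use assms(2-4) 3 in auto)
    moreover have "(put m (z ! m \<noteq> s) ((del m z)[m := (z ! m \<noteq> z ! Suc m)]))[Suc m := t]
        = (del m z')[m := (z' ! m \<noteq> z' ! Suc m)]"
      using assms(2-4) 3 types_spl(3)[of m z "z ! m \<noteq> s" "z ! m \<noteq> z ! Suc m" t s]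
      by (simp add: z'_def nth_put)
    ultimately show ?thesis
      by (rule nc_eq) (use assms(2-4) 3 in \<open>simp_all add: mrg_spl_pred z'_def\<close>)
  next
    case 4
    have "nc ((put k s ((del (m - 1) z)[m - 1 := (z ! (m - 1) \<noteq> z ! Suc (m - 1))]))[Suc k := t])
        (spl k (mrg (m - 1) \<eta>))"
      by (intro nc_spl IH) (use assms(2-4) 4 in \<open>auto simp: nth_del nth_list_update\<close>)
    moreover have "(put k s ((del (m - 1) z)[m - 1 := (z ! (m - 1) \<noteq> z ! Suc (m - 1))]))[Suc k := t]
        = (del m z')[m := (z' ! m \<noteq> z' ! Suc m)]"
      using assms(2-4) 4 types_spl(4)[of k m z s "z ! (m - 1) \<noteq> z ! m" t]
      by (simp add: z'_def nth_put)
    ultimately show ?thesis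
      by (rule nc_eq) (use assms(2-4) 4 in \<open>simp_all add: mrg_spl_gt z'_def\<close>)
  next
    case 5
    have "nc ((put (k - 1) s ((del m z)[m := (z ! m \<noteq> z ! Suc m)]))[Suc (k - 1) := t])
        (spl (k - 1) (mrg m \<eta>))"
      by (intro nc_spl IH) (use assms(2-4) 5 in \<open>auto simp: nth_del nth_list_update\<close>)
    moreover have "(put (k - 1) s ((del m z)[m := (z ! m \<noteq> z ! Suc m)]))[Suc (k - 1) := t]
        = (del m z')[m := (z' ! m \<noteq> z' ! Suc m)]"
      using assms(2-4) 5 types_spl(5)[of m k z s "z ! m \<noteq> z ! Suc m" t]
      by (simp add: z'_def nth_put)
    ultimately show ?thesis
      by (rule nc_eq) (use assms(2-4) 5 in \<open>simp_all add: mrg_spl_lt z'_def\<close>)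
  qed
qed

text \<open>Joining the blocks of two neighbours keeps a partition noncrossing, and the exclusive or
  of the two labels keeps its parity. The proof uses the commutation rules in place of
  partitions.\<close>

lemma nc_mrg:
  "nc z \<eta> \<Longrightarrow> Suc m < length z \<Longrightarrow> nc ((del m z)[m := (z ! m \<noteq> z ! Suc m)]) (mrg m \<eta>)"
proof (induction z \<eta> arbitrary: m rule: nc.induct)
  case (nc_ins z \<eta> k)
  then show ?case by (intro nc_mrg_ins) auto
next
  case (nc_spl z \<eta> k s t)
  then show ?case by (intro nc_mrg_spl) auto
next
  case (nc_zero z)
  then show ?case by (simp add: mrg_def nc.nc_zero)
next
  case (nc_add z \<eta> \<zeta>)
  then show ?case by (auto simp: mrg_def intro: nc_eq[OF nc.nc_add])
next
  case (nc_scale z \<eta> c)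
  then show ?case by (auto simp: mrg_def intro: nc_eq[OF nc.nc_scale])
next
  case (nc_cong z \<eta> \<zeta>)
  then show ?case by (auto simp: mrg_def intro!: nc_eq[OF nc_cong.IH])
qed simp


section \<open>Orthogonal projections\<close>

text \<open>Only values on \<open>I\<close> count, and the proof is by induction on
  \<open>I\<close>: the functions of \<open>C\<close> that vanish at the new point form a subspace
  treated by the hypothesis, and at most one direction orthogonal to it remains.\<close>

lemma orthogonal_projection_exists:
  fixes C :: "('i \<Rightarrow> real) set"
  assumes "finite I" "(\<lambda>_. 0) \<in> C" "\<And>f g. f \<in> C \<Longrightarrow> g \<in> C \<Longrightarrow> (\<lambda>x. f x + g x) \<in> C"
    and "\<And>c f. f \<in> C \<Longrightarrow> (\<lambda>x. c * f x) \<in> C"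
  shows "\<exists>f\<in>C. \<forall>g\<in>C. (\<Sum>x\<in>I. (v x - f x) * g x) = 0"
  using assms
proof (induction I arbitrary: C v rule: finite_induct)
  case empty
  then show ?case by auto
next
  case (insert i I)
  show ?case
  proof (cases "\<forall>f\<in>C. f i = 0")
    case True
    obtain f where "f \<in> C" "\<forall>g\<in>C. (\<Sum>x\<in>I. (v x - f x) * g x) = 0"
      using insert.IH[of C v, OF insert.prems] by blast
    then show ?thesis using True insert.hyps by (intro bexI[of _ f]) simp_all
  next
    case False
    then obtain b where b: "b \<in> C" "b i \<noteq> 0" by blast
    \<comment> \<open>Of codimension one in \<open>C\<close>: subtracting a suitable multiple of
      \<open>b\<close> from a member of \<open>C\<close> makes it vanish at
      \<open>i\<close>.\<close>
    define C' where "C' = {f \<in> C. f i = 0}"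
    have ex: "\<exists>f\<in>C'. \<forall>g\<in>C'. (\<Sum>x\<in>I. (v x - f x) * g x) = 0" for v
      by (rule insert.IH) (auto simp: C'_def insert.prems)
    obtain b0 where b0: "b0 \<in> C'" "\<And>g. g \<in> C' \<Longrightarrow> (\<Sum>x\<in>I. (b x - b0 x) * g x) = 0"
      using ex[of b] by blast
    obtain v0 where v0: "v0 \<in> C'" "\<And>g. g \<in> C' \<Longrightarrow> (\<Sum>x\<in>I. (v x - v0 x) * g x) = 0"
      using ex[of v] by blast
    let ?ip = "\<lambda>f g :: 'i \<Rightarrow> real. \<Sum>x\<in>insert i I. f x * g x"
    have ip0: "?ip f g = (\<Sum>x\<in>I. f x * g x)" if "g \<in> C'" for f g
      using that insert.hyps by (simp add: C'_def)
    have diff: "(\<lambda>x. f x - c * g x) \<in> C" if "f \<in> C" "g \<in> C" for f g c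
      using insert.prems(2)[OF that(1) insert.prems(3)[OF that(2), of "- c"]] by simp
    define b' where "b' = (\<lambda>x. b x - b0 x)"
    have b': "b' \<in> C" "b' i = b i"
      using diff[of b b0 1] b b0(1) by (simp_all add: b'_def C'_def)
    have "?ip b' b' > 0"
    proof -
      have "0 < b' i * b' i" using b b' by (simp add: zero_less_mult_iff) linarith
      also have "\<dots> \<le> ?ip b' b'" using insert.hyps by (intro member_le_sum) auto
      finally show ?thesis .
    qed
    define t where "t = ?ip (\<lambda>x. v x - v0 x) b' / ?ip b' b'"
    define f where "f = (\<lambda>x. v0 x + t * b' x)"
    have lin: "?ip (\<lambda>x. v x - f x) g = ?ip (\<lambda>x. v x - v0 x) g - t * ?ip b' g" for g
      by (simp add: f_def sum_distrib_left sum_subtractf algebra_simps sum.distrib del: sum.insert)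
    have "f \<in> C"
      unfolding f_def using v0(1) b'(1) by (intro insert.prems) (auto simp: C'_def)
    moreover have "?ip (\<lambda>x. v x - f x) g = 0" if g: "g \<in> C" for g
    proof -
      define s where "s = g i / b i"
      define g' where "g' = (\<lambda>x. g x - s * b' x)"
      have g': "g' \<in> C'" proof -
        have "g i - s * b' i = 0" using b b'(2) by (simp add: s_def)
        then show ?thesis using diff[OF g b'(1), of s] by (simp add: C'_def g'_def)
      qed
      have "?ip (\<lambda>x. v x - f x) g' = 0"
        using v0(2)[OF g'] b0(2)[OF g'] by (simp only: lin ip0[OF g'] b'_def)
      moreover have "?ip (\<lambda>x. v x - f x) b' = 0"
        using \<open>?ip b' b' > 0\<close> by (simp only: lin) (simp add: t_def del: sum.insert)
      moreover have "?ip (\<lambda>x. v x - f x) g = ?ip (\<lambda>x. v x - f x) g' + s * ?ip (\<lambda>x. v x - f x) b'"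
        by (simp add: g'_def sum_distrib_left sum.distrib[symmetric] algebra_simps del: sum.insert)
      ultimately show ?thesis by simp
    qed
    ultimately show ?thesis by blast
  qed
qed

section \<open>Projections onto the noncrossing span and the relations of their matrices\<close>

definition is_proj :: "bool list \<Rightarrow> ('n::finite list \<Rightarrow> real) \<Rightarrow> ('n list \<Rightarrow> real) \<Rightarrow> bool" where
  "is_proj z v f \<longleftrightarrow> nc z f \<and> (\<forall>g. nc z g \<longrightarrow> (\<Sum>x\<in>tuples (length z). (v x - f x) * g x) = 0)"

lemma is_proj_exists: "\<exists>f. is_proj z v f"
  using orthogonal_projection_exists[of "tuples (length z)" "{f. nc z f}" v]
  by (auto simp: is_proj_def intro: nc_zero nc_add nc_scale)

lemma is_proj_unique:
  assumes "is_proj z v f" "is_proj z v f'" "length x = length z"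
  shows "f x = f' x"
proof -
  define d where "d = (\<lambda>x. f x - f' x)"
  have "nc z (\<lambda>x. f x + (-1) * f' x)"
    using assms(1,2) by (intro nc_add nc_scale) (auto simp: is_proj_def)
  then have "nc z d" by (simp add: d_def)
  then have "(\<Sum>x\<in>tuples (length z). (v x - f x) * d x) = 0"
    "(\<Sum>x\<in>tuples (length z). (v x - f' x) * d x) = 0"
    using assms(1,2) by (auto simp: is_proj_def)
  then have "(\<Sum>x\<in>tuples (length z). (v x - f' x) * d x) - (\<Sum>x\<in>tuples (length z). (v x - f x) * d x) = 0"
    by simp
  also have "(\<Sum>x\<in>tuples (length z). (v x - f' x) * d x) - (\<Sum>x\<in>tuples (length z). (v x - f x) * d x)
      = (\<Sum>x\<in>tuples (length z). d x * d x)"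
    unfolding sum_subtractf[symmetric] by (rule sum.cong) (simp_all add: d_def algebra_simps)
  finally have "\<forall>x\<in>tuples (length z). d x * d x = 0"
    by (subst (asm) sum_nonneg_eq_0_iff) auto
  then show ?thesis using assms(3) by (simp add: d_def)
qed

text \<open>The matrix of the projection, one chosen column for each \<open>y\<close>. The choice is
  immaterial on tuples of the right length, by \<open>is_proj_unique\<close>.\<close>

definition nc_ker :: "bool list \<Rightarrow> 'n::finite list \<Rightarrow> 'n list \<Rightarrow> real" where
  "nc_ker z x y = (SOME f. is_proj z (\<lambda>w. of_bool (w = y)) f) x"

lemma is_proj_nc_ker: "is_proj z (\<lambda>w. of_bool (w = y)) (\<lambda>x. nc_ker z x y)"
  unfolding nc_ker_def by (rule someI_ex[OF is_proj_exists])

lemma nc_nc_ker: "nc z (\<lambda>x. nc_ker z x y)"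
  using is_proj_nc_ker[of z y] by (simp add: is_proj_def)

text \<open>Reproducing property. With a column of the kernel in place of \<open>g\<close> it yields
  the symmetry of the kernel.\<close>

lemma sum_nc_ker:
  assumes "nc z g" "length y = length z"
  shows "(\<Sum>w\<in>tuples (length z). nc_ker z w y * g w) = g y"
proof -
  have "(\<Sum>w\<in>tuples (length z). (of_bool (w = y) - nc_ker z w y) * g w) = 0"
    using is_proj_nc_ker[of z y] assms(1) by (simp add: is_proj_def)
  then have "(\<Sum>w\<in>tuples (length z). nc_ker z w y * g w) = (\<Sum>w\<in>tuples (length z). of_bool (w = y) * g w)"
    by (simp add: left_diff_distrib sum_subtractf)
  also have "\<dots> = (\<Sum>w\<in>tuples (length z). if w = y then g w else 0)"
    by (rule sum.cong) auto
  also have "\<dots> = g y" using assms(2) by (intro sum_tuples_delta) simp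
  finally show ?thesis .
qed

lemma nc_ker_Nil: "nc_ker [] [] [] = 1"
  using sum_nc_ker[OF nc_Nil, of "[]"] by simp

lemma nc_ker_sym:
  assumes "length x = length z" "length y = length z"
  shows "nc_ker z x y = nc_ker z y x"
proof -
  have "nc_ker z x y = (\<Sum>w\<in>tuples (length z). nc_ker z w x * nc_ker z w y)"
    using sum_nc_ker[OF nc_nc_ker assms(1)] by simp
  also have "\<dots> = (\<Sum>w\<in>tuples (length z). nc_ker z w y * nc_ker z w x)"
    by (simp add: mult.commute)
  also have "\<dots> = nc_ker z y x"
    using sum_nc_ker[OF nc_nc_ker assms(2)] by simp
  finally show ?thesis .
qed

lemma dup_del: "Suc m < length x \<Longrightarrow> x ! m = x ! Suc m \<Longrightarrow> dup m (del m x) = x"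
  by (intro nth_equalityI) (auto simp: nth_del nth_dup le_less_Suc_eq le_eq_less_or_eq)

lemma put_del: "m < length x \<Longrightarrow> put m (x ! m) (del m x) = x"
  by (intro nth_equalityI) (auto simp: nth_del nth_put)

lemma mrg_adjoint:
  fixes h g :: "'n::finite list \<Rightarrow> 'b::comm_semiring_0"
  assumes "m < n"
  shows "(\<Sum>x\<in>tuples n. mrg m h x * g x) = (\<Sum>x\<in>tuples (Suc n). h x * spl m g x)"
proof -
  have "(\<Sum>x\<in>tuples n. mrg m h x * g x)
      = (\<Sum>x\<in>{x \<in> tuples (Suc n). x ! m = x ! Suc m}. h x * g (del m x))"
    by (rule sum.reindex_bij_witness[of _ "del m" "dup m"])
      (use assms in \<open>auto simp: mrg_def del_dup_same dup_del nth_dup\<close>)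
  also have "\<dots> = (\<Sum>x\<in>tuples (Suc n). h x * spl m g x)"
    by (rule sum.mono_neutral_cong_left) (auto simp: spl_def)
  finally show ?thesis .
qed

lemma cap_adjoint:
  fixes h g :: "'n::finite list \<Rightarrow> 'b::comm_semiring_0"
  assumes "m \<le> n"
  shows "(\<Sum>x\<in>tuples n. cap m h x * g x) = (\<Sum>x\<in>tuples (Suc n). h x * ins m g x)"
proof -
  have "(\<Sum>x\<in>tuples n. cap m h x * g x) = (\<Sum>(x, a)\<in>tuples n \<times> UNIV. h (put m a x) * g x)"
    by (simp add: cap_def sum_distrib_right sum.cartesian_product)
  also have "\<dots> = (\<Sum>x\<in>tuples (Suc n). h x * ins m g x)"
    by (rule sum.reindex_bij_witness[of _ "\<lambda>x. (del m x, x ! m)" "\<lambda>(x, a). put m a x"])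
      (use assms in \<open>auto simp: ins_def del_put_same put_del nth_put\<close>)
  finally show ?thesis .
qed

text \<open>A linear map that sends one subspace into another, and whose adjoint sends the second
  into the first, intertwines the orthogonal projections. Here the map is \<open>mrg m\<close> and
  its adjoint is \<open>spl m\<close>; in \<open>is_proj_cap\<close> they are \<open>cap m\<close>
  and \<open>ins m\<close>.\<close>

lemma is_proj_mrg:
  assumes "is_proj z v f" "Suc m < length z"
  shows "is_proj ((del m z)[m := (z ! m \<noteq> z ! Suc m)]) (mrg m v) (mrg m f)"
proof -
  let ?z = "(del m z)[m := (z ! m \<noteq> z ! Suc m)]"
  obtain n where n: "length z = Suc n" "m < n" using assms(2) by (cases "length z") auto
  have z: "(put m (z ! m) ?z)[Suc m := z ! Suc m] = z"
    using assms(2) by (intro nth_equalityI) (auto simp: nth_del nth_put nth_list_update)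
  have "(\<Sum>x\<in>tuples (length ?z). (mrg m v x - mrg m f x) * g x) = 0" if "nc ?z g" for g
  proof -
    have "nc z (spl m g)"
      by (subst z[symmetric], rule nc_spl[OF that]) (use assms(2) in auto)
    then have "0 = (\<Sum>x\<in>tuples (Suc n). (\<lambda>x. v x - f x) x * spl m g x)"
      using assms(1) n(1) by (simp add: is_proj_def)
    also have "\<dots> = (\<Sum>x\<in>tuples n. mrg m (\<lambda>x. v x - f x) x * g x)"
      by (rule mrg_adjoint[symmetric]) (use n in auto)
    also have "\<dots> = (\<Sum>x\<in>tuples (length ?z). (mrg m v x - mrg m f x) * g x)"
      using n by (simp add: mrg_def)
    finally show ?thesis ..
  qed
  then show ?thesis
    using assms nc_mrg[of z f m] by (simp add: is_proj_def)
qed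

lemma is_proj_cap:
  assumes "is_proj z v f" "m < length z" "\<not> z ! m"
  shows "is_proj (del m z) (cap m v) (cap m f)"
proof -
  obtain n where n: "length z = Suc n" "m \<le> n" using assms(2) by (cases "length z") auto
  have z: "put m False (del m z) = z"
    using assms(2,3) put_del[of m z] by simp
  have "(\<Sum>x\<in>tuples (length (del m z)). (cap m v x - cap m f x) * g x) = 0" if "nc (del m z) g" for g
  proof -
    have "nc z (ins m g)"
      using nc_ins[OF that, of m] assms(2) n by (simp add: z)
    then have "0 = (\<Sum>x\<in>tuples (Suc n). (\<lambda>x. v x - f x) x * ins m g x)"
      using assms(1) n(1) by (simp add: is_proj_def)
    also have "\<dots> = (\<Sum>x\<in>tuples n. cap m (\<lambda>x. v x - f x) x * g x)"
      by (rule cap_adjoint[symmetric]) (use n in auto)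
    also have "\<dots> = (\<Sum>x\<in>tuples (length (del m z)). (cap m v x - cap m f x) * g x)"
      using n by (simp add: cap_def sum_subtractf)
    finally show ?thesis ..
  qed
  then show ?thesis
    using assms nc_cap[of z f m] by (simp add: is_proj_def)
qed

lemma is_proj_cong:
  assumes "is_proj z v f" "\<And>x. length x = length z \<Longrightarrow> v x = v' x"
  shows "is_proj z v' f"
  using assms by (simp add: is_proj_def)

lemma is_proj_zero: "is_proj z (\<lambda>_. 0) (\<lambda>_. 0)"
  by (simp add: is_proj_def nc_zero)

text \<open>Apply \<open>is_proj_mrg\<close> to the basis vector of the column index: restricted to
  the diagonal it is a basis vector or zero. The kernel thus obeys the relation that
  \<open>word_merge_row\<close> gives for words.\<close>

lemma nc_ker_merge_row:
  assumes "length x = length z" "length x' = length z" "length y = length z'" "length y' = length z'"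
  shows "nc_ker (z @ s # t # z') (x @ a # a # y) (x' @ b # c # y')
    = (if b = c then nc_ker (z @ (s \<noteq> t) # z') (x @ a # y) (x' @ b # y') else 0)"
proof -
  define m where "m = length z"
  let ?Z = "z @ s # t # z'" and ?Z' = "z @ (s \<noteq> t) # z'" and ?y = "x' @ b # c # y'"
  have type: "(del m ?Z)[m := (?Z ! m \<noteq> ?Z ! Suc m)] = ?Z'"
    by (simp add: m_def del_def nth_append list_update_append)
  have dup: "dup m (u @ d # w) = u @ d # d # w" if "length u = m" for u w :: "'a list" and d
    using that by (simp add: dup_def)
  have "is_proj ?Z' (mrg m (\<lambda>w. of_bool (w = ?y))) (mrg m (\<lambda>x. nc_ker ?Z x ?y))"
    using is_proj_mrg[OF is_proj_nc_ker[of ?Z ?y], of m] unfolding type by (simp add: m_def)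
  then have *: "is_proj ?Z' (\<lambda>w. if b = c then of_bool (w = x' @ b # y') else 0) (mrg m (\<lambda>x. nc_ker ?Z x ?y))"
  proof (rule is_proj_cong)
    fix w :: "'a list" assume w: "length w = length ?Z'"
    then have "length (take m w) = m" "m < length w" by (auto simp: m_def)
    then obtain u d v where uv: "w = u @ d # v" "length u = m"
      using id_take_nth_drop[of m w] by metis
    show "mrg m (\<lambda>w. of_bool (w = ?y)) w = (if b = c then of_bool (w = x' @ b # y') else 0)"
      unfolding mrg_def uv(1) dup[OF uv(2)] using uv(2) assms by (auto simp: m_def)
  qed
  have len: "length (x @ a # y) = length ?Z'" using assms by simp
  have dupx: "nc_ker ?Z (x @ a # a # y) ?y = mrg m (\<lambda>x. nc_ker ?Z x ?y) (x @ a # y)"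
    using dup[of x a y] assms by (simp add: mrg_def m_def)
  show ?thesis
  proof (cases "b = c")
    case True
    then have "is_proj ?Z' (\<lambda>w. of_bool (w = x' @ b # y')) (mrg m (\<lambda>x. nc_ker ?Z x ?y))"
      using * by simp
    from is_proj_unique[OF this is_proj_nc_ker len] show ?thesis using True dupx by simp
  next
    case False
    then have "is_proj ?Z' (\<lambda>w. 0) (mrg m (\<lambda>x. nc_ker ?Z x ?y))" using * by simp
    from is_proj_unique[OF this is_proj_zero len] show ?thesis using False dupx by simp
  qed
qed

lemma nc_ker_merge_col:
  assumes "length x = length z" "length x' = length z" "length y = length z'" "length y' = length z'"
  shows "nc_ker (z @ s # t # z') (x @ a # d # y) (x' @ b # b # y')
    = (if a = d then nc_ker (z @ (s \<noteq> t) # z') (x @ a # y) (x' @ b # y') else 0)"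
  using assms nc_ker_merge_row[of x' z x y' z' y s t b a d]
    nc_ker_sym[of "x @ a # d # y" "z @ s # t # z'" "x' @ b # b # y'"]
    nc_ker_sym[of "x @ a # y" "z @ (s \<noteq> t) # z'" "x' @ b # y'"]
  by (cases "a = d") simp_all

lemma nc_ker_sum_row:
  assumes "length x = length z" "length x' = length z" "length y = length z'" "length y' = length z'"
  shows "(\<Sum>a\<in>UNIV. nc_ker (z @ False # z') (x @ a # y) (x' @ b # y')) = nc_ker (z @ z') (x @ y) (x' @ y')"
proof -
  define m where "m = length z"
  let ?Z = "z @ False # z'" and ?y = "x' @ b # y'"
  have type: "del m ?Z = z @ z'" by (simp add: m_def del_def)
  have put: "put m d (u @ w) = u @ d # w" if "length u = m" for u w :: "'a list" and d
    using that by (simp add: put_def)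
  have "is_proj (z @ z') (cap m (\<lambda>w. of_bool (w = ?y))) (cap m (\<lambda>x. nc_ker ?Z x ?y))"
    using is_proj_cap[OF is_proj_nc_ker[of ?Z ?y], of m] unfolding type by (simp add: m_def)
  then have *: "is_proj (z @ z') (\<lambda>w. of_bool (w = x' @ y')) (cap m (\<lambda>x. nc_ker ?Z x ?y))"
  proof (rule is_proj_cong)
    fix w :: "'a list" assume w: "length w = length (z @ z')"
    define u v where "u = take m w" and "v = drop m w"
    have uv: "w = u @ v" "length u = m" using w by (auto simp: u_def v_def m_def)
    have eq: "of_bool (u @ d # v = ?y) = (if d = b then of_bool (w = x' @ y') else (0::real))" for d
      using uv assms by (auto simp: m_def)
    have "cap m (\<lambda>w. of_bool (w = ?y)) w = (\<Sum>d\<in>UNIV. if d = b then of_bool (w = x' @ y') else (0::real))"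
      unfolding cap_def uv(1) put[OF uv(2)] by (intro sum.cong refl) (use eq uv(1) in simp)
    then show "cap m (\<lambda>w. of_bool (w = ?y)) w = (of_bool (w = x' @ y') :: real)" by simp
  qed
  have len: "length (x @ y) = length (z @ z')" using assms by simp
  have "length x = m" using assms by (simp add: m_def)
  with is_proj_unique[OF * is_proj_nc_ker len] show ?thesis by (simp add: cap_def put)
qed

lemma nc_ker_sum_col:
  assumes "length x = length z" "length x' = length z" "length y = length z'" "length y' = length z'"
  shows "(\<Sum>b\<in>UNIV. nc_ker (z @ False # z') (x @ a # y) (x' @ b # y')) = nc_ker (z @ z') (x @ y) (x' @ y')"
  using assms nc_ker_sum_row[of x' z x y' z' y a]
  by (simp add: nc_ker_sym[of "x @ a # y"] nc_ker_sym[of "x @ y"])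

section \<open>The functional defined by the noncrossing projections\<close>

text \<open>Adjoint flags are dropped because the generators are to become self-adjoint. Only
  letters \<open>u\<close> occur; \<open>p\<close> enters as \<open>u\<close> written twice.\<close>

fun haar_word :: "'n::finite hyp_word \<Rightarrow> complex" where
  "haar_word (Word w) = of_real (nc_ker (replicate (length w) True) (map (fst \<circ> fst) w) (map (snd \<circ> fst) w))"

lemma haar_word_flags: "map fst v = map fst w \<Longrightarrow> haar_word (Word v) = haar_word (Word w)"
proof -
  assume a: "map fst v = map fst w"
  have "map (fst \<circ> fst) v = map (fst \<circ> fst) w" "map (snd \<circ> fst) v = map (snd \<circ> fst) w"
    using arg_cong[OF a, of "map fst"] arg_cong[OF a, of "map snd"] by simp_all
  then show ?thesis using map_eq_imp_length_eq[OF a] by simp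
qed

lemma haar_word_append:
  "haar_word (Word (a @ c @ b)) = of_real (nc_ker
     (replicate (length a) True @ replicate (length c) True @ replicate (length b) True)
     (map (fst \<circ> fst) a @ map (fst \<circ> fst) c @ map (fst \<circ> fst) b)
     (map (snd \<circ> fst) a @ map (snd \<circ> fst) c @ map (snd \<circ> fst) b))"
  by (simp add: replicate_add)

lemma haar_word_row: "j \<noteq> k \<Longrightarrow> haar_word (Word (a @ [((i, j), s), ((i, k), t)] @ b)) = 0"
  unfolding haar_word_append by (simp add: nc_ker_merge_row numeral_2_eq_2)

lemma haar_word_col: "i \<noteq> k \<Longrightarrow> haar_word (Word (a @ [((i, j), s), ((k, j), t)] @ b)) = 0"
  unfolding haar_word_append by (simp add: nc_ker_merge_col numeral_2_eq_2)

text \<open>The fourth power reduces to the square by two merges, with labels \<open>True\<close>,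
  \<open>True\<close> first and then \<open>False\<close>, \<open>True\<close>.\<close>

lemma haar_word_idem:
  "haar_word (Word (a @ [((i, j), s), ((i, j), t), ((i, j), s'), ((i, j), t')] @ b))
    = haar_word (Word (a @ [((i, j), s), ((i, j), t)] @ b))"
proof -
  let ?A = "replicate (length a) True" and ?B = "replicate (length b) True"
  let ?x = "map (fst \<circ> fst) a" and ?x' = "map (snd \<circ> fst) a"
    and ?y = "map (fst \<circ> fst) b" and ?y' = "map (snd \<circ> fst) b"
  have "nc_ker (?A @ True # True # True # True # ?B) (?x @ i # i # i # i # ?y) (?x' @ j # j # j # j # ?y')
      = nc_ker (?A @ False # True # True # ?B) (?x @ i # i # i # ?y) (?x' @ j # j # j # ?y')"
    using nc_ker_merge_row[of ?x ?A ?x' "i # i # ?y" "True # True # ?B" "j # j # ?y'" True True i j j] by simp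
  also have "\<dots> = nc_ker (?A @ True # True # ?B) (?x @ i # i # ?y) (?x' @ j # j # ?y')"
    using nc_ker_merge_row[of ?x ?A ?x' "i # ?y" "True # ?B" "j # ?y'" False True i j j] by simp
  finally show ?thesis unfolding haar_word_append by simp
qed

lemma haar_word_sum_col: "(\<Sum>k\<in>UNIV. haar_word (Word (a @ [((k, j), s), ((k, j), t)] @ b))) = haar_word (Word (a @ b))"
  and haar_word_sum_row: "(\<Sum>k\<in>UNIV. haar_word (Word (a @ [((j, k), s), ((j, k), t)] @ b))) = haar_word (Word (a @ b))"
proof -
  let ?A = "replicate (length a) True" and ?B = "replicate (length b) True"
  let ?x = "map (fst \<circ> fst) a" and ?x' = "map (snd \<circ> fst) a"
    and ?y = "map (fst \<circ> fst) b" and ?y' = "map (snd \<circ> fst) b"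
  have *: "haar_word (Word (a @ [((i, j), s), ((i, j), t)] @ b))
      = of_real (nc_ker (?A @ False # ?B) (?x @ i # ?y) (?x' @ j # ?y'))" for i j
    unfolding haar_word_append
    using nc_ker_merge_row[of ?x ?A ?x' ?y ?B ?y' True True i j j] by simp
  have **: "haar_word (Word (a @ b)) = of_real (nc_ker (?A @ ?B) (?x @ ?y) (?x' @ ?y'))"
    using haar_word_append[of a "[]" b] by simp
  show "(\<Sum>k\<in>UNIV. haar_word (Word (a @ [((k, j), s), ((k, j), t)] @ b))) = haar_word (Word (a @ b))"
    unfolding * ** of_real_sum[symmetric] by (subst nc_ker_sum_row) simp_all
  show "(\<Sum>k\<in>UNIV. haar_word (Word (a @ [((j, k), s), ((j, k), t)] @ b))) = haar_word (Word (a @ b))"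
    unfolding * ** of_real_sum[symmetric] by (subst nc_ker_sum_col) simp_all
qed

text \<open>Testing between arbitrary words makes these elements a two-sided ideal, so the relations
  need to be checked on relators only.\<close>

definition vanishing :: "('n::finite hyp_word \<Rightarrow>\<^sub>0 complex) \<Rightarrow> bool" where
  "vanishing p \<longleftrightarrow> (\<forall>a b. free_lin haar_word (Poly_Mapping.single (Word a) 1 * p * Poly_Mapping.single (Word b) 1) = 0)"

lemma vanishing_zero: "vanishing 0"
  and vanishing_add: "vanishing p \<Longrightarrow> vanishing q \<Longrightarrow> vanishing (p + q)"
  by (simp_all add: vanishing_def distrib_left distrib_right free_lin_add)

lemma vanishing_mult_left:
  assumes "vanishing p"
  shows "vanishing (q * p)"
proof (induction q rule: poly_mapping_single_induct)
  case (2 m c)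
  obtain v where m: "m = Word v" by (cases m)
  have "Poly_Mapping.single (Word a) 1 * (Poly_Mapping.single m c * p) * Poly_Mapping.single (Word b) 1
      = c *\<^sub>C (Poly_Mapping.single (Word (a @ v)) 1 * p * Poly_Mapping.single (Word b) 1)" for a b
    by (simp add: m mult.assoc[symmetric] mult_single mult_scaleC_left[symmetric] scaleC_single scaleC_complex_def)
  then show ?case
    using assms by (simp add: vanishing_def clinear_scaleC[OF clinear_free_lin])
qed (simp_all add: distrib_right vanishing_zero vanishing_add)

lemma vanishing_mult_right:
  assumes "vanishing p"
  shows "vanishing (p * q)"
proof (induction q rule: poly_mapping_single_induct)
  case (2 m c)
  obtain v where m: "m = Word v" by (cases m)
  have "Poly_Mapping.single (Word a) 1 * (p * Poly_Mapping.single m c) * Poly_Mapping.single (Word b) 1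
      = c *\<^sub>C (Poly_Mapping.single (Word a) 1 * p * Poly_Mapping.single (Word (v @ b)) 1)" for a b
    by (simp add: m mult.assoc mult_single mult_scaleC_right[symmetric] scaleC_single scaleC_complex_def)
  then show ?case
    using assms by (simp add: vanishing_def clinear_scaleC[OF clinear_free_lin])
qed (simp_all add: distrib_left vanishing_zero vanishing_add)

abbreviation hyp_mono :: "(('n \<times> 'n) \<times> bool) list \<Rightarrow> 'n hyp_word \<Rightarrow>\<^sub>0 complex" where
  "hyp_mono w \<equiv> Poly_Mapping.single (Word w) 1"

lemma mono_mult: "hyp_mono v * hyp_mono w = hyp_mono (v @ w)"
  by (simp add: mult_single)

lemma vanishing_mono: "(\<And>a b. haar_word (Word (a @ w @ b)) = 0) \<Longrightarrow> vanishing (hyp_mono w)"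
  by (simp add: vanishing_def mono_mult scaleC_complex_def)

lemma vanishing_mono_diff:
  "(\<And>a b. haar_word (Word (a @ v @ b)) = haar_word (Word (a @ w @ b))) \<Longrightarrow> vanishing (hyp_mono v - hyp_mono w)"
  by (simp add: vanishing_def mono_mult scaleC_complex_def left_diff_distrib right_diff_distrib
      clinear_diff[OF clinear_free_lin])

lemma vanishing_mono_sum:
  "(\<And>a b. (\<Sum>k\<in>UNIV. haar_word (Word (a @ v k @ b))) = haar_word (Word (a @ b)))
    \<Longrightarrow> vanishing ((\<Sum>k\<in>UNIV. hyp_mono (v k)) - hyp_mono [])"
  by (simp add: vanishing_def mono_mult scaleC_complex_def left_diff_distrib right_diff_distrib
      sum_distrib_left sum_distrib_right clinear_diff[OF clinear_free_lin] clinear_sum[OF clinear_free_lin])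

lemma star_mono: "star (hyp_mono w) = hyp_mono (rev (map (\<lambda>(x, s). (x, \<not> s)) w))"
  by (simp add: star_single star_complex_def)

lemma one_mono: "(1 :: 'n hyp_word \<Rightarrow>\<^sub>0 complex) = hyp_mono []"
  by (simp add: single_one[symmetric] zero_hyp_word_def)

lemma letter_mono: "hyp_letter i j = hyp_mono [((i, j), False)]"
  by (simp add: hyp_letter_def)

text \<open>Adjoints of relators are included because \<open>star_ideal\<close> is closed under
  \<open>star\<close>, while the functional is known only to be linear.\<close>

lemma vanishing_relators:
  assumes "r \<in> relators"
  shows "vanishing r \<and> vanishing (star r)"
proof -
  note mono_simps = letter_mono power2_eq_square mono_mult one_mono star_diff star_sum star_mono append_Cons append_Nil
    list.map rev.simps prod.case simp_thms
  have row: "vanishing (hyp_mono [((i, j), s), ((i, k), t)])" if "j \<noteq> k" for i j k :: 'a and s t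
    using haar_word_row[OF that] by (intro vanishing_mono)
  have col: "vanishing (hyp_mono [((i, j), s), ((k, j), t)])" if "i \<noteq> k" for i j k :: 'a and s t
    using haar_word_col[OF that] by (intro vanishing_mono)
  have flags: "vanishing (hyp_mono v - hyp_mono w)" if "map fst v = map fst w" for v w :: "(('a \<times> 'a) \<times> bool) list"
    using that by (intro vanishing_mono_diff haar_word_flags) simp
  have row4: "vanishing (hyp_mono [((i, j), s), ((i, j), t), ((i, k), s'), ((i, k), t')])"
    if "j \<noteq> k" for i j k :: 'a and s t s' t'
    using vanishing_mult_right[OF vanishing_mult_left[OF row[OF that, of i t s'], of "hyp_mono [((i, j), s)]"], of "hyp_mono [((i, k), t')]"]
    by (simp add: mono_mult)
  have col4: "vanishing (hyp_mono [((i, j), s), ((i, j), t), ((k, j), s'), ((k, j), t')])"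
    if "i \<noteq> k" for i j k :: 'a and s t s' t'
    using vanishing_mult_right[OF vanishing_mult_left[OF col[OF that, of j t s'], of "hyp_mono [((i, j), s)]"], of "hyp_mono [((k, j), t')]"]
    by (simp add: mono_mult)
  have idem: "vanishing (hyp_mono [((i, j), s), ((i, j), s), ((i, j), s), ((i, j), s)] - hyp_mono [((i, j), s), ((i, j), s)])"
    for i j :: 'a and s
    by (intro vanishing_mono_diff haar_word_idem)
  have sum_col: "vanishing ((\<Sum>k\<in>UNIV. hyp_mono [((k, j), s), ((k, j), s)]) - hyp_mono [])"
    and sum_row: "vanishing ((\<Sum>k\<in>UNIV. hyp_mono [((j, k), s), ((j, k), s)]) - hyp_mono [])" for j :: 'a and s
    by (intro vanishing_mono_sum haar_word_sum_col haar_word_sum_row)+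
  show ?thesis
    using assms unfolding relators_hyp_word_def hyp_relators_def Un_iff
  proof (elim disjE CollectE exE conjE)
    fix i j assume r: "r = star (hyp_letter i j) - hyp_letter i j"
    show ?thesis unfolding r mono_simps by (intro conjI flags) simp_all
  next
    fix i j k assume r: "r = hyp_letter i j * hyp_letter i k - (if j = k then (hyp_letter i j)\<^sup>2 else 0)"
    show ?thesis
    proof (cases "j = k")
      case True
      then show ?thesis unfolding r by (simp add: power2_eq_square vanishing_zero)
    next
      case False
      then have r': "r = hyp_mono [((i, j), False), ((i, k), False)]" unfolding r by (simp add: letter_mono mono_mult)
      show ?thesis unfolding r' mono_simps by (intro conjI row) (use False in auto)
    qed
  next
    fix i j k assume r: "r = hyp_letter i j * hyp_letter k j - (if i = k then (hyp_letter i j)\<^sup>2 else 0)"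
    show ?thesis
    proof (cases "i = k")
      case True
      then show ?thesis unfolding r by (simp add: power2_eq_square vanishing_zero)
    next
      case False
      then have r': "r = hyp_mono [((i, j), False), ((k, j), False)]" unfolding r by (simp add: letter_mono mono_mult)
      show ?thesis unfolding r' mono_simps by (intro conjI col) (use False in auto)
    qed
  next
    fix i j assume r: "r = star ((hyp_letter i j)\<^sup>2) - (hyp_letter i j)\<^sup>2"
    show ?thesis unfolding r mono_simps by (intro conjI flags) simp_all
  next
    fix i j l assume r: "r = (hyp_letter i j)\<^sup>2 * (hyp_letter i l)\<^sup>2 - (if j = l then (hyp_letter i j)\<^sup>2 else 0)"
    show ?thesis
    proof (cases "j = l")
      case True
      then have r': "r = hyp_mono [((i, j), False), ((i, j), False), ((i, j), False), ((i, j), False)]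
          - hyp_mono [((i, j), False), ((i, j), False)]"
        unfolding r by (simp add: letter_mono mono_mult power2_eq_square)
      show ?thesis unfolding r' mono_simps by (intro conjI idem)
    next
      case False
      then have r': "r = hyp_mono [((i, j), False), ((i, j), False), ((i, l), False), ((i, l), False)]"
        unfolding r by (simp add: letter_mono mono_mult power2_eq_square)
      show ?thesis unfolding r' mono_simps by (intro conjI row4) (use False in auto)
    qed
  next
    fix i j l assume r: "r = (hyp_letter i j)\<^sup>2 * (hyp_letter l j)\<^sup>2 - (if i = l then (hyp_letter i j)\<^sup>2 else 0)"
    show ?thesis
    proof (cases "i = l")
      case True
      then have r': "r = hyp_mono [((i, j), False), ((i, j), False), ((i, j), False), ((i, j), False)]
          - hyp_mono [((i, j), False), ((i, j), False)]"
        unfolding r by (simp add: letter_mono mono_mult power2_eq_square)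
      show ?thesis unfolding r' mono_simps by (intro conjI idem)
    next
      case False
      then have r': "r = hyp_mono [((i, j), False), ((i, j), False), ((l, j), False), ((l, j), False)]"
        unfolding r by (simp add: letter_mono mono_mult power2_eq_square)
      show ?thesis unfolding r' mono_simps by (intro conjI col4) (use False in auto)
    qed
  next
    fix j assume r: "r = (\<Sum>k\<in>UNIV. (hyp_letter k j)\<^sup>2) - 1"
    show ?thesis unfolding r mono_simps by (intro conjI sum_col)
  next
    fix i assume r: "r = (\<Sum>k\<in>UNIV. (hyp_letter i k)\<^sup>2) - 1"
    show ?thesis unfolding r mono_simps by (intro conjI sum_row)
  qed
qed

lemma haar_word_star_ideal:
  assumes "p \<in> star_ideal relators"
  shows "free_lin haar_word p = 0"
proof -
  have "vanishing p \<and> vanishing (star p)"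
    using assms
    by induction (simp_all add: vanishing_zero vanishing_relators vanishing_add vanishing_mult_left
        vanishing_mult_right star_add star_mult star_star)
  then have "free_lin haar_word (hyp_mono [] * p * hyp_mono []) = 0" by (simp add: vanishing_def)
  then show ?thesis by (simp add: one_mono[symmetric])
qed

definition nc_functional :: "'n::finite pol_hyp \<Rightarrow> complex" where
  "nc_functional = presented_ext haar_word"

lemma clinear_nc_functional: "clinear nc_functional"
  unfolding nc_functional_def by (rule clinear_presented_ext[OF haar_word_star_ideal])

lemma nc_functional_gen: "nc_functional (gen (Word w)) = haar_word (Word w)"
  unfolding nc_functional_def by (rule presented_ext_gen[OF haar_word_star_ideal])

section \<open>Values of the functional on words in both letters\<close>

fun expand :: "bool list \<Rightarrow> 'n list \<Rightarrow> 'n list \<Rightarrow> (('n \<times> 'n) \<times> bool) list" where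
  "expand (t # z) (i # x) (j # y)
     = (if t then [((i, j), False)] else [((i, j), False), ((i, j), False)]) @ expand z x y"
| "expand _ _ _ = []"

lemma word_expand:
  "length x = length z \<Longrightarrow> length y = length z \<Longrightarrow> word z x y = gen (Word (expand z x y))"
proof (induction z arbitrary: x y)
  case Nil
  then show ?case by (simp add: gen_zero[symmetric] zero_hyp_word_def)
next
  case (Cons t z)
  then obtain i x' j y' where xy: "x = i # x'" "y = j # y'" by (metis length_Suc_conv length_Cons)
  have "letter t i j = gen (Word (if t then [((i, j), False)] else [((i, j), False), ((i, j), False)]))"
    by (simp add: letter_def u_gen_def power2_eq_square gen_add[symmetric])
  with Cons xy show ?case by (simp add: gen_add[symmetric])
qed

text \<open>Each \<open>p\<close> is spelled \<open>u u\<close> with repeated indices, and one merge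
  undoes this. The prefix \<open>c\<close> collects the letters already treated, since merging takes
  place behind them.\<close>

lemma nc_ker_expand:
  assumes "length x = length z" "length y = length z" "length a = length c" "length b = length c"
  shows "nc_ker (c @ replicate (length (expand z x y)) True)
      (a @ map (fst \<circ> fst) (expand z x y)) (b @ map (snd \<circ> fst) (expand z x y))
    = nc_ker (c @ z) (a @ x) (b @ y)"
  using assms
proof (induction z arbitrary: x y a b c)
  case (Cons t z)
  then obtain i x' j y' where xy: "x = i # x'" "y = j # y'" by (metis length_Suc_conv length_Cons)
  show ?case
  proof (cases t)
    case True
    then show ?thesis using Cons.IH[of x' y' "a @ [i]" "c @ [True]" "b @ [j]"] Cons.prems by (simp add: xy)
  next
    case False
    let ?r = "replicate (length (expand z x' y')) True"
    have "nc_ker (c @ True # True # ?r) (a @ i # i # map (fst \<circ> fst) (expand z x' y'))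
          (b @ j # j # map (snd \<circ> fst) (expand z x' y'))
        = nc_ker (c @ False # ?r) (a @ i # map (fst \<circ> fst) (expand z x' y'))
          (b @ j # map (snd \<circ> fst) (expand z x' y'))"
      using nc_ker_merge_row[of a c b "map (fst \<circ> fst) (expand z x' y')" ?r
          "map (snd \<circ> fst) (expand z x' y')" True True i j j] Cons.prems by simp
    then show ?thesis
      using Cons.IH[of x' y' "a @ [i]" "c @ [False]" "b @ [j]"] Cons.prems False by (simp add: xy comp_def)
  qed
qed simp

lemma nc_functional_word:
  "length x = length z \<Longrightarrow> length y = length z \<Longrightarrow> nc_functional (word z x y) = of_real (nc_ker z x y)"
  using nc_ker_expand[of x z y "[]" "[]" "[]"] by (simp add: word_expand nc_functional_gen)

lemma nc_functional_one: "nc_functional 1 = 1"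
  using nc_functional_word[of "[]" "[]" "[]"] by (simp add: nc_ker_Nil)

text \<open>This is Tannaka--Krein duality for the fixed vectors of the tensor powers.\<close>
lemma fixed_vector_nc:
  fixes \<eta> :: "'n::finite list \<Rightarrow> complex"
  assumes "\<And>x. length x = length z \<Longrightarrow> (\<Sum>y\<in>tuples (length z). \<eta> y *\<^sub>C word z x y) = \<eta> x *\<^sub>C 1"
    and "length x = length z"
  shows "\<eta> x = (\<Sum>y\<in>tuples (length z). \<eta> y * of_real (nc_ker z x y))"
proof -
  \<comment> \<open>Under the functional the matrix of words becomes the projection matrix, so a
    fixed vector equals its own projection.\<close>
  have "nc_functional (\<Sum>y\<in>tuples (length z). \<eta> y *\<^sub>C word z x y) = nc_functional (\<eta> x *\<^sub>C (1 :: 'n pol_hyp))"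
    using assms by simp
  then show ?thesis
    using assms(2)
    by (simp add: clinear_sum[OF clinear_nc_functional] clinear_scaleC[OF clinear_nc_functional]
        nc_functional_word nc_functional_one scaleC_complex_def)
qed

section \<open>Primitive vectors\<close>

text \<open>The primitive vectors are orthogonal to everything that reduces to shorter words.\<close>
definition primitive :: "bool list \<Rightarrow> ('n::finite list \<Rightarrow> complex) \<Rightarrow> bool" where
  "primitive z \<tau> \<longleftrightarrow>
     (\<forall>m x. Suc m < length z \<longrightarrow> Suc (length x) = length z \<longrightarrow> mrg m \<tau> x = 0)
   \<and> (\<forall>m x. m < length z \<longrightarrow> \<not> z ! m \<longrightarrow> Suc (length x) = length z \<longrightarrow> cap m \<tau> x = 0)"

lemma primitive_mrg: "primitive z \<tau> \<Longrightarrow> Suc m < length z \<Longrightarrow> Suc (length x) = length z \<Longrightarrow> mrg m \<tau> x = 0"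
  and primitive_cap: "primitive z \<tau> \<Longrightarrow> m < length z \<Longrightarrow> \<not> z ! m \<Longrightarrow> Suc (length x) = length z \<Longrightarrow> cap m \<tau> x = 0"
  by (simp_all add: primitive_def)

text \<open>Freezing the last coordinate is needed when the coordinate shared by two primitive
  vectors is summed out in \<open>nc_pairs\<close>.\<close>

lemma primitive_snoc:
  assumes "primitive (z @ [t]) \<tau>"
  shows "primitive z (\<lambda>x. \<tau> (x @ [a]))"
  unfolding primitive_def
proof (intro conjI allI impI)
  fix m and x :: "'a list" assume m: "Suc m < length z" "Suc (length x) = length z"
  then have "mrg m (\<lambda>x. \<tau> (x @ [a])) x = mrg m \<tau> (x @ [a])" by (simp add: mrg_def dup_def)
  then show "mrg m (\<lambda>x. \<tau> (x @ [a])) x = 0" using primitive_mrg[OF assms, of m "x @ [a]"] m by simp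
next
  fix m and x :: "'a list" assume m: "m < length z" "\<not> z ! m" "Suc (length x) = length z"
  then have "cap m (\<lambda>x. \<tau> (x @ [a])) x = cap m \<tau> (x @ [a])" by (simp add: cap_def put_def)
  then show "cap m (\<lambda>x. \<tau> (x @ [a])) x = 0"
    using primitive_cap[OF assms, of m "x @ [a]"] m by (simp add: nth_append)
qed

lemma primitive_diff_scale:
  "primitive z f \<Longrightarrow> primitive z g \<Longrightarrow> primitive z (\<lambda>x. f x - c * g x)"
  unfolding primitive_def mrg_def cap_def by (simp add: sum_subtractf sum_distrib_left[symmetric])

lemma primitive_cnj: "primitive z f \<Longrightarrow> primitive z (\<lambda>x. cnj (f x))"
  unfolding primitive_def mrg_def cap_def by (simp flip: cnj_sum)

text \<open>The pairing is bilinear, without conjugation. The equations defining primitivity are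
  real, so \<open>cnj f\<close> is an admissible test vector and gives the squared norm.\<close>

lemma primitive_orthogonal_zero:
  assumes "primitive z f" "\<And>g. primitive z g \<Longrightarrow> (\<Sum>x\<in>tuples (length z). g x * f x) = 0"
    and "length x = length z"
  shows "f x = 0"
proof -
  have "(\<Sum>x\<in>tuples (length z). cnj (f x) * f x) = 0"
    by (intro assms(2) primitive_cnj assms(1))
  then have "complex_of_real (\<Sum>x\<in>tuples (length z). (cmod (f x))\<^sup>2) = 0"
    by (simp add: complex_norm_square mult.commute del: of_real_power)
  then have "(\<Sum>x\<in>tuples (length z). (cmod (f x))\<^sup>2) = 0" by (simp only: of_real_eq_0_iff)
  then have "\<forall>x\<in>tuples (length z). (cmod (f x))\<^sup>2 = 0"
    by (subst (asm) sum_nonneg_eq_0_iff) auto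
  then show ?thesis using assms(3) by simp
qed


section \<open>Noncrossing vectors against primitive vectors\<close>

text \<open>The second vector is read backwards, so that the last coordinates of both vectors meet
  at the seam. In \<open>pair1\<close> these two coordinates are identified.\<close>

definition pair0 :: "nat \<Rightarrow> ('n list \<Rightarrow> complex) \<Rightarrow> ('n list \<Rightarrow> complex) \<Rightarrow> 'n list \<Rightarrow> complex" where
  "pair0 k \<tau> \<tau>' X = \<tau> (take k X) * \<tau>' (rev (drop k X))"

definition pair1 :: "nat \<Rightarrow> ('n list \<Rightarrow> complex) \<Rightarrow> ('n list \<Rightarrow> complex) \<Rightarrow> 'n list \<Rightarrow> complex" where
  "pair1 k \<tau> \<tau>' X = \<tau> (take (Suc k) X) * \<tau>' (rev (drop k X))"

lemma take_put:
  "m < k \<Longrightarrow> k \<le> Suc (length x) \<Longrightarrow> take k (put m a x) = put m a (take (k - 1) x)"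
  "k \<le> m \<Longrightarrow> m \<le> length x \<Longrightarrow> take k (put m a x) = take k x"
  by (auto simp: put_def take_Cons' drop_take min_def)

lemma drop_put:
  "m < k \<Longrightarrow> k \<le> Suc (length x) \<Longrightarrow> drop k (put m a x) = drop (k - 1) x"
  "k \<le> m \<Longrightarrow> m \<le> length x \<Longrightarrow> drop k (put m a x) = put (m - k) a (drop k x)"
  by (auto simp: put_def drop_Cons' drop_take min_def)

lemma take_dup:
  "Suc m < k \<Longrightarrow> k \<le> Suc (length x) \<Longrightarrow> take k (dup m x) = dup m (take (k - 1) x)"
  "k \<le> Suc m \<Longrightarrow> m < length x \<Longrightarrow> take k (dup m x) = take k x"
  by (auto simp: dup_def drop_take min_def)

lemma drop_dup:
  "m < k \<Longrightarrow> m < length x \<Longrightarrow> drop k (dup m x) = drop (k - 1) x"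
  "k \<le> m \<Longrightarrow> m < length x \<Longrightarrow> drop k (dup m x) = dup (m - k) (drop k x)"
  by (simp_all add: dup_def drop_take min.absorb2 Suc_leI Suc_diff_le)

lemma rev_put: "m \<le> length x \<Longrightarrow> rev (put m a x) = put (length x - m) a (rev x)"
  by (simp add: put_def rev_take rev_drop)

lemma rev_dup: "m < length x \<Longrightarrow> rev (dup m x) = dup (length x - Suc m) (rev x)"
proof -
  assume "m < length x"
  then have "length x - m = Suc (length x - Suc m)" by simp
  then show ?thesis by (simp add: dup_def rev_take rev_drop)
qed

lemma cap_pair0:
  assumes "primitive z \<tau>" "primitive z' \<tau>'" "m < length z + length z'" "\<not> (z @ rev z') ! m"
    "Suc (length X) = length z + length z'"
  shows "cap m (pair0 (length z) \<tau> \<tau>') X = 0"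
proof (cases "m < length z")
  case True
  then have "cap m (pair0 (length z) \<tau> \<tau>') X
      = cap m \<tau> (take (length z - 1) X) * \<tau>' (rev (drop (length z - 1) X))"
    using assms(5) by (simp add: cap_def pair0_def take_put drop_put sum_distrib_right)
  moreover have "cap m \<tau> (take (length z - 1) X) = 0"
    using assms True by (intro primitive_cap[OF assms(1)]) (auto simp: nth_append)
  ultimately show ?thesis by simp
next
  case False
  let ?j = "length z' - Suc (m - length z)"
  have "cap m (pair0 (length z) \<tau> \<tau>') X
      = \<tau> (take (length z) X) * cap ?j \<tau>' (rev (drop (length z) X))"
    using assms(3,5) False
    by (simp add: cap_def pair0_def take_put drop_put rev_put sum_distrib_left)
      (intro sum.cong refl arg_cong2[of _ _ _ _ "(*)"] arg_cong[of _ _ \<tau>'] arg_cong[of _ _ "\<lambda>m. put m _ _"], linarith)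
  moreover have "cap ?j \<tau>' (rev (drop (length z) X)) = 0"
    using assms False by (intro primitive_cap[OF assms(2)]) (auto simp: nth_append rev_nth)
  ultimately show ?thesis by simp
qed

lemma mrg_pair0:
  assumes "primitive z \<tau>" "primitive z' \<tau>'" "Suc m < length z + length z'" "Suc m \<noteq> length z"
    "Suc (length X) = length z + length z'"
  shows "mrg m (pair0 (length z) \<tau> \<tau>') X = 0"
proof (cases "m < length z")
  case True
  then have "mrg m (pair0 (length z) \<tau> \<tau>') X
      = mrg m \<tau> (take (length z - 1) X) * \<tau>' (rev (drop (length z - 1) X))"
    using assms(4,5) by (simp add: mrg_def pair0_def take_dup drop_dup)
  moreover have "mrg m \<tau> (take (length z - 1) X) = 0"
    using assms True by (intro primitive_mrg[OF assms(1)]) auto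
  ultimately show ?thesis by simp
next
  case False
  let ?j = "length (drop (length z) X) - Suc (m - length z)"
  have "mrg m (pair0 (length z) \<tau> \<tau>') X
      = \<tau> (take (length z) X) * mrg ?j \<tau>' (rev (drop (length z) X))"
    using assms(3,5) False by (simp add: mrg_def pair0_def take_dup drop_dup rev_dup)
  moreover have "mrg ?j \<tau>' (rev (drop (length z) X)) = 0"
    using assms False by (intro primitive_mrg[OF assms(2)]) auto
  ultimately show ?thesis by simp
qed

lemma mrg_pair0_middle:
  "length X = k + k' \<Longrightarrow> mrg k (pair0 (Suc k) \<tau> \<tau>') X = pair1 k \<tau> \<tau>' X" if "0 < k'"
  using that by (simp add: mrg_def pair0_def pair1_def take_dup drop_dup)

lemma cap_pair1:
  assumes "primitive (z @ [s]) \<tau>" "primitive (z' @ [t]) \<tau>'" "m < Suc (length z + length z')"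
    "m \<noteq> length z" "\<not> (z @ r # rev z') ! m" "length X = length z + length z'"
  shows "cap m (pair1 (length z) \<tau> \<tau>') X = 0"
proof (cases "m < length z")
  case True
  then have "cap m (pair1 (length z) \<tau> \<tau>') X
      = cap m \<tau> (take (length z) X) * \<tau>' (rev (drop (length z - 1) X))"
    using assms(6) by (simp add: cap_def pair1_def take_put drop_put sum_distrib_right)
  moreover have "cap m \<tau> (take (length z) X) = 0"
    using assms True by (intro primitive_cap[OF assms(1)]) (auto simp: nth_append)
  ultimately show ?thesis by simp
next
  case False
  let ?j = "length (drop (length z) X) - (m - length z)"
  have "cap m (pair1 (length z) \<tau> \<tau>') X
      = \<tau> (take (Suc (length z)) X) * cap ?j \<tau>' (rev (drop (length z) X))"
    using assms(3,4,6) False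
    by (simp add: cap_def pair1_def take_put drop_put rev_put sum_distrib_left)
  moreover have "cap ?j \<tau>' (rev (drop (length z) X)) = 0"
    using assms False
    by (intro primitive_cap[OF assms(2)]) (auto simp: nth_append rev_nth nth_Cons')
  ultimately show ?thesis by simp
qed

lemma cap_pair1_middle:
  "length X = k + k' \<Longrightarrow> cap k (pair1 k \<tau> \<tau>') X
    = (\<Sum>a\<in>UNIV. pair0 k (\<lambda>x. \<tau> (x @ [a])) (\<lambda>x. \<tau>' (x @ [a])) X)"
  by (simp add: cap_def pair0_def pair1_def put_def)

lemma mrg_pair1:
  assumes "primitive (z @ [s]) \<tau>" "primitive (z' @ [t]) \<tau>'" "m < length z + length z'"
    "length X = length z + length z'"
  shows "mrg m (pair1 (length z) \<tau> \<tau>') X = 0"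
proof (cases "m < length z")
  case True
  then have "mrg m (pair1 (length z) \<tau> \<tau>') X
      = mrg m \<tau> (take (length z) X) * \<tau>' (rev (drop (length z - 1) X))"
    using assms(4) by (simp add: mrg_def pair1_def take_dup drop_dup)
  moreover have "mrg m \<tau> (take (length z) X) = 0"
    using assms True by (intro primitive_mrg[OF assms(1)]) auto
  ultimately show ?thesis by simp
next
  case False
  let ?j = "length (drop (length z) X) - Suc (m - length z)"
  have "mrg m (pair1 (length z) \<tau> \<tau>') X
      = \<tau> (take (Suc (length z)) X) * mrg ?j \<tau>' (rev (drop (length z) X))"
    using assms(3,4) False by (simp add: mrg_def pair1_def take_dup drop_dup rev_dup)
  moreover have "mrg ?j \<tau>' (rev (drop (length z) X)) = 0"
    using assms False by (intro primitive_mrg[OF assms(2)]) auto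
  ultimately show ?thesis by simp
qed

definition pairs0 :: "bool list \<Rightarrow> bool list \<Rightarrow> ('n::finite list \<Rightarrow> real) \<Rightarrow> complex \<Rightarrow> bool" where
  "pairs0 z z' \<eta> c \<longleftrightarrow> (\<forall>\<tau> \<tau>'. primitive z \<tau> \<longrightarrow> primitive z' \<tau>' \<longrightarrow>
     (\<Sum>X\<in>tuples (length z + length z'). pair0 (length z) \<tau> \<tau>' X * of_real (\<eta> X))
       = (if z = z' then c * (\<Sum>x\<in>tuples (length z). \<tau> x * \<tau>' x) else 0))"

definition pairs1 :: "bool list \<Rightarrow> bool \<Rightarrow> bool \<Rightarrow> bool list \<Rightarrow> ('n::finite list \<Rightarrow> real) \<Rightarrow> complex \<Rightarrow> bool" where
  "pairs1 z s t z' \<eta> c \<longleftrightarrow> (\<forall>\<tau> \<tau>'. primitive (z @ [s]) \<tau> \<longrightarrow> primitive (z' @ [t]) \<tau>' \<longrightarrow>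
     (\<Sum>X\<in>tuples (Suc (length z + length z')). pair1 (length z) \<tau> \<tau>' X * of_real (\<eta> X))
       = (if z @ [s] = z' @ [t] then c * (\<Sum>x\<in>tuples (Suc (length z)). \<tau> x * \<tau>' x) else 0))"

lemma of_real_ins: "complex_of_real (ins m \<eta> x) = ins m (\<lambda>x. complex_of_real (\<eta> x)) x"
  and of_real_spl: "complex_of_real (spl m \<eta> x) = spl m (\<lambda>x. complex_of_real (\<eta> x)) x"
  by (simp_all add: ins_def spl_def)

lemma sum_ins:
  "m \<le> n \<Longrightarrow> (\<Sum>X\<in>tuples (Suc n). h X * complex_of_real (ins m \<eta> X))
    = (\<Sum>X\<in>tuples n. cap m h X * complex_of_real (\<eta> X))"
  by (simp only: of_real_ins cap_adjoint)

lemma sum_spl: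
  fixes h :: "'n::finite list \<Rightarrow> complex"
  shows "m < n \<Longrightarrow> (\<Sum>X\<in>tuples (Suc n). h X * complex_of_real (spl m \<eta> X))
    = (\<Sum>X\<in>tuples n. mrg m h X * complex_of_real (\<eta> X))"
  using mrg_adjoint[of m n h "\<lambda>x. complex_of_real (\<eta> x)"] by (simp only: of_real_spl)

lemma pairs0_add:
  assumes "pairs0 z z' \<eta> c" "pairs0 z z' \<zeta> d"
  shows "pairs0 z z' (\<lambda>x. \<eta> x + \<zeta> x) (c + d)"
  using assms unfolding pairs0_def
  by (simp only: of_real_add distrib_left sum.distrib distrib_right) auto

lemma pairs1_add:
  assumes "pairs1 z s t z' \<eta> c" "pairs1 z s t z' \<zeta> d"
  shows "pairs1 z s t z' (\<lambda>x. \<eta> x + \<zeta> x) (c + d)"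
  using assms unfolding pairs1_def
  by (simp only: of_real_add distrib_left sum.distrib distrib_right) auto

lemma sum_scale_of_real:
  "(\<Sum>X\<in>A. h X * complex_of_real (e * f X)) = of_real e * (\<Sum>X\<in>A. h X * complex_of_real (f X))"
  by (simp add: sum_distrib_left mult.left_commute)

lemma pairs0_scale:
  assumes "pairs0 z z' \<eta> c"
  shows "pairs0 z z' (\<lambda>x. e * \<eta> x) (of_real e * c)"
  using assms unfolding pairs0_def by (simp only: sum_scale_of_real) auto

lemma pairs1_scale:
  assumes "pairs1 z s t z' \<eta> c"
  shows "pairs1 z s t z' (\<lambda>x. e * \<eta> x) (of_real e * c)"
  using assms unfolding pairs1_def by (simp only: sum_scale_of_real) auto

lemma put_split: "m < length w \<Longrightarrow> (put m s w)[Suc m := t] = take m w @ s # t # drop (Suc m) w"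
  by (simp add: put_def list_update_append Cons_nth_drop_Suc[symmetric])

text \<open>A move away from the seam turns into an adjoint that kills one of the primitive vectors.
  At the seam, doubling turns \<open>pair0\<close> into \<open>pair1\<close>, and inserting turns
  \<open>pair1\<close> into a sum of terms \<open>pair0\<close> with one coordinate fewer on each
  side; hence the joint induction. A noncrossing vector can therefore only match coordinates from
  the seam outwards, which forces equal words.\<close>

lemma nc_pairs:
  fixes \<eta> :: "'n::finite list \<Rightarrow> real"
  assumes "nc w \<eta>"
  shows "(\<forall>z z'. w = z @ rev z' \<longrightarrow> (\<exists>c. pairs0 z z' \<eta> c))
    \<and> (\<forall>z s t z'. w = z @ (s \<noteq> t) # rev z' \<longrightarrow> (\<exists>c. pairs1 z s t z' \<eta> c))"
  using assms
proof (induction w \<eta> rule: nc.induct)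
  case nc_Nil
  have "pairs0 [] [] (\<lambda>_. 1) 1" by (simp add: pairs0_def pair0_def)
  then show ?case by auto
next
  case (nc_ins w \<eta> m)
  show ?case
  proof (intro conjI allI impI)
    fix z z' assume w: "put m False w = z @ rev z'"
    have len: "length z + length z' = Suc (length w)"
      using arg_cong[OF w, of length] nc_ins.hyps by simp
    have "\<not> (z @ rev z') ! m" using nc_ins.hyps by (simp add: w[symmetric] nth_put)
    \<comment> \<open>An insertion never lies on the seam of \<open>pair0\<close>: the new point
      belongs to one of the two words and its vector is killed by \<open>cap\<close>.\<close>
    then have "pairs0 z z' (ins m \<eta>) 0"
      unfolding pairs0_def len using nc_ins.hyps len
      by (auto simp: sum_ins intro!: sum.neutral cap_pair0)
    then show "\<exists>c. pairs0 z z' (ins m \<eta>) c" ..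
  next
    fix z z' and s t :: bool assume w: "put m False w = z @ (s \<noteq> t) # rev z'"
    have len: "length z + length z' = length w"
      using arg_cong[OF w, of length] nc_ins.hyps by simp
    have nth: "\<not> (z @ (s \<noteq> t) # rev z') ! m"
      unfolding w[symmetric] using nc_ins.hyps by (simp add: nth_put)
    show "\<exists>c. pairs1 z s t z' (ins m \<eta>) c"
    proof (cases "m = length z")
      case True
      \<comment> \<open>The inserted letter is \<open>False\<close> and equals the exclusive or of
        the two end letters. With equal ends, \<open>z = z'\<close> is equivalent to
        \<open>z @ [s] = z' @ [t]\<close>.\<close>
      have "s = t" using nth True by simp
      have "w = del m (put m False w)" using nc_ins.hyps by (simp add: del_put_same)
      then have "w = z @ rev z'" unfolding w by (simp add: True del_def)
      then obtain c where c: "pairs0 z z' \<eta> c" using nc_ins.IH[THEN conjunct1, rule_format] by blast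
      have "pairs1 z s t z' (ins m \<eta>) c"
        unfolding pairs1_def len
      proof (intro allI impI)
        fix \<tau> \<tau>' :: "'n list \<Rightarrow> complex"
        assume prim: "primitive (z @ [s]) \<tau>" "primitive (z' @ [t]) \<tau>'"
        have "(\<Sum>X\<in>tuples (Suc (length w)). pair1 (length z) \<tau> \<tau>' X * complex_of_real (ins m \<eta> X))
            = (\<Sum>X\<in>tuples (length w). cap m (pair1 (length z) \<tau> \<tau>') X * complex_of_real (\<eta> X))"
          by (rule sum_ins[OF nc_ins.hyps(2)])
        also have "\<dots> = (\<Sum>X\<in>tuples (length w). \<Sum>a\<in>UNIV.
            pair0 (length z) (\<lambda>x. \<tau> (x @ [a])) (\<lambda>x. \<tau>' (x @ [a])) X * complex_of_real (\<eta> X))"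
          using len True
          by (intro sum.cong refl) (simp add: sum_distrib_right cap_pair1_middle[of _ "length z" "length z'"])
        also have "\<dots> = (\<Sum>a\<in>UNIV. \<Sum>X\<in>tuples (length z + length z').
            pair0 (length z) (\<lambda>x. \<tau> (x @ [a])) (\<lambda>x. \<tau>' (x @ [a])) X * complex_of_real (\<eta> X))"
          unfolding len by (rule sum.swap)
        also have "\<dots> = (\<Sum>a\<in>UNIV. if z = z' then c * (\<Sum>x\<in>tuples (length z). \<tau> (x @ [a]) * \<tau>' (x @ [a])) else 0)"
          using c primitive_snoc[OF prim(1)] primitive_snoc[OF prim(2)]
          by (intro sum.cong refl) (simp add: pairs0_def)
        also have "\<dots> = (if z @ [s] = z' @ [t] then c * (\<Sum>x\<in>tuples (Suc (length z)). \<tau> x * \<tau>' x) else 0)"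
          using \<open>s = t\<close> unfolding sum_tuples_snoc
          by (subst sum.swap) (simp add: sum_distrib_left)
        finally show "(\<Sum>X\<in>tuples (Suc (length w)). pair1 (length z) \<tau> \<tau>' X * complex_of_real (ins m \<eta> X))
            = (if z @ [s] = z' @ [t] then c * (\<Sum>x\<in>tuples (Suc (length z)). \<tau> x * \<tau>' x) else 0)" .
      qed
      then show ?thesis ..
    next
      case False
      have "pairs1 z s t z' (ins m \<eta>) 0"
        unfolding pairs1_def len using nc_ins.hyps len False nth
        by (auto simp: sum_ins intro!: sum.neutral cap_pair1)
      then show ?thesis ..
    qed
  qed
next
  case (nc_spl w \<eta> m s t)
  show ?case
  proof (intro conjI allI impI)
    fix z z' assume w: "(put m s w)[Suc m := t] = z @ rev z'"
    have len: "length z + length z' = Suc (length w)"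
      using arg_cong[OF w, of length] nc_spl.hyps by simp
    show "\<exists>c. pairs0 z z' (spl m \<eta>) c"
    proof (cases "Suc m = length z")
      case True
      have eq: "(take m w @ [s]) @ t # drop (Suc m) w = z @ rev z'"
        using w nc_spl.hyps by (simp add: put_split)
      have "length (take m w @ [s]) = length z" using True nc_spl.hyps by simp
      then have "take m w @ [s] = z \<and> t # drop (Suc m) w = rev z'"
        by (rule iffD1[OF append_eq_append_conv[OF disjI1] eq])
      then have zz: "z = take m w @ [s]" "rev z' = t # drop (Suc m) w" by (simp_all only:)
      define z0 z0' where "z0 = take m w" and "z0' = rev (drop (Suc m) w)"
      have z: "z = z0 @ [s]" "z' = z0' @ [t]"
        using zz arg_cong[OF zz(2), of rev] by (simp_all add: z0_def z0'_def)
      have "w = z0 @ (s \<noteq> t) # rev z0'"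
        using id_take_nth_drop[OF nc_spl.hyps(2)] unfolding nc_spl.hyps(3) by (simp add: z0_def z0'_def)
      then obtain c where c: "pairs1 z0 s t z0' \<eta> c" using nc_spl.IH[THEN conjunct2, rule_format] by blast
      have m: "m = length z0" using True by (simp add: z)
      have "pairs0 z z' (spl m \<eta>) c"
        unfolding pairs0_def len
      proof (intro allI impI)
        fix \<tau> \<tau>' :: "'n list \<Rightarrow> complex"
        assume prim: "primitive z \<tau>" "primitive z' \<tau>'"
        have "(\<Sum>X\<in>tuples (Suc (length w)). pair0 (length z) \<tau> \<tau>' X * complex_of_real (spl m \<eta> X))
            = (\<Sum>X\<in>tuples (length w). mrg m (pair0 (length z) \<tau> \<tau>') X * complex_of_real (\<eta> X))"
          by (rule sum_spl[OF nc_spl.hyps(2)])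
        also have "\<dots> = (\<Sum>X\<in>tuples (Suc (length z0 + length z0')). pair1 (length z0) \<tau> \<tau>' X * complex_of_real (\<eta> X))"
          using mrg_pair0_middle[of "Suc (length z0')" _ m \<tau> \<tau>'] len m
          by (intro sum.cong) (auto simp: z)
        also have "\<dots> = (if z = z' then c * (\<Sum>x\<in>tuples (length z). \<tau> x * \<tau>' x) else 0)"
          using c prim by (simp add: pairs1_def z)
        finally show "(\<Sum>X\<in>tuples (Suc (length w)). pair0 (length z) \<tau> \<tau>' X * complex_of_real (spl m \<eta> X))
            = (if z = z' then c * (\<Sum>x\<in>tuples (length z). \<tau> x * \<tau>' x) else 0)" .
      qed
      then show ?thesis ..
    next
      case False
      have "pairs0 z z' (spl m \<eta>) 0"
        unfolding pairs0_def len using nc_spl.hyps len False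
        by (auto simp: sum_spl intro!: sum.neutral mrg_pair0)
      then show ?thesis ..
    qed
  next
    fix z z' and s' t' :: bool assume w: "(put m s w)[Suc m := t] = z @ (s' \<noteq> t') # rev z'"
    have len: "length z + length z' = length w"
      using arg_cong[OF w, of length] nc_spl.hyps by simp
    \<comment> \<open>The shared coordinate belongs to both vectors, so any two neighbours lie
      within one of them and \<open>mrg\<close> kills it.\<close>
    have "pairs1 z s' t' z' (spl m \<eta>) 0"
      unfolding pairs1_def len using nc_spl.hyps len
      by (auto simp: sum_spl intro!: sum.neutral mrg_pair1)
    then show "\<exists>c. pairs1 z s' t' z' (spl m \<eta>) c" ..
  qed
next
  case (nc_zero w)
  have "pairs0 z z' (\<lambda>_. 0 :: real) 0" "pairs1 z s t z' (\<lambda>_. 0 :: real) 0"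
    for z z' s t by (simp_all add: pairs0_def pairs1_def)
  then show ?case by blast
next
  case (nc_add w \<eta> \<zeta>)
  show ?case
  proof (intro conjI allI impI)
    fix z z' assume w: "w = z @ rev z'"
    obtain c where "pairs0 z z' \<eta> c" using nc_add.IH(1)[THEN conjunct1, rule_format, OF w] by blast
    moreover obtain d where "pairs0 z z' \<zeta> d" using nc_add.IH(2)[THEN conjunct1, rule_format, OF w] by blast
    ultimately have "pairs0 z z' (\<lambda>x. \<eta> x + \<zeta> x) (c + d)" by (rule pairs0_add)
    then show "\<exists>c. pairs0 z z' (\<lambda>x. \<eta> x + \<zeta> x) c" ..
  next
    fix z z' and s t :: bool assume w: "w = z @ (s \<noteq> t) # rev z'"
    obtain c where "pairs1 z s t z' \<eta> c" using nc_add.IH(1)[THEN conjunct2, rule_format, OF w] by blast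
    moreover obtain d where "pairs1 z s t z' \<zeta> d" using nc_add.IH(2)[THEN conjunct2, rule_format, OF w] by blast
    ultimately have "pairs1 z s t z' (\<lambda>x. \<eta> x + \<zeta> x) (c + d)" by (rule pairs1_add)
    then show "\<exists>c. pairs1 z s t z' (\<lambda>x. \<eta> x + \<zeta> x) c" ..
  qed
next
  case (nc_scale w \<eta> e)
  show ?case
  proof (intro conjI allI impI)
    fix z z' assume w: "w = z @ rev z'"
    obtain c where "pairs0 z z' \<eta> c" using nc_scale.IH[THEN conjunct1, rule_format, OF w] by blast
    then have "pairs0 z z' (\<lambda>x. e * \<eta> x) (of_real e * c)" by (rule pairs0_scale)
    then show "\<exists>c. pairs0 z z' (\<lambda>x. e * \<eta> x) c" ..
  next
    fix z z' and s t :: bool assume w: "w = z @ (s \<noteq> t) # rev z'"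
    obtain c where "pairs1 z s t z' \<eta> c" using nc_scale.IH[THEN conjunct2, rule_format, OF w] by blast
    then have "pairs1 z s t z' (\<lambda>x. e * \<eta> x) (of_real e * c)" by (rule pairs1_scale)
    then show "\<exists>c. pairs1 z s t z' (\<lambda>x. e * \<eta> x) c" ..
  qed
next
  case (nc_cong w \<eta> \<zeta>)
  show ?case
  proof (intro conjI allI impI)
    fix z z' assume w: "w = z @ rev z'"
    obtain c where "pairs0 z z' \<eta> c" using nc_cong.IH[THEN conjunct1, rule_format, OF w] by blast
    then have "pairs0 z z' \<zeta> c" using nc_cong.hyps(2) w by (simp add: pairs0_def)
    then show "\<exists>c. pairs0 z z' \<zeta> c" ..
  next
    fix z z' and s t :: bool assume w: "w = z @ (s \<noteq> t) # rev z'"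
    obtain c where "pairs1 z s t z' \<eta> c" using nc_cong.IH[THEN conjunct2, rule_format, OF w] by blast
    then have "pairs1 z s t z' \<zeta> c" using nc_cong.hyps(2) w by (simp add: pairs1_def)
    then show "\<exists>c. pairs1 z s t z' \<zeta> c" ..
  qed
qed

section \<open>Functionals commuting with the regular representation\<close>

text \<open>Left and right convolution with \<open>\<theta>\<close> agree. On words this says that
  the matrix of values of \<open>\<theta>\<close> commutes with the tensor product
  representation.\<close>

definition convolution_central :: "('n::finite pol_hyp \<Rightarrow> complex) \<Rightarrow> bool" where
  "convolution_central \<theta> \<longleftrightarrow> clinear \<theta> \<and> (\<forall>x. slice_left \<theta> (comult x) = slice_right \<theta> (comult x))"

lemma convolution_central_word:
  assumes "convolution_central \<theta>" "length x = length z" "length y = length z"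
  shows "(\<Sum>a\<in>tuples (length z). \<theta> (word z x a) *\<^sub>C word z a y)
    = (\<Sum>a\<in>tuples (length z). \<theta> (word z a y) *\<^sub>C word z x a)"
proof -
  have lin: "clinear \<theta>" and eq: "slice_left \<theta> (comult (word z x y)) = slice_right \<theta> (comult (word z x y))"
    using assms(1) by (simp_all add: convolution_central_def)
  from eq show ?thesis
    by (simp add: comult_word assms(2,3) clinear_sum[OF slice_left(1)[OF lin]]
        clinear_sum[OF slice_right(1)[OF lin]] slice_left(2)[OF lin] slice_right(2)[OF lin])
qed

text \<open>The merging rule at an arbitrary position, in the form in which it meets
  \<open>mrg\<close>.\<close>

lemma word_dup_row:
  assumes "Suc m < length z" "Suc (length x) = length z" "length y = length z"
  shows "word z (dup m x) y
    = (if y ! m = y ! Suc m then word ((del m z)[m := (z ! m \<noteq> z ! Suc m)]) x (del m y) else 0)"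
proof -
  have z: "z = take m z @ z ! m # z ! Suc m # drop (Suc (Suc m)) z"
    and y: "y = take m y @ y ! m # y ! Suc m # drop (Suc (Suc m)) y"
    using assms by (simp_all add: Cons_nth_drop_Suc)
  have x: "x = take m x @ x ! m # drop (Suc m) x"
    using assms by (simp add: Cons_nth_drop_Suc)
  have d: "dup m x = take m x @ x ! m # x ! m # drop (Suc m) x"
    using assms by (simp add: dup_def take_Suc_conv_app_nth Cons_nth_drop_Suc)
  have dy: "del m y = take m y @ y ! Suc m # drop (Suc (Suc m)) y"
    using assms by (simp add: del_def Cons_nth_drop_Suc)
  have dz: "(del m z)[m := w] = take m z @ w # drop (Suc (Suc m)) z" for w
    using assms by (simp add: del_def list_update_append Cons_nth_drop_Suc[symmetric])
  have "word z (dup m x) y = word (take m z @ z ! m # z ! Suc m # drop (Suc (Suc m)) z)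
      (take m x @ x ! m # x ! m # drop (Suc m) x) (take m y @ y ! m # y ! Suc m # drop (Suc (Suc m)) y)"
    using z y d by simp
  also have "\<dots> = (if y ! m = y ! Suc m then word (take m z @ (z ! m \<noteq> z ! Suc m) # drop (Suc (Suc m)) z)
      (take m x @ x ! m # drop (Suc m) x) (take m y @ y ! m # drop (Suc (Suc m)) y) else 0)"
    using assms by (intro word_merge_row) auto
  also have "\<dots> = (if y ! m = y ! Suc m then word ((del m z)[m := (z ! m \<noteq> z ! Suc m)]) x (del m y) else 0)"
    unfolding dz dy using x by simp
  finally show ?thesis .
qed

lemma word_dup_col:
  assumes "Suc m < length z" "length x = length z" "Suc (length y) = length z"
  shows "word z x (dup m y)
    = (if x ! m = x ! Suc m then word ((del m z)[m := (z ! m \<noteq> z ! Suc m)]) (del m x) y else 0)"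
proof -
  have z: "z = take m z @ z ! m # z ! Suc m # drop (Suc (Suc m)) z"
    and x: "x = take m x @ x ! m # x ! Suc m # drop (Suc (Suc m)) x"
    using assms by (simp_all add: Cons_nth_drop_Suc)
  have y: "y = take m y @ y ! m # drop (Suc m) y"
    using assms by (simp add: Cons_nth_drop_Suc)
  have d: "dup m y = take m y @ y ! m # y ! m # drop (Suc m) y"
    using assms by (simp add: dup_def take_Suc_conv_app_nth Cons_nth_drop_Suc)
  have dx: "del m x = take m x @ x ! Suc m # drop (Suc (Suc m)) x"
    using assms by (simp add: del_def Cons_nth_drop_Suc)
  have dz: "(del m z)[m := w] = take m z @ w # drop (Suc (Suc m)) z" for w
    using assms by (simp add: del_def list_update_append Cons_nth_drop_Suc[symmetric])
  have "word z x (dup m y) = word (take m z @ z ! m # z ! Suc m # drop (Suc (Suc m)) z)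
      (take m x @ x ! m # x ! Suc m # drop (Suc (Suc m)) x) (take m y @ y ! m # y ! m # drop (Suc m) y)"
    using z x d by simp
  also have "\<dots> = (if x ! m = x ! Suc m then word (take m z @ (z ! m \<noteq> z ! Suc m) # drop (Suc (Suc m)) z)
      (take m x @ x ! m # drop (Suc (Suc m)) x) (take m y @ y ! m # drop (Suc m) y) else 0)"
    using assms by (intro word_merge_col) auto
  also have "\<dots> = (if x ! m = x ! Suc m then word ((del m z)[m := (z ! m \<noteq> z ! Suc m)]) (del m x) y else 0)"
    unfolding dz dx using y by simp
  finally show ?thesis .
qed

lemma sum_word_put:
  assumes "m < length z" "\<not> z ! m" "Suc (length x) = length z" "length y = length z"
  shows "(\<Sum>a\<in>UNIV. word z (put m a x) y) = word (del m z) x (del m y)"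
    and "(\<Sum>a\<in>UNIV. word z y (put m a x)) = word (del m z) (del m y) x"
proof -
  have z: "z = take m z @ False # drop (Suc m) z"
    and y: "y = take m y @ y ! m # drop (Suc m) y"
    using assms id_take_nth_drop[of m z] id_take_nth_drop[of m y] by simp_all
  have len: "length (take m x) = length (take m z)" "length (take m y) = length (take m z)"
    using assms by auto
  have w: "word (take m z @ t # z') (take m x @ a # x') (take m y @ b # y')
      = word (take m z) (take m x) (take m y) * (letter t a b * word z' x' y')"
    "word (take m z @ t # z') (take m y @ b # y') (take m x @ a # x')
      = word (take m z) (take m y) (take m x) * (letter t b a * word z' y' x')"
    "word (take m z @ z') (take m x @ x') (take m y @ y') = word (take m z) (take m x) (take m y) * word z' x' y'"
    "word (take m z @ z') (take m y @ y') (take m x @ x') = word (take m z) (take m y) (take m x) * word z' y' x'"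
    for t a b z' x' y' using len by (simp_all add: word_append)
  have "(\<Sum>a\<in>UNIV. word z (put m a x) y)
      = word (take m z) (take m x) (take m y) * ((\<Sum>a\<in>UNIV. letter False a (y ! m)) * word (drop (Suc m) z) (drop m x) (drop (Suc m) y))"
    by (subst z, subst y) (simp only: put_def w word.simps sum_distrib_left sum_distrib_right)
  then show "(\<Sum>a\<in>UNIV. word z (put m a x) y) = word (del m z) x (del m y)"
    using w(3)[of "drop (Suc m) z" "drop m x" "drop (Suc m) y"] by (simp add: letter_sum_col del_def)
  have "(\<Sum>a\<in>UNIV. word z y (put m a x))
      = word (take m z) (take m y) (take m x) * ((\<Sum>a\<in>UNIV. letter False (y ! m) a) * word (drop (Suc m) z) (drop (Suc m) y) (drop m x))"
    by (subst z, subst y) (simp only: put_def w word.simps sum_distrib_left sum_distrib_right)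
  then show "(\<Sum>a\<in>UNIV. word z y (put m a x)) = word (del m z) (del m y) x"
    using w(4)[of "drop (Suc m) z" "drop (Suc m) y" "drop m x"] by (simp add: letter_sum_row del_def)
qed

text \<open>Merging rows leaves only columns on a diagonal, where a primitive vector vanishes.
  Summing out a row index leaves a function of \<open>del m y\<close>, to which a primitive vector
  is orthogonal. The matrix and its transpose are both treated because left and right eigenvectors
  are compared later.\<close>

lemma primitive_action:
  assumes lin: "clinear \<theta>" and prim: "primitive z \<tau>"
  shows "primitive z (\<lambda>x. \<Sum>y\<in>tuples (length z). \<tau> y * \<theta> (word z x y))"
    and "primitive z (\<lambda>y. \<Sum>x\<in>tuples (length z). \<tau> x * \<theta> (word z x y))"
proof -
  have zero: "\<theta> 0 = 0" using clinear_zero[OF lin] .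
  have dup0: "\<tau> w = 0" if "Suc m < length z" "length w = length z" "w ! m = w ! Suc m" for w m
    using primitive_mrg[OF prim that(1), of "del m w"] that by (simp add: mrg_def dup_del)
  have cap0: "(\<Sum>w\<in>tuples (length z). \<tau> w * g (del m w)) = 0" if m: "m < length z" "\<not> z ! m" for m g
  proof -
    obtain n where n: "length z = Suc n" using m(1) by (cases "length z") auto
    have "(\<Sum>w\<in>tuples (Suc n). \<tau> w * ins m g w) = (\<Sum>w\<in>tuples n. cap m \<tau> w * g w)"
      using m(1) n by (intro cap_adjoint[symmetric]) simp
    also have "\<dots> = 0"
      using primitive_cap[OF prim m] n by (intro sum.neutral) auto
    finally show ?thesis by (simp add: ins_def n)
  qed
  show "primitive z (\<lambda>x. \<Sum>y\<in>tuples (length z). \<tau> y * \<theta> (word z x y))"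
    unfolding primitive_def
  proof (intro conjI allI impI)
    fix m and x :: "'a list" assume m: "Suc m < length z" "Suc (length x) = length z"
    show "mrg m (\<lambda>x. \<Sum>y\<in>tuples (length z). \<tau> y * \<theta> (word z x y)) x = 0"
      unfolding mrg_def
      by (intro sum.neutral ballI) (use m in \<open>auto simp: word_dup_row zero dup0\<close>)
  next
    fix m and x :: "'a list" assume m: "m < length z" "\<not> z ! m" "Suc (length x) = length z"
    have "cap m (\<lambda>x. \<Sum>y\<in>tuples (length z). \<tau> y * \<theta> (word z x y)) x
        = (\<Sum>y\<in>tuples (length z). \<tau> y * \<theta> (\<Sum>a\<in>UNIV. word z (put m a x) y))"
      unfolding cap_def by (subst sum.swap) (simp add: clinear_sum[OF lin] sum_distrib_left)
    also have "\<dots> = (\<Sum>y\<in>tuples (length z). \<tau> y * \<theta> (word (del m z) x (del m y)))"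
      by (intro sum.cong refl) (use m in \<open>simp add: sum_word_put(1)\<close>)
    also have "\<dots> = 0" using cap0[OF m(1,2), of "\<lambda>y. \<theta> (word (del m z) x y)"] .
    finally show "cap m (\<lambda>x. \<Sum>y\<in>tuples (length z). \<tau> y * \<theta> (word z x y)) x = 0" .
  qed
  show "primitive z (\<lambda>y. \<Sum>x\<in>tuples (length z). \<tau> x * \<theta> (word z x y))"
    unfolding primitive_def
  proof (intro conjI allI impI)
    fix m and x :: "'a list" assume m: "Suc m < length z" "Suc (length x) = length z"
    show "mrg m (\<lambda>y. \<Sum>x\<in>tuples (length z). \<tau> x * \<theta> (word z x y)) x = 0"
      unfolding mrg_def
      by (intro sum.neutral ballI) (use m in \<open>auto simp: word_dup_col zero dup0\<close>)
  next
    fix m and x :: "'a list" assume m: "m < length z" "\<not> z ! m" "Suc (length x) = length z"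
    have "cap m (\<lambda>y. \<Sum>x\<in>tuples (length z). \<tau> x * \<theta> (word z x y)) x
        = (\<Sum>y\<in>tuples (length z). \<tau> y * \<theta> (\<Sum>a\<in>UNIV. word z y (put m a x)))"
      unfolding cap_def by (subst sum.swap) (simp add: clinear_sum[OF lin] sum_distrib_left)
    also have "\<dots> = (\<Sum>y\<in>tuples (length z). \<tau> y * \<theta> (word (del m z) (del m y) x))"
      by (intro sum.cong refl) (use m in \<open>simp add: sum_word_put(2)\<close>)
    also have "\<dots> = 0" using cap0[OF m(1,2), of "\<lambda>y. \<theta> (word (del m z) y x)"] .
    finally show "cap m (\<lambda>y. \<Sum>x\<in>tuples (length z). \<tau> x * \<theta> (word z x y)) x = 0" .
  qed
qed

text \<open>Frobenius reciprocity: an intertwiner of \<open>z\<close> is a fixed vector of \<open>z\<close> followed by its reversal.\<close>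
lemma convolution_central_fixed:
  fixes \<theta> :: "'n::finite pol_hyp \<Rightarrow> complex"
  assumes \<theta>: "convolution_central \<theta>" and X: "length X = length (z @ rev z)"
  defines "\<eta> \<equiv> \<lambda>X. \<theta> (word z (take (length z) X) (rev (drop (length z) X)))"
  shows "(\<Sum>Y\<in>tuples (length (z @ rev z)). \<eta> Y *\<^sub>C word (z @ rev z) X Y) = \<eta> X *\<^sub>C 1"
proof -
  define k where "k = length z"
  define x y where "x = take k X" and "y = rev (drop k X)"
  have xy: "X = x @ rev y" "length x = k" "length y = k"
    using X by (simp_all add: x_def y_def k_def)
  have "(\<Sum>Y\<in>tuples (length (z @ rev z)). \<eta> Y *\<^sub>C word (z @ rev z) X Y)
      = (\<Sum>b\<in>tuples k. \<Sum>c\<in>tuples k. \<theta> (word z b (rev c)) *\<^sub>C (word z x b * word (rev z) (rev y) c))"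
    unfolding length_append length_rev k_def[symmetric] sum_tuples_add
    by (intro sum.cong refl) (use xy in \<open>simp add: \<eta>_def k_def word_append\<close>)
  also have "\<dots> = (\<Sum>b\<in>tuples k. \<Sum>c\<in>tuples k. \<theta> (word z b c) *\<^sub>C (word z x b * word (rev z) (rev y) (rev c)))"
    by (rule sum.cong[OF refl], subst sum_tuples_rev[symmetric]) simp
  also have "\<dots> = (\<Sum>c\<in>tuples k. (\<Sum>b\<in>tuples k. \<theta> (word z b c) *\<^sub>C word z x b) * word (rev z) (rev y) (rev c))"
    by (subst sum.swap) (simp add: sum_distrib_right mult_scaleC_left)
  \<comment> \<open>The intertwining relation moves \<open>\<theta>\<close> onto the row side, after
    which unitarity collapses the sum over \<open>c\<close>.\<close>
  also have "\<dots> = (\<Sum>c\<in>tuples k. (\<Sum>a\<in>tuples k. \<theta> (word z x a) *\<^sub>C word z a c) * word (rev z) (rev y) (rev c))"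
    using convolution_central_word[OF \<theta>, of x z] xy
    by (intro sum.cong refl) (simp add: k_def)
  also have "\<dots> = (\<Sum>a\<in>tuples k. \<theta> (word z x a) *\<^sub>C (\<Sum>c\<in>tuples k. word z a c * word (rev z) (rev y) (rev c)))"
    by (simp add: sum_distrib_right mult_scaleC_left scaleC_sum_right) (rule sum.swap)
  also have "\<dots> = (\<Sum>a\<in>tuples k. if a = y then \<theta> (word z x a) *\<^sub>C 1 else 0)"
    using xy by (intro sum.cong refl) (simp add: k_def word_cancel)
  also have "\<dots> = \<eta> X *\<^sub>C 1"
    using xy by (subst sum_tuples_delta) (simp_all add: \<eta>_def k_def)
  finally show ?thesis .
qed

section \<open>Scalar action on primitive vectors\<close>

definition acts_as_scalar :: "('n::finite pol_hyp \<Rightarrow> complex) \<Rightarrow> bool list \<Rightarrow> complex \<Rightarrow> bool" where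
  "acts_as_scalar \<theta> z c \<longleftrightarrow> (\<forall>\<tau>. primitive z \<tau> \<longrightarrow>
     (\<forall>x. length x = length z \<longrightarrow> (\<Sum>y\<in>tuples (length z). \<tau> y * \<theta> (word z x y)) = c * \<tau> x)
   \<and> (\<forall>y. length y = length z \<longrightarrow> (\<Sum>x\<in>tuples (length z). \<tau> x * \<theta> (word z x y)) = c * \<tau> y))"

text \<open>Read as a vector on \<open>z @ rev z\<close>, the matrix of \<open>\<theta>\<close> is a
  combination of columns of the noncrossing projection, and column \<open>Y\<close> pairs primitive
  vectors through a constant \<open>d Y\<close>. So the matrix has the bilinear form of a scalar on
  the primitive vectors, a space that it preserves and on which the pairing is
  nondegenerate.\<close>

lemma convolution_central_scalar:
  fixes \<theta> :: "'n::finite pol_hyp \<Rightarrow> complex"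
  assumes \<theta>: "convolution_central \<theta>"
  shows "\<exists>c. acts_as_scalar \<theta> z c"
proof -
  let ?L = "length z"
  let ?Z = "z @ rev z"
  have lin: "clinear \<theta>" using \<theta> by (simp add: convolution_central_def)
  define \<eta> where "\<eta> = (\<lambda>X. \<theta> (word z (take ?L X) (rev (drop ?L X))))"
  have \<eta>: "\<eta> X = (\<Sum>Y\<in>tuples (length ?Z). \<eta> Y * of_real (nc_ker ?Z X Y))" if "length X = length ?Z" for X
    using convolution_central_fixed[OF \<theta>, of _ z] that
    by (intro fixed_vector_nc) (simp_all add: \<eta>_def)
  have "\<exists>d. pairs0 z z (\<lambda>X. nc_ker ?Z X Y) d" for Y :: "'n list"
    using nc_pairs[OF nc_nc_ker] by blast
  then obtain d where d: "\<And>Y :: 'n list. pairs0 z z (\<lambda>X. nc_ker ?Z X Y) (d Y)" by metis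
  define c where "c = (\<Sum>Y\<in>tuples (length ?Z). \<eta> Y * d Y)"
  have pair: "(\<Sum>x\<in>tuples ?L. \<Sum>y\<in>tuples ?L. \<tau> x * \<tau>' y * \<theta> (word z x y)) = c * (\<Sum>x\<in>tuples ?L. \<tau> x * \<tau>' x)"
    if prim: "primitive z \<tau>" "primitive z \<tau>'" for \<tau> \<tau>'
  proof -
    have "(\<Sum>x\<in>tuples ?L. \<Sum>y\<in>tuples ?L. \<tau> x * \<tau>' y * \<theta> (word z x y))
        = (\<Sum>x\<in>tuples ?L. \<Sum>y\<in>tuples ?L. \<tau> x * \<tau>' (rev y) * \<theta> (word z x (rev y)))"
      by (rule sum.cong[OF refl], subst sum_tuples_rev[symmetric]) simp
    also have "\<dots> = (\<Sum>X\<in>tuples (?L + ?L). pair0 ?L \<tau> \<tau>' X * \<eta> X)"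
      unfolding sum_tuples_add by (intro sum.cong refl) (simp add: pair0_def \<eta>_def)
    also have "\<dots> = (\<Sum>X\<in>tuples (?L + ?L). \<Sum>Y\<in>tuples (?L + ?L). pair0 ?L \<tau> \<tau>' X * (\<eta> Y * of_real (nc_ker ?Z X Y)))"
      using \<eta> by (intro sum.cong refl) (simp add: sum_distrib_left)
    also have "\<dots> = (\<Sum>Y\<in>tuples (?L + ?L). \<eta> Y * (\<Sum>X\<in>tuples (?L + ?L). pair0 ?L \<tau> \<tau>' X * of_real (nc_ker ?Z X Y)))"
      by (subst sum.swap) (simp add: sum_distrib_left mult.left_commute)
    also have "\<dots> = (\<Sum>Y\<in>tuples (?L + ?L). \<eta> Y * (d Y * (\<Sum>x\<in>tuples ?L. \<tau> x * \<tau>' x)))"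
      using d prim by (intro sum.cong refl) (simp add: pairs0_def)
    also have "\<dots> = c * (\<Sum>x\<in>tuples ?L. \<tau> x * \<tau>' x)"
      by (simp add: c_def sum_distrib_right mult.assoc)
    finally show ?thesis .
  qed
  have "acts_as_scalar \<theta> z c"
    unfolding acts_as_scalar_def
  proof (intro allI impI conjI)
    fix \<tau> :: "'n list \<Rightarrow> complex" and x :: "'n list" assume \<tau>: "primitive z \<tau>" and x: "length x = ?L"
    have "(\<Sum>y\<in>tuples ?L. \<tau> y * \<theta> (word z x y)) - c * \<tau> x = 0"
    proof (rule primitive_orthogonal_zero[OF _ _ x])
      show "primitive z (\<lambda>x. (\<Sum>y\<in>tuples ?L. \<tau> y * \<theta> (word z x y)) - c * \<tau> x)"
        by (intro primitive_diff_scale primitive_action lin \<tau>)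
      show "(\<Sum>x\<in>tuples ?L. g x * ((\<Sum>y\<in>tuples ?L. \<tau> y * \<theta> (word z x y)) - c * \<tau> x)) = 0"
        if g: "primitive z g" for g
        using pair[OF g \<tau>]
        by (simp add: right_diff_distrib sum_subtractf sum_distrib_left mult.assoc mult.left_commute[of _ c])
    qed
    then show "(\<Sum>y\<in>tuples ?L. \<tau> y * \<theta> (word z x y)) = c * \<tau> x" by simp
  next
    fix \<tau> :: "'n list \<Rightarrow> complex" and y :: "'n list" assume \<tau>: "primitive z \<tau>" and y: "length y = ?L"
    have "(\<Sum>x\<in>tuples ?L. \<tau> x * \<theta> (word z x y)) - c * \<tau> y = 0"
    proof (rule primitive_orthogonal_zero[OF _ _ y])
      show "primitive z (\<lambda>y. (\<Sum>x\<in>tuples ?L. \<tau> x * \<theta> (word z x y)) - c * \<tau> y)"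
        by (intro primitive_diff_scale primitive_action lin \<tau>)
      show "(\<Sum>y\<in>tuples ?L. g y * ((\<Sum>x\<in>tuples ?L. \<tau> x * \<theta> (word z x y)) - c * \<tau> y)) = 0"
        if g: "primitive z g" for g
      proof -
        have "(\<Sum>y\<in>tuples ?L. g y * (\<Sum>x\<in>tuples ?L. \<tau> x * \<theta> (word z x y)))
            = (\<Sum>x\<in>tuples ?L. \<Sum>y\<in>tuples ?L. \<tau> x * g y * \<theta> (word z x y))"
          by (simp add: sum_distrib_left mult.assoc mult.left_commute) (rule sum.swap)
        then show ?thesis
          using pair[OF \<tau> g]
          by (simp add: right_diff_distrib sum_subtractf sum_distrib_left mult.assoc mult.commute mult.left_commute)
      qed
    qed
    then show "(\<Sum>x\<in>tuples ?L. \<tau> x * \<theta> (word z x y)) = c * \<tau> y" by simp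
  qed
  then show ?thesis ..
qed

text \<open>Induction on the length: once shorter words are killed, each row of values is itself
  primitive, and the hypothesis makes it orthogonal to all primitive vectors.\<close>

lemma vanishes_if_vanishes_on_primitive:
  fixes \<delta> :: "'n::finite pol_hyp \<Rightarrow> complex"
  assumes lin: "clinear \<delta>"
    and van: "\<And>z \<tau> x. primitive z \<tau> \<Longrightarrow> length x = length z
      \<Longrightarrow> (\<Sum>y\<in>tuples (length z). \<tau> y * \<delta> (word z x y)) = 0"
  shows "length x = length z \<Longrightarrow> length y = length z \<Longrightarrow> \<delta> (word z x y) = 0"
proof (induction "length z" arbitrary: z x y rule: less_induct)
  case less
  have "primitive z (\<lambda>y. \<delta> (word z x y))"
    unfolding primitive_def
  proof (intro conjI allI impI)
    fix m and y :: "'n list" assume m: "Suc m < length z" "Suc (length y) = length z"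
    show "mrg m (\<lambda>y. \<delta> (word z x y)) y = 0"
      using m less.prems by (auto simp: mrg_def word_dup_col clinear_zero[OF lin] intro!: less.hyps)
  next
    fix m and y :: "'n list" assume m: "m < length z" "\<not> z ! m" "Suc (length y) = length z"
    have "cap m (\<lambda>y. \<delta> (word z x y)) y = \<delta> (\<Sum>a\<in>UNIV. word z x (put m a y))"
      by (simp add: cap_def clinear_sum[OF lin])
    also have "\<dots> = 0"
      using m less.prems by (simp add: sum_word_put(2)) (intro less.hyps, auto)
    finally show "cap m (\<lambda>y. \<delta> (word z x y)) y = 0" .
  qed
  then show ?case
    by (rule primitive_orthogonal_zero) (use van less.prems in auto)
qed

section \<open>The scalars of a tracial functional\<close>

text \<open>The scalar is determined as soon as a nonzero primitive vector exists; the product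
  vectors below provide one for every word.\<close>

definition scal :: "('n::finite pol_hyp \<Rightarrow> complex) \<Rightarrow> bool list \<Rightarrow> complex" where
  "scal \<theta> z = (SOME c. acts_as_scalar \<theta> z c)"

lemma scal:
  assumes "convolution_central \<theta>"
  shows "primitive z \<tau> \<Longrightarrow> length x = length z
      \<Longrightarrow> (\<Sum>y\<in>tuples (length z). \<tau> y * \<theta> (word z x y)) = scal \<theta> z * \<tau> x"
    and "primitive z \<tau> \<Longrightarrow> length y = length z
      \<Longrightarrow> (\<Sum>x\<in>tuples (length z). \<tau> x * \<theta> (word z x y)) = scal \<theta> z * \<tau> y"
  using someI_ex[OF convolution_central_scalar[OF assms], of z, folded scal_def]
  by (simp_all add: acts_as_scalar_def)

section \<open>Product vectors as explicit primitive vectors\<close>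

fun prod_vec :: "('n \<Rightarrow> complex) list \<Rightarrow> 'n list \<Rightarrow> complex" where
  "prod_vec [] [] = 1"
| "prod_vec (f # fs) (a # x) = f a * prod_vec fs x"
| "prod_vec _ _ = 0"

lemma prod_vec_append:
  "length fs = length x \<Longrightarrow> prod_vec (fs @ gs) (x @ y) = prod_vec fs x * prod_vec gs y"
  by (induction fs x rule: prod_vec.induct) simp_all

definition disjoint_supp :: "('n \<Rightarrow> complex) \<Rightarrow> ('n \<Rightarrow> complex) \<Rightarrow> bool" where
  "disjoint_supp f g \<longleftrightarrow> (\<forall>a. f a * g a = 0)"

text \<open>Sum zero makes every \<open>cap\<close> vanish, and disjoint neighbouring supports make
  every \<open>mrg\<close> vanish. Neither condition sees the labels, so one vector serves all words
  of its length.\<close>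

lemma primitive_prod_vec:
  fixes fs :: "('n::finite \<Rightarrow> complex) list"
  assumes len: "length fs = length z"
    and sum: "\<And>f. f \<in> set fs \<Longrightarrow> (\<Sum>a\<in>UNIV. f a) = 0"
    and disj: "successively disjoint_supp fs"
  shows "primitive z (prod_vec fs)"
  unfolding primitive_def
proof (intro conjI allI impI)
  fix m and x :: "'n list" assume m: "Suc m < length z" "Suc (length x) = length z"
  have fs: "fs = take m fs @ fs ! m # fs ! Suc m # drop (Suc (Suc m)) fs"
    using m len by (simp add: Cons_nth_drop_Suc)
  have d: "dup m x = take m x @ x ! m # x ! m # drop (Suc m) x"
    using m by (simp add: dup_def take_Suc_conv_app_nth Cons_nth_drop_Suc)
  have "(fs ! m) (x ! m) * (fs ! Suc m) (x ! m) = 0"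
    using disj m len by (auto simp: successively_conv_nth disjoint_supp_def)
  then have "prod_vec (fs ! m # fs ! Suc m # gs) (x ! m # x ! m # y) = 0" for gs y
    by auto
  then show "mrg m (prod_vec fs) x = 0"
    unfolding mrg_def d by (subst fs, subst prod_vec_append) (use m len in auto)
next
  fix m and x :: "'n list" assume m: "m < length z" "Suc (length x) = length z"
  have fs: "fs = take m fs @ fs ! m # drop (Suc m) fs"
    using m len by (simp add: id_take_nth_drop)
  have "prod_vec fs (put m a x) = prod_vec (take m fs) (take m x) * ((fs ! m) a * prod_vec (drop (Suc m) fs) (drop m x))" for a
    unfolding put_def by (subst fs, subst prod_vec_append) (use m len in auto)
  then have "cap m (prod_vec fs) x
      = prod_vec (take m fs) (take m x) * ((\<Sum>a\<in>UNIV. (fs ! m) a) * prod_vec (drop (Suc m) fs) (drop m x))"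
    by (simp add: cap_def sum_distrib_left sum_distrib_right)
  then show "cap m (prod_vec fs) x = 0" using sum[of "fs ! m"] m len by simp
qed

lemma prod_vec_nonzero:
  "(\<And>f. f \<in> set fs \<Longrightarrow> \<exists>a. f a \<noteq> 0) \<Longrightarrow> \<exists>x. length x = length fs \<and> prod_vec fs x \<noteq> 0"
proof (induction fs)
  case (Cons f fs)
  then obtain x a where "length x = length fs" "prod_vec fs x \<noteq> 0" "f a \<noteq> 0"
    by (metis list.set_intros(1,2))
  then show ?case by (intro exI[of _ "a # x"]) simp
qed auto

lemma sum_prod_vec_mult:
  "(\<Sum>x\<in>tuples (length fs). prod_vec fs x * prod_vec fs x) = (\<Prod>f\<leftarrow>fs. \<Sum>a\<in>UNIV. f a * f (a::'n::finite))"
proof (induction fs)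
  case (Cons f fs)
  have "(\<Sum>x\<in>tuples (length (f # fs)). prod_vec (f # fs) x * prod_vec (f # fs) x)
      = (\<Sum>a\<in>UNIV. f a * f a * (\<Sum>x\<in>tuples (length fs). prod_vec fs x * prod_vec fs x))"
    by (simp add: sum_tuples_Suc sum_distrib_left mult_ac)
  then show ?case using Cons by (simp add: sum_distrib_right)
qed simp

fun parity :: "bool list \<Rightarrow> bool" where
  "parity [] = False"
| "parity (t # z) = (t \<noteq> parity z)"

lemma parity_snoc: "parity (z @ [t]) = (t \<noteq> parity z)"
  by (induction z) auto

text \<open>The indices 2 to 7 name three pairs of points: \<open>2, 3\<close> and
  \<open>4, 5\<close> alternate along a word, \<open>6, 7\<close> serves its ends.\<close>

locale six_points =
  fixes e :: "nat \<Rightarrow> 'n::finite" and \<phi> :: "'n pol_hyp \<Rightarrow> complex"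
  assumes inj: "inj_on e {2..<8}"
    and central: "convolution_central \<phi>"
    and tracial: "tracial \<phi>"
begin

definition d :: "nat \<Rightarrow> nat \<Rightarrow> 'n \<Rightarrow> complex" where
  "d i j a = of_bool (a = e i) - of_bool (a = e j)"

fun alt :: "bool \<Rightarrow> nat \<Rightarrow> ('n \<Rightarrow> complex) list" where
  "alt b 0 = []"
| "alt b (Suc k) = (if b then d 2 3 else d 4 5) # alt (\<not> b) k"

lemma e_eq: "2 \<le> i \<Longrightarrow> i < 8 \<Longrightarrow> 2 \<le> j \<Longrightarrow> j < 8 \<Longrightarrow> e i = e j \<longleftrightarrow> i = j"
  using inj by (auto simp: inj_on_def)

lemma sum_d: "(\<Sum>a\<in>UNIV. d i j a) = 0"
  by (simp add: d_def sum_subtractf of_bool_def)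

lemma d_disjoint:
  assumes "i \<noteq> k" "i \<noteq> l" "j \<noteq> k" "j \<noteq> l" "{i, j, k, l} \<subseteq> {2..<8}"
  shows "disjoint_supp (d i j) (d k l)"
  using assms by (auto simp: d_def e_eq disjoint_supp_def)

lemma d_sq: "2 \<le> i \<Longrightarrow> i < 8 \<Longrightarrow> 2 \<le> j \<Longrightarrow> j < 8 \<Longrightarrow> i \<noteq> j \<Longrightarrow> (\<Sum>a\<in>UNIV. d i j a * d i j a) = 2"
proof -
  assume a: "2 \<le> i" "i < 8" "2 \<le> j" "j < 8" "i \<noteq> j"
  have "d i j a * d i j a = of_bool (a = e i) + of_bool (a = e j)" for a
    using a by (auto simp: d_def e_eq)
  then show ?thesis by (simp add: sum.distrib of_bool_def)
qed

lemma d_nonzero: "2 \<le> i \<Longrightarrow> i < 8 \<Longrightarrow> 2 \<le> j \<Longrightarrow> j < 8 \<Longrightarrow> i \<noteq> j \<Longrightarrow> \<exists>a. d i j a \<noteq> 0"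
  by (rule exI[of _ "e i"]) (simp add: d_def e_eq)

lemma length_alt [simp]: "length (alt b k) = k"
  by (induction b k rule: alt.induct) simp_all

lemma set_alt: "f \<in> set (alt b k) \<Longrightarrow> f = d 2 3 \<or> f = d 4 5"
  by (induction b k rule: alt.induct) (auto split: if_splits)

lemma alt_disjoint: "successively disjoint_supp (alt b k)"
proof (induction b k rule: alt.induct)
  case (2 b k)
  then show ?case by (cases b; cases k) (simp_all add: d_disjoint)
qed simp

lemma sum_alt: "f \<in> set (alt b k) \<Longrightarrow> (\<Sum>a\<in>UNIV. f a) = 0"
  and nonzero_alt: "f \<in> set (alt b k) \<Longrightarrow> \<exists>a. f a \<noteq> 0"
  using set_alt[of f b k] sum_d d_nonzero[of 2 3] d_nonzero[of 4 5] by auto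

text \<open>The alternating vector starts with \<open>d 2 3\<close>, so both \<open>d 6 7\<close>
  and \<open>d 6 4\<close> may precede it. Since \<open>d 6 7\<close> is disjoint from either
  alternating factor, it may also follow, whatever the parity of \<open>k\<close>.\<close>

lemma primitive_alt:
  "length z = k \<Longrightarrow> primitive z (prod_vec (alt True k))"
  "length z = Suc k \<Longrightarrow> primitive z (prod_vec (d 6 7 # alt True k))"
  "length z = Suc k \<Longrightarrow> primitive z (prod_vec (d 6 4 # alt True k))"
  "length z = Suc k \<Longrightarrow> primitive z (prod_vec (alt True k @ [d 6 7]))"
  "length z = Suc (Suc k) \<Longrightarrow> primitive z (prod_vec (d 6 7 # alt True k @ [d 6 7]))" if "0 < k"
proof -
  have 67: "disjoint_supp f (d 6 7)" if "f \<in> set (alt True k)" for f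
    using set_alt[OF that] by (elim disjE) (simp_all add: d_disjoint)
  have hd: "hd (alt True k) = d 2 3" and ne: "alt True k \<noteq> []" using \<open>0 < k\<close> by (cases k; simp)+
  note simps = successively_Cons successively_append_iff alt_disjoint hd ne d_disjoint
  show "length z = k \<Longrightarrow> primitive z (prod_vec (alt True k))"
    by (intro primitive_prod_vec alt_disjoint) (auto simp: sum_alt)
  show "length z = Suc k \<Longrightarrow> primitive z (prod_vec (d 6 7 # alt True k))"
    "length z = Suc k \<Longrightarrow> primitive z (prod_vec (d 6 4 # alt True k))"
    by (intro primitive_prod_vec; auto simp: sum_alt sum_d simps)+
  have last: "disjoint_supp (last (alt True k)) (d 6 7)" using 67 ne by simp
  show "length z = Suc k \<Longrightarrow> primitive z (prod_vec (alt True k @ [d 6 7]))"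
    "length z = Suc (Suc k) \<Longrightarrow> primitive z (prod_vec (d 6 7 # alt True k @ [d 6 7]))"
    using last by (intro primitive_prod_vec; auto simp: sum_alt sum_d simps)+
qed

lemma \<phi>_clinear: "clinear \<phi>"
  using central by (simp add: convolution_central_def)

text \<open>The trace moves the first letter to the end. The factor \<open>d 6 7\<close> moves along
  with it, and the vector is primitive before and after.\<close>

lemma scal_rotate:
  assumes "z \<noteq> []"
  shows "scal \<phi> (s # z) = scal \<phi> (z @ [s])"
proof -
  define k where "k = length z"
  have k: "0 < k" using assms by (simp add: k_def)
  let ?gs = "alt True k"
  obtain x where x: "length x = k" "prod_vec ?gs x \<noteq> 0"
    using prod_vec_nonzero[of ?gs] nonzero_alt by auto
  obtain i where i: "d 6 7 i \<noteq> 0" using d_nonzero[of 6 7] by auto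
  have "scal \<phi> (s # z) * prod_vec (d 6 7 # ?gs) (i # x)
      = (\<Sum>y\<in>tuples (length (s # z)). prod_vec (d 6 7 # ?gs) y * \<phi> (word (s # z) (i # x) y))"
    using scal(1)[OF central primitive_alt(2)[OF k], of "s # z" "i # x"] x by (simp add: k_def)
  also have "\<dots> = (\<Sum>a\<in>UNIV. \<Sum>y\<in>tuples k. d 6 7 a * prod_vec ?gs y * \<phi> (letter s i a * word z x y))"
    by (simp add: sum_tuples_Suc k_def)
  also have "\<dots> = (\<Sum>a\<in>UNIV. \<Sum>y\<in>tuples k. prod_vec (?gs @ [d 6 7]) (y @ [a]) * \<phi> (word (z @ [s]) (x @ [i]) (y @ [a])))"
    using tracial x by (intro sum.cong refl) (simp add: tracial_def prod_vec_append word_append k_def mult_ac)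
  also have "\<dots> = (\<Sum>y\<in>tuples (length (z @ [s])). prod_vec (?gs @ [d 6 7]) y * \<phi> (word (z @ [s]) (x @ [i]) y))"
    by (subst sum.swap) (simp add: sum_tuples_snoc k_def)
  also have "\<dots> = scal \<phi> (z @ [s]) * prod_vec (?gs @ [d 6 7]) (x @ [i])"
    using scal(1)[OF central primitive_alt(4)[OF k], of "z @ [s]" "x @ [i]"] x by (simp add: k_def)
  finally show ?thesis using x i by (simp add: prod_vec_append)
qed

text \<open>Both ends carry the row index \<open>i\<close>. Under the trace the end letters meet and
  multiply to one letter with label \<open>t \<noteq> s\<close>, which forces equal column indices.
  So the square of \<open>d 6 7\<close>, followed by the alternating vector, is an eigenvector of
  the shorter word, and its eigenvalue is the scalar of the longer word.\<close>

lemma close_up: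
  assumes "z \<noteq> []" "length x = length z"
  shows "(\<Sum>a\<in>UNIV. \<Sum>y\<in>tuples (length z). d 6 7 a * d 6 7 a * prod_vec (alt True (length z)) y
        * \<phi> (word ((t \<noteq> s) # z) (i # x) (a # y)))
    = scal \<phi> (s # z @ [t]) * (d 6 7 i * d 6 7 i * prod_vec (alt True (length z)) x)"
proof -
  define k where "k = length z"
  have k: "0 < k" using assms by (simp add: k_def)
  let ?gs = "alt True k"
  let ?fs = "d 6 7 # ?gs @ [d 6 7]"
  have "scal \<phi> (s # z @ [t]) * prod_vec ?fs (i # x @ [i])
      = (\<Sum>y\<in>tuples (length (s # z @ [t])). prod_vec ?fs y * \<phi> (word (s # z @ [t]) (i # x @ [i]) y))"
    using scal(1)[OF central primitive_alt(5)[OF k], of "s # z @ [t]" "i # x @ [i]"] assms by (simp add: k_def)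
  also have "\<dots> = (\<Sum>a\<in>UNIV. \<Sum>y\<in>tuples k. \<Sum>b\<in>UNIV.
      prod_vec ?fs (a # y @ [b]) * \<phi> (word (s # z @ [t]) (i # x @ [i]) (a # y @ [b])))"
  proof -
    have "length (s # z @ [t]) = Suc (Suc k)" by (simp add: k_def)
    then show ?thesis
      by (simp only:) (subst sum_tuples_Suc, rule sum.cong[OF refl], rule sum_tuples_snoc)
  qed
  also have "\<dots> = (\<Sum>a\<in>UNIV. \<Sum>y\<in>tuples k. \<Sum>b\<in>UNIV.
      if a = b then d 6 7 a * d 6 7 a * prod_vec ?gs y * \<phi> (word ((t \<noteq> s) # z) (i # x) (a # y)) else 0)"
  proof (intro sum.cong refl)
    fix a b and y :: "'n list" assume y: "y \<in> tuples k"
    have "\<phi> (word (s # z @ [t]) (i # x @ [i]) (a # y @ [b])) = \<phi> ((letter s i a * word z x y) * letter t i b)"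
      using assms y by (simp add: word_append k_def mult.assoc)
    also have "\<dots> = \<phi> (letter t i b * (letter s i a * word z x y))"
      using tracial by (simp add: tracial_def)
    also have "\<dots> = (if a = b then \<phi> (word ((t \<noteq> s) # z) (i # x) (a # y)) else 0)"
      using letter_row[of t i b s a] clinear_zero[OF \<phi>_clinear] by (simp add: mult.assoc[symmetric])
    finally show "prod_vec ?fs (a # y @ [b]) * \<phi> (word (s # z @ [t]) (i # x @ [i]) (a # y @ [b]))
        = (if a = b then d 6 7 a * d 6 7 a * prod_vec ?gs y * \<phi> (word ((t \<noteq> s) # z) (i # x) (a # y)) else 0)"
      using y by (simp add: prod_vec_append mult_ac)
  qed
  also have "\<dots> = (\<Sum>a\<in>UNIV. \<Sum>y\<in>tuples k. d 6 7 a * d 6 7 a * prod_vec ?gs y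
      * \<phi> (word ((t \<noteq> s) # z) (i # x) (a # y)))"
    by simp
  finally show ?thesis using assms by (simp add: prod_vec_append k_def mult_ac)
qed

text \<open>A right and a left eigenvector with nonzero pairing \<open>Q\<close> have the same
  eigenvalue. The right one comes from \<open>close_up\<close>; the left one is primitive and starts
  with \<open>d 6 4\<close>, which meets the square of \<open>d 6 7\<close> in the single point
  \<open>e 6\<close>, so that nothing cancels in \<open>Q\<close>.\<close>

lemma scal_merge:
  assumes "z \<noteq> []"
  shows "scal \<phi> (s # z @ [t]) = scal \<phi> ((t \<noteq> s) # z)"
proof -
  define k where "k = length z"
  have k: "0 < k" using assms by (simp add: k_def)
  let ?gs = "alt True k"
  let ?h = "prod_vec (d 6 4 # ?gs)"
  define w where "w = (\<lambda>a y. d 6 7 a * d 6 7 a * prod_vec ?gs y)"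
  define Q where "Q = (\<Sum>a\<in>UNIV. \<Sum>y\<in>tuples k. w a y * ?h (a # y))"
  have "scal \<phi> (s # z @ [t]) * Q
      = (\<Sum>i\<in>UNIV. \<Sum>x\<in>tuples k. ?h (i # x) * (scal \<phi> (s # z @ [t]) * w i x))"
    by (simp add: Q_def sum_distrib_left mult_ac del: prod_vec.simps)
  also have "\<dots> = (\<Sum>i\<in>UNIV. \<Sum>x\<in>tuples k. ?h (i # x) * (\<Sum>a\<in>UNIV. \<Sum>y\<in>tuples k. w a y * \<phi> (word ((t \<noteq> s) # z) (i # x) (a # y))))"
    using close_up[OF assms] by (intro sum.cong refl) (simp add: w_def k_def del: prod_vec.simps)
  also have "\<dots> = (\<Sum>p\<in>tuples (Suc k). ?h p * (\<Sum>q\<in>tuples (Suc k). w (hd q) (tl q) * \<phi> (word ((t \<noteq> s) # z) p q)))"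
    by (simp only: sum_tuples_Suc list.sel)
  also have "\<dots> = (\<Sum>q\<in>tuples (Suc k). w (hd q) (tl q) * (\<Sum>p\<in>tuples (Suc k). ?h p * \<phi> (word ((t \<noteq> s) # z) p q)))"
    unfolding sum_distrib_left by (subst sum.swap) (simp only: mult.left_commute)
  also have "\<dots> = (\<Sum>q\<in>tuples (Suc k). w (hd q) (tl q) * (scal \<phi> ((t \<noteq> s) # z) * ?h q))"
    using scal(2)[OF central primitive_alt(3)[OF k], of "(t \<noteq> s) # z"]
    by (intro sum.cong refl) (simp add: k_def del: prod_vec.simps)
  also have "\<dots> = scal \<phi> ((t \<noteq> s) # z) * Q"
    unfolding Q_def sum_tuples_Suc by (simp add: sum_distrib_left mult_ac del: prod_vec.simps)
  finally have eq: "scal \<phi> (s # z @ [t]) * Q = scal \<phi> ((t \<noteq> s) # z) * Q" .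
  have 674: "d 6 7 a * d 6 7 a * d 6 4 a = of_bool (a = e 6)" for a
    by (auto simp: d_def e_eq)
  have "Q = (\<Sum>a\<in>UNIV. d 6 7 a * d 6 7 a * d 6 4 a * (\<Sum>y\<in>tuples k. prod_vec ?gs y * prod_vec ?gs y))"
    by (simp add: Q_def w_def sum_distrib_left mult_ac)
  also have "\<dots> = (\<Prod>f\<leftarrow>?gs. \<Sum>a\<in>UNIV. f a * f a)"
    unfolding 674 using sum_prod_vec_mult[of ?gs] by (simp add: of_bool_def if_distrib[of "\<lambda>c. c * _"] cong: if_cong)
  also have "\<dots> \<noteq> 0"
    by (auto simp: prod_list_zero_iff dest!: set_alt) (simp_all add: d_sq)
  finally show ?thesis using eq by simp
qed

text \<open>Take \<open>close_up\<close> with \<open>u\<close> at both ends and sum over the row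
  index \<open>i\<close>. The column relation for \<open>p\<close> removes the merged letter, and
  both sides acquire the factor 2, the sum of the squares of \<open>d 6 7\<close>. Then
  \<open>scal_merge\<close> trades the longer word for \<open>False # z\<close>.\<close>

lemma scal_cancel:
  assumes "z \<noteq> []"
  shows "scal \<phi> (False # z) = scal \<phi> z"
proof -
  define k where "k = length z"
  have k: "0 < k" using assms by (simp add: k_def)
  let ?gs = "alt True k"
  obtain x where x: "length x = k" "prod_vec ?gs x \<noteq> 0"
    using prod_vec_nonzero[of ?gs] nonzero_alt by auto
  have "(\<Sum>i\<in>UNIV. \<Sum>a\<in>UNIV. \<Sum>y\<in>tuples k. d 6 7 a * d 6 7 a * prod_vec ?gs y * \<phi> (word (False # z) (i # x) (a # y)))
      = (\<Sum>i\<in>UNIV. scal \<phi> (True # z @ [True]) * (d 6 7 i * d 6 7 i * prod_vec ?gs x))"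
    using close_up[OF assms, of x True True] x by (simp add: k_def)
  also have "\<dots> = scal \<phi> (True # z @ [True]) * (\<Sum>i\<in>UNIV. d 6 7 i * d 6 7 i) * prod_vec ?gs x"
    by (simp add: sum_distrib_left sum_distrib_right mult_ac)
  also have "\<dots> = scal \<phi> (True # z @ [True]) * 2 * prod_vec ?gs x"
    by (simp add: d_sq)
  finally have 1: "(\<Sum>i\<in>UNIV. \<Sum>a\<in>UNIV. \<Sum>y\<in>tuples k. d 6 7 a * d 6 7 a * prod_vec ?gs y * \<phi> (word (False # z) (i # x) (a # y)))
      = scal \<phi> (True # z @ [True]) * 2 * prod_vec ?gs x" .
  have col: "(\<Sum>i\<in>UNIV. \<phi> (word (False # z) (i # x) (a # y))) = \<phi> (word z x y)" for a y
  proof -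
    have "(\<Sum>i\<in>UNIV. \<phi> (word (False # z) (i # x) (a # y))) = \<phi> ((\<Sum>i\<in>UNIV. letter False i a) * word z x y)"
      by (simp add: clinear_sum[OF \<phi>_clinear] sum_distrib_right)
    then show ?thesis by (simp add: letter_sum_col)
  qed
  have "(\<Sum>i\<in>UNIV. \<Sum>a\<in>UNIV. \<Sum>y\<in>tuples k. d 6 7 a * d 6 7 a * prod_vec ?gs y * \<phi> (word (False # z) (i # x) (a # y)))
      = (\<Sum>a\<in>UNIV. \<Sum>y\<in>tuples k. d 6 7 a * d 6 7 a * prod_vec ?gs y * (\<Sum>i\<in>UNIV. \<phi> (word (False # z) (i # x) (a # y))))"
    unfolding sum_distrib_left by (subst sum.swap, intro sum.cong refl, subst sum.swap) simp
  also have "\<dots> = (\<Sum>a\<in>UNIV. d 6 7 a * d 6 7 a) * (\<Sum>y\<in>tuples k. prod_vec ?gs y * \<phi> (word z x y))"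
    unfolding col by (simp add: sum_product mult.assoc)
  also have "\<dots> = 2 * (scal \<phi> z * prod_vec ?gs x)"
    using scal(1)[OF central primitive_alt(1)[OF k], of z x] x by (simp add: d_sq k_def)
  finally show ?thesis using 1 x scal_merge[OF assms, of True True] by simp
qed

lemma scal_parity: "z \<noteq> [] \<Longrightarrow> scal \<phi> z = scal \<phi> [parity z]"
proof (induction "length z" arbitrary: z rule: less_induct)
  case less
  have two: "scal \<phi> [False, t] = scal \<phi> [t]" for t by (rule scal_cancel) simp
  have TF: "scal \<phi> [True, False] = scal \<phi> [True]"
    using scal_rotate[of "[False]" True] two[of True] by simp
  \<comment> \<open>\<open>scal_merge\<close> needs a nonempty middle, so the word is first
    lengthened: \<open>[True, True]\<close>, \<open>[True, True, False]\<close>,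
    \<open>[True, False, True]\<close>, \<open>[False, False]\<close>, \<open>[False]\<close> have
    equal scalars.\<close>
  have TT: "scal \<phi> [True, True] = scal \<phi> [False]"
    using scal_merge[of "[True]" True False] scal_rotate[of "[True, False]" True]
      scal_merge[of "[False]" True True] two[of False] by simp
  consider t where "z = [t]" | s t where "z = [s, t]" | s w t where "z = s # w @ [t]" "w \<noteq> []"
  proof -
    obtain s z' where z: "z = s # z'" using less.prems by (cases z) auto
    show thesis
    proof (cases z' rule: rev_cases)
      case Nil
      then show thesis using that(1) z by simp
    next
      case (snoc w t)
      then show thesis using that(2)[of s t] that(3)[of s w t] z by (cases "w = []") auto
    qed
  qed
  then show ?case
  proof cases
    case (2 s t)
    then show ?thesis using two[of t] TF TT by (cases s; cases t) simp_all
  next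
    case (3 s w t)
    have "scal \<phi> z = scal \<phi> ((t \<noteq> s) # w)" unfolding 3(1) by (rule scal_merge[OF 3(2)])
    also have "\<dots> = scal \<phi> [parity ((t \<noteq> s) # w)]" by (rule less.hyps) (simp_all add: 3)
    also have "parity ((t \<noteq> s) # w) = parity z" by (auto simp: 3 parity_snoc)
    finally show ?thesis .
  qed simp
qed

end

section \<open>Spanning by words\<close>

lemma pol_hyp_induct [case_names word add scale]:
  assumes word: "\<And>z x y. length x = length z \<Longrightarrow> length y = length z \<Longrightarrow> P (word z x y)"
    and add: "\<And>x y. P x \<Longrightarrow> P y \<Longrightarrow> P (x + y)" and scale: "\<And>c x. P x \<Longrightarrow> P (c *\<^sub>C x)"
  shows "P (a :: 'n::finite pol_hyp)"
proof (induction a rule: presented_induct)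
  case zero
  show ?case using scale[OF word[of "[]" "[]" "[]"], of 0] by simp
next
  case (gen c m)
  have "\<exists>z x y. length x = length z \<and> length y = length z \<and> gen (Word w) = word z x y"
    for w :: "(('n \<times> 'n) \<times> bool) list"
  proof (induction w)
    case Nil
    then show ?case
      by (intro exI[of _ "[]"]) (simp add: gen_zero zero_hyp_word_def[symmetric])
  next
    case (Cons l w)
    then obtain z x y where w: "length x = length z" "length y = length z" "gen (Word w) = word z x y" by blast
    obtain i j s where l: "l = ((i, j), s)" by (metis prod.exhaust)
    have "gen (Word [l]) = u_gen i j"
      using star_u[of i j] by (cases s) (simp_all add: l u_gen_def gen_flip[symmetric])
    moreover have "gen (Word (l # w)) = gen (Word [l]) * gen (Word w)"
      by (simp add: gen_add[symmetric])
    ultimately have "gen (Word (l # w)) = word (True # z) (i # x) (j # y)"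
      by (simp add: letter_def w)
    then show ?case using w by (metis length_Cons)
  qed
  then show ?case using word scale by (cases m) metis
next
  case (add x y)
  then show ?case by (rule assms(2))
qed

lemma word_cancel_col:
  "length x = length z \<Longrightarrow> length y = length z
    \<Longrightarrow> (\<Sum>b\<in>tuples (length z). word (rev z) (rev b) (rev x) * word z b y) = (if x = y then 1 else 0)"
proof (induction z arbitrary: x y)
  case (Cons t z)
  then obtain i x' j y' where xy: "x = i # x'" "y = j # y'" by (metis length_Suc_conv length_Cons)
  have len: "length x' = length z" "length y' = length z" using Cons.prems xy by simp_all
  have "(\<Sum>b\<in>tuples (length (t # z)). word (rev (t # z)) (rev b) (rev x) * word (t # z) b y)
    = (\<Sum>a\<in>UNIV. \<Sum>b\<in>tuples (length z). word (rev z) (rev b) (rev x') * (letter t a i * letter t a j) * word z b y')"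
    unfolding xy length_Cons sum_tuples_Suc
    by (intro sum.cong refl) (use len in \<open>simp add: word_append mult.assoc\<close>)
  also have "\<dots> = (\<Sum>b\<in>tuples (length z). word (rev z) (rev b) (rev x') * (\<Sum>a\<in>UNIV. letter t a i * letter t a j) * word z b y')"
    by (subst sum.swap) (simp add: sum_distrib_left sum_distrib_right)
  also have "(\<Sum>a\<in>UNIV. letter t a i * letter t a j) = (if i = j then 1 else 0)"
    using letter_sum_col[of j] by (simp add: letter_row)
  also have "(\<Sum>b\<in>tuples (length z). word (rev z) (rev b) (rev x') * (if i = j then 1 else 0) * word z b y')
      = (if x = y then 1 else 0)"
    using Cons.IH[OF len] by (cases "x' = y'") (simp_all add: xy)
  finally show ?case .
qed simp

lemma star_word: "length x = length z \<Longrightarrow> length y = length z \<Longrightarrow> star (word z x y) = word (rev z) (rev x) (rev y)"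
proof (induction z arbitrary: x y)
  case (Cons t z)
  then obtain i x' j y' where "x = i # x'" "y = j # y'" by (metis length_Suc_conv length_Cons)
  with Cons show ?case by (simp add: star_mult star_letter word_append)
qed simp

lemma counit_word: "length x = length z \<Longrightarrow> length y = length z \<Longrightarrow> counit (word z x y) = (if x = y then 1 else 0)"
proof (induction z arbitrary: x y)
  case (Cons t z)
  then obtain i x' j y' where xy: "x = i # x'" "y = j # y'" by (metis length_Suc_conv length_Cons)
  have "counit (letter t i j) = (if i = j then 1 else 0)"
    by (simp add: letter_def star_hom_power2[OF star_hom_counit] counit_u)
  with Cons xy show ?case by (simp add: star_hom_mult[OF star_hom_counit])
qed (simp add: star_hom_one[OF star_hom_counit])

lemma eps_alt_word:
  "length x = length z \<Longrightarrow> length y = length z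
    \<Longrightarrow> eps_alt (word z x y) = (if x = y then if parity z then -1 else 1 else 0)"
proof (induction z arbitrary: x y)
  case (Cons t z)
  then obtain i x' j y' where xy: "x = i # x'" "y = j # y'" by (metis length_Suc_conv length_Cons)
  have "eps_alt (letter t i j) = (if i = j then if t then -1 else 1 else 0)"
    by (simp add: letter_def star_hom_power2[OF star_hom_eps_alt] eps_alt_u)
  with Cons xy show ?case by (simp add: star_hom_mult[OF star_hom_eps_alt])
qed (simp add: star_hom_one[OF star_hom_eps_alt])


section \<open>The antipode\<close>

text \<open>In the opposite algebra, with unchanged \<open>star\<close>, the antipode becomes a
  \<open>star_hom\<close>, so that it can be obtained from the generators and relations.\<close>

datatype 'a opp = Opp (unopp: 'a)

instantiation opp :: (complex_star_algebra) complex_star_algebra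
begin
definition "0 = Opp 0"
definition "1 = Opp 1"
definition "a + b = Opp (unopp a + unopp b)"
definition "a - b = Opp (unopp a - unopp b)"
definition "- a = Opp (- unopp a)"
definition "a * b = Opp (unopp b * unopp a)"
definition "c *\<^sub>C a = Opp (c *\<^sub>C unopp a)"
definition "star a = Opp (star (unopp a))"
instance
  by standard
    (simp_all add: zero_opp_def one_opp_def plus_opp_def minus_opp_def uminus_opp_def times_opp_def
      scaleC_opp_def star_opp_def algebra_simps scaleC_add_right scaleC_add_left scaleC_scaleC
      scaleC_one mult_scaleC_left mult_scaleC_right star_add star_scaleC star_mult star_star opp.expand)
end

lemma unopp_sum: "unopp (\<Sum>i\<in>A. f i) = (\<Sum>i\<in>A. unopp (f i))"
  by (induction A rule: infinite_finite_induct) (simp_all add: zero_opp_def plus_opp_def)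

lemma hyp_relators_opp: "hyp_relators (\<lambda>i j::'n::finite. Opp (u_gen j i)) \<subseteq> {0}"
proof -
  have sq: "(Opp a)\<^sup>2 = Opp (a\<^sup>2)" for a :: "'n pol_hyp"
    by (simp add: power2_eq_square times_opp_def)
  have sum: "(\<Sum>k\<in>A. Opp (f k)) = 1 \<longleftrightarrow> (\<Sum>k\<in>A. f k) = 1" for A and f :: "'n \<Rightarrow> 'n pol_hyp"
  proof -
    have "(\<Sum>k\<in>A. Opp (f k)) = Opp (\<Sum>k\<in>A. f k)" by (rule opp.expand) (simp add: unopp_sum)
    then show ?thesis by (simp add: one_opp_def)
  qed
  have mult: "Opp a * Opp b = Opp (b * a)" for a b :: "'n pol_hyp"
    by (simp add: times_opp_def)
  show ?thesis
    unfolding hyp_relators_iff sq sum mult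
    using u_rels by (auto simp: star_opp_def zero_opp_def u_row u_col p_row p_col p_sum_row p_sum_col)
qed

text \<open>The antipode sends \<open>u_gen i j\<close> to the adjoint of \<open>u_gen j i\<close>,
  which is \<open>u_gen j i\<close> itself.\<close>

definition antipode :: "'n::finite pol_hyp \<Rightarrow> 'n pol_hyp" where
  "antipode x = unopp (hyp_ext (\<lambda>i j. Opp (u_gen j i)) x)"

lemma antipode_simps:
  shows "clinear antipode" "antipode 1 = 1" "antipode (x * y) = antipode y * antipode x"
    "antipode (u_gen i j) = u_gen j i"
proof -
  note hom = star_hom_hyp_ext(1)[OF hyp_relators_opp]
  show "clinear antipode"
    unfolding clinear_def antipode_def
    by (simp add: clinear_add[OF star_hom_clinear[OF hom]] clinear_scaleC[OF star_hom_clinear[OF hom]]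
        plus_opp_def scaleC_opp_def)
  show "antipode 1 = 1" by (simp add: antipode_def star_hom_one[OF hom] one_opp_def)
  show "antipode (x * y) = antipode y * antipode x"
    by (simp add: antipode_def star_hom_mult[OF hom] times_opp_def)
  show "antipode (u_gen i j) = u_gen j i"
    by (simp add: antipode_def star_hom_hyp_ext(2)[OF hyp_relators_opp])
qed

lemma antipode_word:
  "length x = length z \<Longrightarrow> length y = length z \<Longrightarrow> antipode (word z x y) = word (rev z) (rev y) (rev x)"
proof (induction z arbitrary: x y)
  case (Cons t z)
  then obtain i x' j y' where "x = i # x'" "y = j # y'" by (metis length_Suc_conv length_Cons)
  moreover have "antipode (letter t i j) = letter t j i" for i j :: 'a
    by (simp add: letter_def power2_eq_square antipode_simps)
  ultimately show ?case using Cons by (simp add: antipode_simps word_append)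
qed (simp add: antipode_simps)

definition antipode_mult :: "('n::finite pol_hyp, 'n pol_hyp) tensor \<Rightarrow> 'n pol_hyp" where
  "antipode_mult = presented_ext (\<lambda>e. case e of Elem a b \<Rightarrow> antipode a * b)"

lemma antipode_mult:
  fixes a b :: "'n::finite pol_hyp"
  shows "clinear (antipode_mult :: ('n pol_hyp, 'n pol_hyp) tensor \<Rightarrow> _)" "antipode_mult (a \<otimes>\<^sub>t b) = antipode a * b"
proof -
  have "cbilinear (\<lambda>e. case e of Elem a b \<Rightarrow> antipode a * (b :: 'n pol_hyp))"
    by (simp add: cbilinear_def clinear_def clinear_add[OF antipode_simps(1)]
        clinear_scaleC[OF antipode_simps(1)] distrib_left distrib_right mult_scaleC_left mult_scaleC_right)
  from cbilinear_presented_ext[OF this]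
  show "clinear (antipode_mult :: ('n pol_hyp, 'n pol_hyp) tensor \<Rightarrow> _)" "antipode_mult (a \<otimes>\<^sub>t b) = antipode a * b"
    by (simp_all add: antipode_mult_def)
qed

text \<open>One of the two antipode axioms. On words it is the column form of unitarity,
  \<open>word_cancel_col\<close>.\<close>

lemma antipode_mult_comult: "antipode_mult (comult x) = counit x *\<^sub>C 1"
proof (induction x rule: pol_hyp_induct)
  case (word z x y)
  have "antipode_mult (comult (word z x y))
      = (\<Sum>a\<in>tuples (length z). word (rev z) (rev a) (rev x) * word z a y)"
    using word by (simp add: comult_word clinear_sum[OF antipode_mult(1)] antipode_mult(2) antipode_word)
  then show ?case using word by (simp add: word_cancel_col counit_word scaleC_one)
next
  case (add x y)
  then show ?case
    by (simp add: star_hom_add[OF star_hom_comult] star_hom_add[OF star_hom_counit]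
        clinear_add[OF antipode_mult(1)] scaleC_add_left)
next
  case (scale c x)
  then show ?case
    by (simp add: clinear_scaleC[OF star_hom_clinear[OF star_hom_comult]]
        clinear_scaleC[OF star_hom_clinear[OF star_hom_counit]] clinear_scaleC[OF antipode_mult(1)]
        scaleC_scaleC scaleC_complex_def)
qed

lemma slice_left_counit: "slice_left counit (comult x) = x"
proof -
  note lin = star_hom_clinear[OF star_hom_counit]
  show ?thesis
  proof (induction x rule: pol_hyp_induct)
    case (word z x y)
    have "slice_left counit (comult (word z x y))
        = (\<Sum>a\<in>tuples (length z). counit (word z x a) *\<^sub>C word z a y)"
      using word by (simp add: comult_word clinear_sum[OF slice_left(1)[OF lin]] slice_left(2)[OF lin])
    also have "\<dots> = (\<Sum>a\<in>tuples (length z). if a = x then word z a y else 0)"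
      by (intro sum.cong refl) (use word in \<open>auto simp: counit_word scaleC_one\<close>)
    finally show ?case using word by (simp add: sum_tuples_delta)
  qed (simp_all add: star_hom_add[OF star_hom_comult] clinear_add[OF slice_left(1)[OF lin]]
      clinear_scaleC[OF star_hom_clinear[OF star_hom_comult]] clinear_scaleC[OF slice_left(1)[OF lin]])
qed


section \<open>Matrices over a *-algebra\<close>

lemma map_mat_mult:
  assumes "\<And>x y. f (x + y) = f x + f y" "\<And>x y. f (x * y) = f x * f y" "f 0 = 0"
    and "A \<in> carrier_mat n k" "B \<in> carrier_mat k m"
  shows "map_mat f (A * B :: 'a::ring_1 mat) = map_mat f A * (map_mat f B :: 'b::ring_1 mat)"
proof (rule eq_matI)
  have f_sum: "f (\<Sum>i\<in>S. g i) = (\<Sum>i\<in>S. f (g i))" for S :: "nat set" and g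
    by (induction S rule: infinite_finite_induct) (simp_all add: assms)
  fix i j assume "i < dim_row (map_mat f A * map_mat f B)" "j < dim_col (map_mat f A * map_mat f B)"
  then show "map_mat f (A * B) $$ (i, j) = (map_mat f A * map_mat f B) $$ (i, j)"
    using assms(4,5) by (simp add: scalar_prod_def f_sum assms(2))
qed (use assms(4,5) in auto)

lemma map_mat_hom_mult:
  "star_hom f \<Longrightarrow> A \<in> carrier_mat n k \<Longrightarrow> B \<in> carrier_mat k m
    \<Longrightarrow> map_mat f (A * B) = map_mat f A * map_mat f B"
  by (rule map_mat_mult) (simp_all add: star_hom_add star_hom_mult star_hom_zero)

lemma adj_mat_carrier [simp]: "A \<in> carrier_mat n m \<Longrightarrow> adj_mat A \<in> carrier_mat m n"
  by (simp add: adj_mat_def)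

lemma adj_mat_index: "A \<in> carrier_mat n m \<Longrightarrow> i < m \<Longrightarrow> j < n \<Longrightarrow> adj_mat A $$ (i, j) = star (A $$ (j, i))"
  by (auto simp: adj_mat_def)

lemma adj_mat_adj: "adj_mat (adj_mat A) = A"
  by (rule eq_matI) (auto simp: adj_mat_def star_star)

lemma adj_mat_mult:
  assumes "A \<in> carrier_mat n k" "B \<in> carrier_mat k m"
  shows "adj_mat (A * B) = adj_mat B * adj_mat A"
proof (rule eq_matI)
  fix i j assume "i < dim_row (adj_mat B * adj_mat A)" "j < dim_col (adj_mat B * adj_mat A)"
  then show "adj_mat (A * B) $$ (i, j) = (adj_mat B * adj_mat A) $$ (i, j)"
    using assms by (simp add: adj_mat_def scalar_prod_def star_sum star_mult)
qed (use assms in \<open>auto simp: adj_mat_def\<close>)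

lemma scalar_mat_carrier [simp]: "T \<in> carrier_mat n m \<Longrightarrow> scalar_mat T \<in> carrier_mat n m"
  by (simp add: scalar_mat_def)

lemma scalar_mat_mult:
  "A \<in> carrier_mat n k \<Longrightarrow> B \<in> carrier_mat k m \<Longrightarrow> scalar_mat (A * B) = scalar_mat A * scalar_mat B"
  unfolding scalar_mat_def
  by (rule map_mat_mult) (simp_all add: scaleC_add_left mult_scaleC_left scaleC_scaleC)

lemma scalar_mat_one: "scalar_mat (1\<^sub>m n) = 1\<^sub>m n"
  by (rule eq_matI) (auto simp: scalar_mat_def scaleC_one)

lemma scalar_mat_minus:
  "A \<in> carrier_mat n m \<Longrightarrow> B \<in> carrier_mat n m \<Longrightarrow> (scalar_mat (A - B) :: 'a::complex_star_algebra mat) = scalar_mat A - scalar_mat B"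
proof (rule eq_matI)
  have "(a - b) *\<^sub>C (1::'a) = a *\<^sub>C 1 - b *\<^sub>C 1" for a b
    using scaleC_add_left[of "a - b" b "1::'a"] by (simp add: algebra_simps)
  moreover assume "A \<in> carrier_mat n m" "B \<in> carrier_mat n m"
  moreover fix i j assume "i < dim_row (scalar_mat A - scalar_mat B :: 'a mat)" "j < dim_col (scalar_mat A - scalar_mat B :: 'a mat)"
  ultimately show "(scalar_mat (A - B) :: 'a mat) $$ (i, j) = (scalar_mat A - scalar_mat B) $$ (i, j)"
    by (simp add: scalar_mat_def)
qed (auto simp: scalar_mat_def)

lemma adj_scalar_mat: "adj_mat (scalar_mat T :: 'a::complex_star_algebra mat) = scalar_mat (adj_mat T)"
  by (rule eq_matI) (auto simp: adj_mat_def scalar_mat_def star_scaleC star_complex_def)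

lemma map_scalar_mat: "star_hom f \<Longrightarrow> map_mat f (scalar_mat T) = scalar_mat T"
  by (rule eq_matI) (auto simp: scalar_mat_def clinear_scaleC[OF star_hom_clinear] star_hom_one)

lemma scalar_sandwich:
  assumes "A \<in> carrier_mat n k" "M \<in> carrier_mat k l" "B \<in> carrier_mat l m" "i < n" "j < m"
  shows "(scalar_mat A * M * scalar_mat B) $$ (i, j)
    = (\<Sum>a<k. \<Sum>b<l. (A $$ (i, a) * B $$ (b, j)) *\<^sub>C M $$ (a, b))"
proof -
  have "(scalar_mat A * M * scalar_mat B) $$ (i, j)
      = (\<Sum>a<k. (A $$ (i, a) *\<^sub>C 1) * (\<Sum>b<l. M $$ (a, b) * (B $$ (b, j) *\<^sub>C 1)))"
    using assms by (simp add: scalar_mat_def scalar_prod_def lessThan_atLeast0)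
  then show ?thesis
    by (simp add: scaleC_sum_right mult_scaleC_left mult_scaleC_right scaleC_scaleC mult.commute)
qed

section \<open>Unitary representations, counit and antipode\<close>

lemma unitary_mat_carrier:
  assumes "U \<in> carrier_mat n n"
  shows "unitary_mat U \<longleftrightarrow> U * adj_mat U = 1\<^sub>m n \<and> adj_mat U * U = 1\<^sub>m n"
  using assms by (auto simp: unitary_mat_def square_mat.simps)

lemma unitary_rep_carrier: "unitary_rep \<Delta> U \<Longrightarrow> U \<in> carrier_mat (dim_row U) (dim_row U)"
  by (auto simp: unitary_rep_def unitary_mat_def square_mat.simps)

lemma star_hom_tensor: "star_hom (\<lambda>x. x \<otimes>\<^sub>t 1)" "star_hom (\<lambda>x. 1 \<otimes>\<^sub>t x)"
  by (simp_all add: star_hom_def clinear_def tensor_add_left tensor_add_right tensor_scaleC_left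
      tensor_scaleC_right tensor_one tensor_mult tensor_star)

lemma unitary_rep_iff:
  assumes "U \<in> carrier_mat n n"
  shows "unitary_rep \<Delta> U \<longleftrightarrow> unitary_mat U
    \<and> map_mat \<Delta> U = map_mat (\<lambda>x. x \<otimes>\<^sub>t 1) U * map_mat (\<lambda>x. 1 \<otimes>\<^sub>t x) U"
  using assms
  by (auto simp: unitary_rep_def mat_eq_iff scalar_prod_def tensor_mult lessThan_atLeast0)

lemma dim_adj_scalar_mat [simp]:
  "dim_row (adj_mat A) = dim_col A" "dim_col (adj_mat A) = dim_row A"
  "dim_row (scalar_mat T) = dim_row T" "dim_col (scalar_mat T) = dim_col T"
  by (simp_all add: adj_mat_def scalar_mat_def)

text \<open>Slicing the coproduct with the counit gives \<open>U = scalar_mat E * U\<close>, where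
  \<open>E\<close> is the matrix of counit values; the adjoint of \<open>U\<close> cancels
  \<open>U\<close>.\<close>

lemma unitary_rep_counit:
  assumes "unitary_rep comult U" "i < dim_row U" "j < dim_row U"
  shows "counit (U $$ (i, j)) = (if i = j then 1 else 0)"
proof -
  define n where "n = dim_row U"
  have U: "U \<in> carrier_mat n n" unfolding n_def by (rule unitary_rep_carrier[OF assms(1)])
  define E where "E = map_mat counit U"
  have E: "E \<in> carrier_mat n n" using U by (simp add: E_def)
  note lin = star_hom_clinear[OF star_hom_counit]
  have uni: "U * adj_mat U = 1\<^sub>m n"
    using assms(1) U by (simp add: unitary_rep_def unitary_mat_carrier)
  have "U = scalar_mat E * U"
  proof (rule eq_matI)
    fix i j assume ij: "i < dim_row (scalar_mat E * U)" "j < dim_col (scalar_mat E * U)"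
    then have ij': "i < n" "j < n" using U E by auto
    have "U $$ (i, j) = slice_left counit (comult (U $$ (i, j)))" by (rule slice_left_counit[symmetric])
    also have "comult (U $$ (i, j)) = (\<Sum>k<n. U $$ (i, k) \<otimes>\<^sub>t U $$ (k, j))"
      using assms(1) ij' by (simp add: unitary_rep_def n_def)
    also have "slice_left counit \<dots> = (\<Sum>k<n. counit (U $$ (i, k)) *\<^sub>C U $$ (k, j))"
      by (simp add: clinear_sum[OF slice_left(1)[OF lin]] slice_left(2)[OF lin])
    also have "\<dots> = (scalar_mat E * U) $$ (i, j)"
      using ij' U by (simp add: E_def scalar_mat_def scalar_prod_def lessThan_atLeast0 mult_scaleC_left)
    finally show "U $$ (i, j) = (scalar_mat E * U) $$ (i, j)" .
  qed (use U E in auto)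
  then have "U * adj_mat U = scalar_mat E * U * adj_mat U" by simp
  also have "\<dots> = scalar_mat E * (U * adj_mat U)"
    using U E by (intro assoc_mult_mat[of _ n n _ n _ n]) auto
  finally have "scalar_mat E = (1\<^sub>m n :: 'a pol_hyp mat)" using uni E by simp
  then have "E $$ (i, j) *\<^sub>C (1 :: 'a pol_hyp) = (if i = j then 1 else 0)"
    using E assms(2,3) by (metis (no_types, lifting) carrier_matD(1) carrier_matD(2) index_map_mat(1) index_one_mat(1) n_def scalar_mat_def)
  then have "counit (E $$ (i, j) *\<^sub>C (1 :: 'a pol_hyp)) = (if i = j then 1 else 0)"
    by (simp add: star_hom_one[OF star_hom_counit] star_hom_zero[OF star_hom_counit])
  moreover have "i < n" "j < n" using assms(2,3) by (simp_all add: n_def)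
  ultimately show ?thesis
    using U by (simp add: clinear_scaleC[OF lin] star_hom_one[OF star_hom_counit] scaleC_complex_def E_def)
qed

text \<open>By the antipode axiom the left side is a left inverse of \<open>U\<close>, and the
  adjoint is a two-sided inverse.\<close>

lemma unitary_rep_antipode:
  assumes "unitary_rep comult U"
  shows "map_mat antipode U = adj_mat U"
proof -
  define n where "n = dim_row U"
  have U: "U \<in> carrier_mat n n" unfolding n_def by (rule unitary_rep_carrier[OF assms])
  have uni: "U * adj_mat U = 1\<^sub>m n"
    using assms U by (simp add: unitary_rep_def unitary_mat_carrier)
  have "map_mat antipode U * U = 1\<^sub>m n"
  proof (rule eq_matI)
    fix i j assume "i < dim_row (1\<^sub>m n :: 'a pol_hyp mat)" "j < dim_col (1\<^sub>m n :: 'a pol_hyp mat)"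
    then have ij: "i < n" "j < n" by auto
    have "(map_mat antipode U * U) $$ (i, j) = antipode_mult (comult (U $$ (i, j)))"
      using assms ij U
      by (simp add: unitary_rep_def scalar_prod_def lessThan_atLeast0 clinear_sum[OF antipode_mult(1)] antipode_mult(2))
    also have "\<dots> = counit (U $$ (i, j)) *\<^sub>C 1" by (rule antipode_mult_comult)
    finally show "(map_mat antipode U * U) $$ (i, j) = (1\<^sub>m n :: 'a pol_hyp mat) $$ (i, j)"
      using unitary_rep_counit[OF assms, of i j] ij by (simp add: n_def scaleC_one)
  qed (use U in auto)
  then have "map_mat antipode U * U * adj_mat U = 1\<^sub>m n * adj_mat U" by simp
  moreover have "map_mat antipode U * U * adj_mat U = map_mat antipode U * (U * adj_mat U)"
    using U by (intro assoc_mult_mat[of _ n n _ n _ n]) auto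
  ultimately show ?thesis using uni U by simp
qed

lemma antipode_sandwich:
  assumes "A \<in> carrier_mat n n" "M \<in> carrier_mat n n" "B \<in> carrier_mat n n"
  shows "map_mat antipode (scalar_mat A * M * scalar_mat B) = scalar_mat A * map_mat antipode M * scalar_mat B"
proof (rule eq_matI)
  fix i j assume "i < dim_row (scalar_mat A * map_mat antipode M * scalar_mat B)"
    "j < dim_col (scalar_mat A * map_mat antipode M * scalar_mat B)"
  then have ij: "i < n" "j < n" using assms by auto
  have "map_mat antipode (scalar_mat A * M * scalar_mat B) $$ (i, j)
      = antipode ((scalar_mat A * M * scalar_mat B) $$ (i, j))"
    using ij assms by simp
  also have "\<dots> = (scalar_mat A * map_mat antipode M * scalar_mat B) $$ (i, j)"
    unfolding scalar_sandwich[OF assms ij] scalar_sandwich[OF assms(1) map_carrier_mat[THEN iffD2, OF assms(2)] assms(3) ij]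
    using assms(2) by (simp add: clinear_sum[OF antipode_simps(1)] clinear_scaleC[OF antipode_simps(1)])
  finally show "map_mat antipode (scalar_mat A * M * scalar_mat B) $$ (i, j)
      = (scalar_mat A * map_mat antipode M * scalar_mat B) $$ (i, j)" .
qed (use assms in auto)

text \<open>The orthogonal complement of an invariant subspace is invariant: apply the antipode and the adjoint.\<close>
lemma invariant_projection_commutes:
  assumes U: "unitary_rep comult U" "U \<in> carrier_mat n n" and e: "e \<in> carrier_mat n n" "adj_mat e = e"
    and inv: "scalar_mat e * U * scalar_mat e = U * scalar_mat e"
  shows "scalar_mat e * U = U * scalar_mat e"
proof -
  let ?e = "scalar_mat e :: 'a pol_hyp mat"
  have c: "?e \<in> carrier_mat n n" "adj_mat U \<in> carrier_mat n n" "adj_mat ?e = ?e"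
    using e U(2) by (simp_all add: adj_scalar_mat)
  have one: "scalar_mat (1\<^sub>m n) * U = U" using U(2) by (simp add: scalar_mat_one)
  have "?e * adj_mat U * ?e = map_mat antipode (?e * U * ?e)"
    using antipode_sandwich[OF e(1) U(2) e(1)] unitary_rep_antipode[OF U(1)] by simp
  also have "\<dots> = map_mat antipode (scalar_mat (1\<^sub>m n) * U * ?e)"
    using inv one by simp
  also have "\<dots> = scalar_mat (1\<^sub>m n) * map_mat antipode U * ?e"
    by (rule antipode_sandwich[OF _ U(2) e(1)]) simp
  also have "\<dots> = adj_mat U * ?e"
    using unitary_rep_antipode[OF U(1)] by (simp add: scalar_mat_one left_mult_one_mat[OF c(2)])
  finally have "adj_mat (?e * adj_mat U * ?e) = adj_mat (adj_mat U * ?e)" by simp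
  moreover have "adj_mat (adj_mat U * ?e) = ?e * U"
    using adj_mat_mult[OF c(2) c(1)] c(3) by (simp add: adj_mat_adj)
  moreover have "adj_mat (?e * adj_mat U * ?e) = ?e * (U * ?e)"
    using adj_mat_mult[OF mult_carrier_mat[OF c(1) c(2)] c(1)] adj_mat_mult[OF c(1) c(2)] c(3)
    by (simp add: adj_mat_adj)
  moreover have "?e * (U * ?e) = ?e * U * ?e" using c U(2) by simp
  ultimately show ?thesis using inv by simp
qed

subsection \<open>Splitting off the range of a projection\<close>

text \<open>Rank one projections are peeled off: a nonzero column of \<open>e\<close>, normalised,
  is a unit vector \<open>v\<close> fixed by \<open>e\<close>, and subtracting the projection onto
  \<open>v\<close> leaves a projection whose trace is smaller by one. The induction runs over a
  strict upper bound \<open>m\<close> of the trace, which thereby turns out to be the natural number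
  \<open>r\<close>.\<close>

lemma projection_isometry_aux:
  fixes e :: "nat \<Rightarrow> nat \<Rightarrow> complex"
  assumes "\<And>i j. i < n \<Longrightarrow> j < n \<Longrightarrow> cnj (e i j) = e j i"
    and "\<And>i j. i < n \<Longrightarrow> j < n \<Longrightarrow> (\<Sum>k<n. e i k * e k j) = e i j"
    and "Re (\<Sum>i<n. e i i) < real m"
  shows "\<exists>r W. (\<forall>a<r. \<forall>b<r. (\<Sum>i<n. cnj (W i a) * W i b) = (if a = b then 1 else 0))
    \<and> (\<forall>i<n. \<forall>k<n. (\<Sum>a<r. W i a * cnj (W k a)) = e i k) \<and> (\<Sum>i<n. e i i) = of_nat r"
  using assms
proof (induction m arbitrary: e)
  have diag: "e j j = of_real (\<Sum>k<n. (cmod (e k j))\<^sup>2)"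
    if "j < n" "\<And>i j. i < n \<Longrightarrow> j < n \<Longrightarrow> cnj (e i j) = e j i"
      "\<And>i j. i < n \<Longrightarrow> j < n \<Longrightarrow> (\<Sum>k<n. e i k * e k j) = e i j" for j and e :: "nat \<Rightarrow> nat \<Rightarrow> complex"
  proof -
    have "e j j = (\<Sum>k<n. e j k * e k j)" using that by simp
    also have "\<dots> = (\<Sum>k<n. cnj (e k j) * e k j)" using that by (intro sum.cong) auto
    also have "\<dots> = of_real (\<Sum>k<n. (cmod (e k j))\<^sup>2)"
      by (simp add: complex_norm_square mult.commute del: of_real_power)
    finally show ?thesis .
  qed
  {
    case 0
    have "Re (\<Sum>i<n. e i i) \<ge> 0"
      using diag[OF _ 0(1,2)] by (simp add: sum_nonneg)
    with 0 show ?case by simp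
  next
    case (Suc m)
    show ?case
    proof (cases "\<forall>i<n. \<forall>j<n. e i j = 0")
      case True
      then show ?thesis by (intro exI[of _ 0]) simp
    next
      case False
      then obtain i0 j where j: "i0 < n" "j < n" "e i0 j \<noteq> 0" by blast
      \<comment> \<open>The squared norm of column \<open>j\<close>, which for a projection is its
        diagonal entry.\<close>
      define t where "t = (\<Sum>k<n. (cmod (e k j))\<^sup>2)"
      have ejj: "e j j = of_real t" using diag[OF j(2) Suc.prems(1,2)] by (simp add: t_def)
      have "(cmod (e i0 j))\<^sup>2 \<le> t" unfolding t_def using j by (intro member_le_sum) auto
      then have t: "t > 0" using j(3) by (smt (verit) zero_less_norm_iff zero_less_power)
      define v where "v = (\<lambda>i. e i j / of_real (sqrt t))"
      have cv: "cnj (v i) = e j i / of_real (sqrt t)" if "i < n" for i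
        using Suc.prems(1)[OF that j(2)] by (simp add: v_def)
      have tt: "complex_of_real (sqrt t) * complex_of_real (sqrt t) = of_real t"
        using t by (simp flip: of_real_mult)
      have vv: "(\<Sum>k<n. cnj (v k) * v k) = 1"
      proof -
        have "(\<Sum>k<n. cnj (v k) * v k) = (\<Sum>k<n. e j k * e k j) / of_real t"
          unfolding sum_divide_distrib
        proof (intro sum.cong refl)
          fix k assume "k \<in> {..<n}"
          then have "cnj (v k) * v k = e j k / of_real (sqrt t) * (e k j / of_real (sqrt t))"
            using cv by (simp only: v_def lessThan_iff)
          then show "cnj (v k) * v k = e j k * e k j / of_real t" by (simp add: tt)
        qed
        then show ?thesis using Suc.prems(2)[OF j(2) j(2)] ejj t by simp
      qed
      have ev: "(\<Sum>k<n. e i k * v k) = v i" if "i < n" for i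
        using Suc.prems(2)[OF that j(2)] by (simp add: v_def sum_divide_distrib[symmetric])
      have ve: "(\<Sum>k<n. cnj (v k) * e k i) = cnj (v i)" if "i < n" for i
      proof -
        have "(\<Sum>k<n. cnj (v k) * e k i) = (\<Sum>k<n. e j k * e k i) / of_real (sqrt t)"
          using cv by (simp add: sum_divide_distrib)
        then show ?thesis using Suc.prems(2)[OF j(2) that] cv[OF that] by simp
      qed
      define f where "f = (\<lambda>i k. e i k - v i * cnj (v k))"
      have f1: "cnj (f i k) = f k i" if "i < n" "k < n" for i k
        using Suc.prems(1)[OF that] by (simp add: f_def mult.commute)
      have f2: "(\<Sum>k<n. f i k * f k l) = f i l" if "i < n" "l < n" for i l
      proof -
        have "(\<Sum>k<n. f i k * f k l) = (\<Sum>k<n. e i k * e k l) - (\<Sum>k<n. e i k * v k) * cnj (v l)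
            - v i * (\<Sum>k<n. cnj (v k) * e k l) + v i * (\<Sum>k<n. cnj (v k) * v k) * cnj (v l)"
          by (simp add: f_def algebra_simps sum.distrib sum_subtractf sum_distrib_left sum_distrib_right)
        then show ?thesis using Suc.prems(2)[OF that] ev[OF that(1)] ve[OF that(2)] vv by (simp add: f_def)
      qed
      have tr: "(\<Sum>i<n. f i i) = (\<Sum>i<n. e i i) - 1"
        using vv by (simp add: f_def sum_subtractf mult.commute)
      have "Re (\<Sum>i<n. f i i) < real m" using Suc.prems(3) by (simp add: tr)
      from Suc.IH[OF f1 f2 this] obtain r W where
        W: "\<And>a b. a < r \<Longrightarrow> b < r \<Longrightarrow> (\<Sum>i<n. cnj (W i a) * W i b) = (if a = b then 1 else 0)"
        "\<And>i k. i < n \<Longrightarrow> k < n \<Longrightarrow> (\<Sum>a<r. W i a * cnj (W k a)) = f i k" "(\<Sum>i<n. f i i) = of_nat r"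
        by blast
      have fv: "(\<Sum>k<n. f i k * v k) = 0" if "i < n" for i
      proof -
        have "(\<Sum>k<n. f i k * v k) = (\<Sum>k<n. e i k * v k) - v i * (\<Sum>k<n. cnj (v k) * v k)"
          by (simp add: f_def algebra_simps sum_subtractf sum_distrib_left)
        then show ?thesis using ev[OF that] vv by simp
      qed
      \<comment> \<open>The columns of \<open>W\<close> span the range of \<open>f\<close>, and
        \<open>f\<close> annihilates \<open>v\<close>.\<close>
      have Wv: "(\<Sum>i<n. cnj (W i a) * v i) = 0" if a: "a < r" for a
      proof -
        have "(\<Sum>i<n. cnj (W i a) * (\<Sum>k<n. f i k * v k)) = (\<Sum>i<n. cnj (W i a) * (\<Sum>k<n. (\<Sum>b<r. W i b * cnj (W k b)) * v k))"
          using W(2) by (intro sum.cong refl arg_cong2[of _ _ _ _ "(*)"]) auto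
        also have "\<dots> = (\<Sum>b<r. (\<Sum>i<n. cnj (W i a) * W i b) * (\<Sum>k<n. cnj (W k b) * v k))"
        proof -
          have "(\<Sum>i<n. cnj (W i a) * (\<Sum>k<n. (\<Sum>b<r. W i b * cnj (W k b)) * v k))
              = (\<Sum>i<n. \<Sum>k<n. \<Sum>b<r. cnj (W i a) * W i b * (cnj (W k b) * v k))"
            by (simp add: sum_distrib_left sum_distrib_right mult.assoc)
          also have "\<dots> = (\<Sum>i<n. \<Sum>b<r. \<Sum>k<n. cnj (W i a) * W i b * (cnj (W k b) * v k))"
            by (intro sum.cong refl sum.swap)
          also have "\<dots> = (\<Sum>b<r. \<Sum>i<n. \<Sum>k<n. cnj (W i a) * W i b * (cnj (W k b) * v k))"
            by (rule sum.swap)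
          finally show ?thesis by (simp add: sum_product)
        qed
        also have "\<dots> = (\<Sum>b<r. if b = a then \<Sum>k<n. cnj (W k b) * v k else 0)"
          using W(1) a by (intro sum.cong refl) auto
        also have "\<dots> = (\<Sum>k<n. cnj (W k a) * v k)" using a by (simp add: sum.delta')
        finally show ?thesis using fv by simp
      qed
      have vW: "(\<Sum>i<n. cnj (v i) * W i a) = 0" if "a < r" for a
        using arg_cong[OF Wv[OF that], of cnj] by (simp add: mult.commute)
      define X where "X = (\<lambda>i a. if a = r then v i else W i a)"
      have "(\<Sum>i<n. cnj (X i a) * X i b) = (if a = b then 1 else 0)" if "a < Suc r" "b < Suc r" for a b
        using that W(1)[of a b] Wv[of a] vW[of b] vv by (auto simp: X_def less_Suc_eq)
      moreover have "(\<Sum>a<Suc r. X i a * cnj (X k a)) = e i k" if "i < n" "k < n" for i k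
        using W(2)[OF that] by (simp add: X_def f_def)
      moreover have "(\<Sum>i<n. e i i) = of_nat (Suc r)"
        using tr W(3) by (simp add: algebra_simps)
      ultimately show ?thesis by blast
    qed
  }
qed

lemma projection_isometry:
  fixes e :: "complex mat"
  assumes e: "e \<in> carrier_mat n n" "adj_mat e = e" "e * e = e"
  obtains r W where "W \<in> carrier_mat n r" "adj_mat W * W = 1\<^sub>m r" "W * adj_mat W = e"
    "(\<Sum>i<n. e $$ (i, i)) = of_nat r"
proof -
  obtain m where m: "Re (\<Sum>i<n. e $$ (i, i)) < real m" using reals_Archimedean2 by blast
  have "cnj (e $$ (i, j)) = e $$ (j, i)" if "i < n" "j < n" for i j
    using adj_mat_index[OF e(1), of j i] that e(2) by (simp add: star_complex_def)
  moreover have "(\<Sum>k<n. e $$ (i, k) * e $$ (k, j)) = e $$ (i, j)" if "i < n" "j < n" for i j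
    using arg_cong[OF e(3), of "\<lambda>A. A $$ (i, j)"] e(1) that by (simp add: scalar_prod_def lessThan_atLeast0)
  ultimately obtain r W where W:
    "\<forall>a<r. \<forall>b<r. (\<Sum>i<n. cnj (W i a) * W i b) = (if a = b then 1 else 0)"
    "\<forall>i<n. \<forall>k<n. (\<Sum>a<r. W i a * cnj (W k a)) = e $$ (i, k)" "(\<Sum>i<n. e $$ (i, i)) = of_nat r"
    using projection_isometry_aux[of n "\<lambda>i j. e $$ (i, j)" m] m by blast
  define M where "M = mat n r (\<lambda>(i, a). W i a)"
  have "M \<in> carrier_mat n r" by (simp add: M_def)
  moreover have "adj_mat M * M = 1\<^sub>m r"
    using W(1) by (intro eq_matI) (auto simp: M_def adj_mat_def scalar_prod_def star_complex_def lessThan_atLeast0)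
  moreover have "M * adj_mat M = e"
    using W(2) e(1) by (intro eq_matI) (auto simp: M_def adj_mat_def scalar_prod_def star_complex_def lessThan_atLeast0)
  ultimately show thesis using that W(3) by blast
qed

text \<open>\<open>W\<close> is an isometry onto the range of \<open>e\<close>. Since
  \<open>e\<close> commutes with \<open>U\<close>, the isometry intertwines \<open>V\<close> and
  \<open>U\<close>, which transports unitarity and the coproduct formula.\<close>

lemma subrepresentation:
  assumes U: "unitary_rep comult U" "U \<in> carrier_mat n n"
    and e: "e \<in> carrier_mat n n" "scalar_mat e * U = U * scalar_mat e"
    and W: "W \<in> carrier_mat n r" "adj_mat W * W = 1\<^sub>m r" "W * adj_mat W = e"
  defines "V \<equiv> scalar_mat (adj_mat W) * U * scalar_mat W"
  shows "unitary_rep comult V" "V \<in> carrier_mat r r"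
    "scalar_mat W * V * scalar_mat (adj_mat W) = scalar_mat e * U * scalar_mat e"
proof -
  let ?w = "scalar_mat W :: 'a pol_hyp mat" and ?w' = "scalar_mat (adj_mat W) :: 'a pol_hyp mat"
  let ?e = "scalar_mat e :: 'a pol_hyp mat" and ?U' = "adj_mat U"
  have c: "?w \<in> carrier_mat n r" "?w' \<in> carrier_mat r n" "?e \<in> carrier_mat n n" "?U' \<in> carrier_mat n n"
    using W e U by simp_all
  show V: "V \<in> carrier_mat r r" using c U(2) by (simp add: V_def)
  have ww: "?w * ?w' = ?e" "?w' * ?w = 1\<^sub>m r"
    unfolding scalar_mat_mult[OF W(1) adj_mat_carrier[OF W(1)], symmetric]
      scalar_mat_mult[OF adj_mat_carrier[OF W(1)] W(1), symmetric] W(2,3)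
    by (simp_all add: scalar_mat_one)
  note assoc = assoc_mult_mat[of _ n n _ n _ r] assoc_mult_mat[of _ r n _ n _ r] assoc_mult_mat[of _ r n _ n _ n]
    assoc_mult_mat[of _ n n _ n _ n] assoc_mult_mat[of _ n r _ n _ n] assoc_mult_mat[of _ n r _ n _ r]
    assoc_mult_mat[of _ n n _ r _ n] assoc_mult_mat[of _ n r _ r _ n] assoc_mult_mat[of _ r n _ r _ n] assoc_mult_mat[of _ r n _ r _ r]
    assoc_mult_mat[of _ r r _ n _ r] assoc_mult_mat[of _ r r _ n _ n] assoc_mult_mat[of _ n r _ r _ r]
  have ew: "?e * ?w = ?w" "?w' * ?e = ?w'"
  proof -
    have "?e * ?w = ?w * (?w' * ?w)"
      unfolding ww(1)[symmetric] by (rule assoc_mult_mat[OF c(1,2,1)])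
    then show "?e * ?w = ?w" by (simp add: ww(2) right_mult_one_mat[OF c(1)])
    have "?w' * ?e = (?w' * ?w) * ?w'"
      unfolding ww(1)[symmetric] by (rule assoc_mult_mat[OF c(2,1,2), symmetric])
    then show "?w' * ?e = ?w'" by (simp add: ww(2) left_mult_one_mat[OF c(2)])
  qed
  have wV: "?w * V = U * ?w"
  proof -
    have "?w * V = (?w * ?w') * (U * ?w)" using c U(2) by (simp add: V_def assoc)
    also have "\<dots> = (?e * U) * ?w" using c U(2) by (simp add: ww assoc)
    also have "\<dots> = U * (?e * ?w)" using c U(2) e(2) by (simp add: assoc)
    finally show ?thesis by (simp add: ew)
  qed
  have Vw: "V * ?w' = ?w' * U"
  proof -
    have "V * ?w' = ?w' * (U * ?e)" using c U(2) by (simp add: V_def ww(1)[symmetric] assoc)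
    also have "\<dots> = (?w' * ?e) * U" using c U(2) by (simp add: e(2)[symmetric] assoc)
    finally show ?thesis by (simp add: ew)
  qed
  show "?w * V * ?w' = ?e * U * ?e"
    using c U(2) by (simp add: V_def ww(1)[symmetric] assoc)
  have uni: "U * ?U' = 1\<^sub>m n" "?U' * U = 1\<^sub>m n"
    using U by (auto simp: unitary_rep_def unitary_mat_carrier)
  have adjV: "adj_mat V = ?w' * ?U' * ?w"
    using c U(2) adj_mat_mult[of "?w' * U" r n ?w r] adj_mat_mult[of ?w' r n U n]
    by (simp add: V_def adj_scalar_mat adj_mat_adj assoc)
  have "V * adj_mat V = ?w' * U * ?U' * ?w"
  proof -
    have "V * adj_mat V = (V * ?w') * (?U' * ?w)" using c U(2) V
      by (simp add: adjV assoc assoc_mult_mat[OF V c(2) mult_carrier_mat[OF c(4) c(1)]])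
    then show ?thesis using c U(2) by (simp add: Vw assoc)
  qed
  also have "\<dots> = ?w' * (U * ?U') * ?w" using c U(2) by (simp add: assoc)
  finally have VV1: "V * adj_mat V = 1\<^sub>m r" by (simp add: uni ww right_mult_one_mat[OF c(2)])
  have "adj_mat V * V = ?w' * ?U' * (?w * V)"
    unfolding adjV by (rule assoc_mult_mat[OF mult_carrier_mat[OF c(2) c(4)] c(1) V])
  also have "\<dots> = ?w' * ((?U' * U) * ?w)" using c U(2) by (simp add: wV assoc)
  finally have VV2: "adj_mat V * V = 1\<^sub>m r" by (simp add: uni ww left_mult_one_mat[OF c(1)])
  let ?L = "map_mat (\<lambda>x. x \<otimes>\<^sub>t (1 :: 'a pol_hyp))" and ?R = "map_mat (\<lambda>x. (1 :: 'a pol_hyp) \<otimes>\<^sub>t x)"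
  let ?x = "scalar_mat W :: ('a pol_hyp, 'a pol_hyp) tensor mat"
  let ?x' = "scalar_mat (adj_mat W) :: ('a pol_hyp, 'a pol_hyp) tensor mat"
  have cx: "?x \<in> carrier_mat n r" "?x' \<in> carrier_mat r n" using W by simp_all
  have LR: "?L U \<in> carrier_mat n n" "?R U \<in> carrier_mat n n" "?R V \<in> carrier_mat r r" using U(2) V by simp_all
  have hom: "map_mat f V = ?x' * map_mat f U * ?x" if "star_hom f" for f :: "'a pol_hyp \<Rightarrow> ('a pol_hyp, 'a pol_hyp) tensor"
    using map_mat_hom_mult[OF that, of "?w' * U" r n ?w r] map_mat_hom_mult[OF that, of ?w' r n U n] c U(2)
    by (simp add: V_def map_scalar_mat[OF that])
  \<comment> \<open>The intertwining relation in the second tensor leg lets the isometry pass to the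
    left of that leg, where it completes the compression of the first.\<close>
  have RwV: "?x * ?R V = ?R U * ?x"
    using arg_cong[OF wV, of ?R]
    by (simp add: map_scalar_mat[OF star_hom_tensor(2)] map_mat_hom_mult[OF star_hom_tensor(2) c(1) V]
        map_mat_hom_mult[OF star_hom_tensor(2) U(2) c(1)])
  have "map_mat comult V = ?x' * (?L U * ?R U) * ?x"
    using hom[OF star_hom_comult] U unitary_rep_iff[OF U(2), of comult] by simp
  also have "\<dots> = ?x' * ?L U * (?R U * ?x)" using cx LR by (simp add: assoc)
  also have "\<dots> = ?x' * ?L U * (?x * ?R V)" by (simp only: RwV)
  also have "\<dots> = ?x' * ?L U * ?x * ?R V" using cx LR by (simp add: assoc)
  also have "\<dots> = ?L V * ?R V" using hom[OF star_hom_tensor(1)] by simp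
  finally show "unitary_rep comult V"
    using V VV1 VV2 by (simp add: unitary_rep_iff unitary_mat_carrier)
qed

section \<open>Central functionals commute with the regular representation\<close>

definition commutes :: "('n::finite pol_hyp \<Rightarrow> complex) \<Rightarrow> 'n pol_hyp \<Rightarrow> bool" where
  "commutes \<phi> x \<longleftrightarrow> slice_left \<phi> (comult x) = slice_right \<phi> (comult x)"

lemma commutes_add: "clinear \<phi> \<Longrightarrow> commutes \<phi> x \<Longrightarrow> commutes \<phi> y \<Longrightarrow> commutes \<phi> (x + y)"
  and commutes_scale: "clinear \<phi> \<Longrightarrow> commutes \<phi> x \<Longrightarrow> commutes \<phi> (c *\<^sub>C x)"
  by (simp_all add: commutes_def star_hom_add[OF star_hom_comult] clinear_add[OF slice_left(1)]
      clinear_add[OF slice_right(1)] clinear_scaleC[OF star_hom_clinear[OF star_hom_comult]]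
      clinear_scaleC[OF slice_left(1)] clinear_scaleC[OF slice_right(1)])

lemma commutes_sum: "clinear \<phi> \<Longrightarrow> (\<And>i. i \<in> A \<Longrightarrow> commutes \<phi> (f i)) \<Longrightarrow> commutes \<phi> (\<Sum>i\<in>A. f i)"
  by (simp add: commutes_def star_hom_sum[OF star_hom_comult] clinear_sum[OF slice_left(1)]
      clinear_sum[OF slice_right(1)])

lemma commutes_sandwich:
  assumes "clinear \<phi>" "A \<in> carrier_mat n k" "M \<in> carrier_mat k l" "B \<in> carrier_mat l m"
    and "\<And>a b. a < k \<Longrightarrow> b < l \<Longrightarrow> commutes \<phi> (M $$ (a, b))" "i < n" "j < m"
  shows "commutes \<phi> ((scalar_mat A * M * scalar_mat B) $$ (i, j))"
  unfolding scalar_sandwich[OF assms(2,3,4,6,7)]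
  by (intro commutes_sum commutes_scale assms) auto

lemma complementary_projection:
  fixes e :: "complex mat"
  assumes e: "e \<in> carrier_mat n n" "adj_mat e = e" "e * e = e"
  shows "adj_mat (1\<^sub>m n - e) = 1\<^sub>m n - e" "(1\<^sub>m n - e) * (1\<^sub>m n - e) = 1\<^sub>m n - e"
proof -
  have "cnj (e $$ (j, i)) = e $$ (i, j)" if "i < n" "j < n" for i j
    using adj_mat_index[OF e(1) that] e(2) by (simp add: star_complex_def)
  then show "adj_mat (1\<^sub>m n - e) = 1\<^sub>m n - e"
    using e(1) by (intro eq_matI) (auto simp: adj_mat_def star_complex_def)
  have "(1\<^sub>m n - e) * (1\<^sub>m n - e) = (1\<^sub>m n - e) * 1\<^sub>m n - (1\<^sub>m n - e) * e"
    using e(1) by (intro mult_minus_distrib_mat[of _ n n _ n]) auto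
  also have "(1\<^sub>m n - e) * e = 1\<^sub>m n * e - e * e"
    using e(1) by (intro minus_mult_distrib_mat[of _ n n]) auto
  also have "\<dots> = 0\<^sub>m n n" using e by (intro eq_matI) auto
  also have "(1\<^sub>m n - e) * 1\<^sub>m n - 0\<^sub>m n n = 1\<^sub>m n - e" using e(1) by (intro eq_matI) auto
  finally show "(1\<^sub>m n - e) * (1\<^sub>m n - e) = 1\<^sub>m n - e" .
qed

text \<open>Complete reducibility as an induction on the dimension. An irreducible \<open>V\<close>
  is conjugate to a representative, for which both slices are \<open>c\<close> times the entry.
  Otherwise \<open>V\<close> is the sum of its compressions by an invariant projection and its
  complement, and an isometry identifies each with a smaller representation.\<close>

lemma commutes_coefficient:
  fixes \<phi> :: "'n::finite pol_hyp \<Rightarrow> complex"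
  assumes lin: "clinear \<phi>" and Irr: "irr_representatives comult Irr" and cen: "central Irr \<phi>"
  shows "unitary_rep comult V \<Longrightarrow> i < dim_row V \<Longrightarrow> j < dim_row V \<Longrightarrow> commutes \<phi> (V $$ (i, j))"
proof (induction "dim_row V" arbitrary: V i j rule: less_induct)
  case less
  define n where "n = dim_row V"
  have V: "V \<in> carrier_mat n n" unfolding n_def by (rule unitary_rep_carrier[OF less.prems(1)])
  have ij: "i < n" "j < n" using less.prems by (simp_all add: n_def)
  show ?case
  proof (cases "irreducible_rep comult V")
    case True
    then obtain U where U: "U \<in> Irr" "equivalent_rep U V"
      using Irr unfolding irr_representatives_def by blast
    then obtain T where T: "T \<in> carrier_mat n n" "unitary_mat T" "scalar_mat T * U = V * scalar_mat T"
      and dim: "dim_row U = n" unfolding equivalent_rep_def n_def by auto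
    have rep: "unitary_rep comult U"
      using U(1) Irr unfolding irr_representatives_def irreducible_rep_def by blast
    have Uc: "U \<in> carrier_mat n n" using unitary_rep_carrier[OF rep] unfolding dim .
    obtain c where c: "\<And>a b. a < n \<Longrightarrow> b < n \<Longrightarrow> \<phi> (U $$ (a, b)) = (if a = b then c else 0)"
      using cen U(1) dim unfolding central_def by blast
    have "commutes \<phi> (U $$ (a, b))" if "a < n" "b < n" for a b
    proof -
      have "comult (U $$ (a, b)) = (\<Sum>k<n. U $$ (a, k) \<otimes>\<^sub>t U $$ (k, b))"
        using rep that dim by (simp add: unitary_rep_def)
      then show ?thesis
        using that c
        by (simp add: commutes_def clinear_sum[OF slice_left(1)[OF lin]] clinear_sum[OF slice_right(1)[OF lin]]
            slice_left(2)[OF lin] slice_right(2)[OF lin] if_distrib[of "\<lambda>c. c *\<^sub>C _"] sum.delta' cong: if_cong)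
    qed
    then have "commutes \<phi> ((scalar_mat T * U * scalar_mat (adj_mat T)) $$ (i, j))"
      using ij T(1) Uc by (intro commutes_sandwich[OF lin]) auto
    moreover have "scalar_mat T * U * scalar_mat (adj_mat T) = V"
    proof -
      have "scalar_mat T * U * scalar_mat (adj_mat T) = V * (scalar_mat T * scalar_mat (adj_mat T))"
        unfolding T(3) using V T(1) by (intro assoc_mult_mat[of _ n n _ n _ n]) auto
      also have "scalar_mat T * scalar_mat (adj_mat T) = (1\<^sub>m n :: 'n pol_hyp mat)"
        using scalar_mat_mult[OF T(1) adj_mat_carrier[OF T(1)], symmetric] T(1,2)
        by (simp add: unitary_mat_carrier scalar_mat_one)
      finally show ?thesis using V by simp
    qed
    ultimately show ?thesis by simp
  next
    case False
    then obtain e where e: "e \<in> carrier_mat n n" "adj_mat e = e" "e * e = e"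
      "scalar_mat e * V * scalar_mat e = V * scalar_mat e" "e \<noteq> 0\<^sub>m n n" "e \<noteq> 1\<^sub>m n"
      using less.prems(1) ij unfolding irreducible_rep_def n_def by auto
    let ?e = "scalar_mat e :: 'n pol_hyp mat"
    define f where "f = 1\<^sub>m n - e"
    have f: "f \<in> carrier_mat n n" "adj_mat f = f" "f * f = f"
      using complementary_projection[OF e(1-3)] minus_carrier_mat[OF e(1), of "1\<^sub>m n"] by (simp_all add: f_def)
    have eV: "?e * V = V * ?e"
      by (rule invariant_projection_commutes[OF less.prems(1) V e(1,2,4)])
    have fs: "scalar_mat f = 1\<^sub>m n - ?e"
      using e(1) by (simp add: f_def scalar_mat_minus[of _ n n] scalar_mat_one)
    have "(1\<^sub>m n - ?e) * V = 1\<^sub>m n * V - ?e * V"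
      using e(1) V by (intro minus_mult_distrib_mat[of _ n n]) auto
    moreover have "V * (1\<^sub>m n - ?e) = V * 1\<^sub>m n - V * ?e"
      using e(1) V by (intro mult_minus_distrib_mat[of _ n n _ n]) auto
    ultimately have fV: "scalar_mat f * V = V * scalar_mat f" and Vf: "V * scalar_mat f = V - V * ?e"
      using V eV by (simp_all add: fs)
    obtain r W where W: "W \<in> carrier_mat n r" "adj_mat W * W = 1\<^sub>m r" "W * adj_mat W = e"
      "(\<Sum>i<n. e $$ (i, i)) = of_nat r"
      by (rule projection_isometry[OF e(1-3)])
    obtain s X where X: "X \<in> carrier_mat n s" "adj_mat X * X = 1\<^sub>m s" "X * adj_mat X = f"
      "(\<Sum>i<n. f $$ (i, i)) = of_nat s"
      by (rule projection_isometry[OF f])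
    \<comment> \<open>Traces are ranks, so the ranks add up to \<open>n\<close>; both being nonzero,
      each is less than \<open>n\<close>.\<close>
    have "(\<Sum>i<n. e $$ (i, i)) + (\<Sum>i<n. f $$ (i, i)) = of_nat n"
      using e(1) by (simp add: f_def sum.distrib[symmetric])
    then have "complex_of_nat (r + s) = of_nat n" using W(4) X(4) by simp
    then have rs: "r + s = n" by (simp only: of_nat_eq_iff)
    have null: "W * adj_mat W = 0\<^sub>m n n" if "W \<in> carrier_mat n 0" for W :: "complex mat"
      using that by (intro eq_matI) (auto simp: scalar_prod_def)
    have "r \<noteq> 0" using null[of W] W e(5) by auto
    moreover have "s \<noteq> 0"
    proof
      assume "s = 0"
      then have z: "f = 0\<^sub>m n n" using null[of X] X by auto
      have "e = 1\<^sub>m n"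
      proof (rule eq_matI)
        fix i j assume "i < dim_row (1\<^sub>m n :: complex mat)" "j < dim_col (1\<^sub>m n :: complex mat)"
        then show "e $$ (i, j) = 1\<^sub>m n $$ (i, j)"
          using arg_cong[OF z, of "\<lambda>A. A $$ (i, j)"] e(1) by (simp add: f_def)
      qed (use e(1) in auto)
      with e(6) show False by simp
    qed
    ultimately have small: "r < n" "s < n" using rs by auto
    have part: "commutes \<phi> ((scalar_mat g * V * scalar_mat g) $$ (i, j))"
      if g: "g \<in> carrier_mat n n" "scalar_mat g * V = V * scalar_mat g"
        and Y: "Y \<in> carrier_mat n q" "adj_mat Y * Y = 1\<^sub>m q" "Y * adj_mat Y = g" "q < n" for g Y q
    proof -
      let ?V = "scalar_mat (adj_mat Y) * V * scalar_mat Y"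
      note sub = subrepresentation[OF less.prems(1) V g Y(1-3)]
      have "commutes \<phi> (?V $$ (a, b))" if "a < q" "b < q" for a b
      proof -
        have dim: "dim_row ?V = q" by (rule carrier_matD(1)[OF sub(2)])
        have lt: "dim_row ?V < dim_row V" unfolding dim using Y(4) by (simp only: n_def)
        show ?thesis by (rule less.hyps[OF lt sub(1)]) (simp_all only: dim that)
      qed
      then have "commutes \<phi> ((scalar_mat Y * ?V * scalar_mat (adj_mat Y)) $$ (i, j))"
        using ij Y(1) by (intro commutes_sandwich[OF lin _ sub(2)]) auto
      then show ?thesis by (simp only: sub(3))
    qed
    have ee: "?e * ?e = ?e" "scalar_mat f * scalar_mat f = (scalar_mat f :: 'n pol_hyp mat)"
      using scalar_mat_mult[OF e(1) e(1), symmetric] scalar_mat_mult[OF f(1) f(1), symmetric] e(3) f(3) by simp_all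
    have "scalar_mat g * V * scalar_mat g = V * scalar_mat g"
      if "g \<in> carrier_mat n n" "scalar_mat g * V = V * scalar_mat g" "scalar_mat g * scalar_mat g = (scalar_mat g :: 'n pol_hyp mat)" for g
    proof -
      have "V * scalar_mat g * scalar_mat g = V * (scalar_mat g * scalar_mat g)"
        using that(1) V by (intro assoc_mult_mat[of _ n n _ n _ n]) auto
      then show ?thesis using that by simp
    qed
    from this[OF e(1) eV ee(1)] this[OF f(1) fV ee(2)]
    have "V $$ (i, j) = (?e * V * ?e) $$ (i, j) + (scalar_mat f * V * scalar_mat f) $$ (i, j)"
      using V e(1) ij by (simp add: Vf)
    then show ?thesis
      using part[OF e(1) eV W(1-3) small(1)] part[OF f(1) fV X(1-3) small(2)] by (simp add: commutes_add[OF lin])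
  qed
qed

text \<open>Matrices are indexed by natural numbers, hence the enumeration \<open>idx\<close> of the
  tuples. The two unitarity relations are \<open>word_cancel\<close> and
  \<open>word_cancel_col\<close>.\<close>

lemma word_coefficient:
  fixes x y :: "'n::finite list"
  assumes "length x = length z" "length y = length z"
  obtains V :: "'n pol_hyp mat" and i j
  where "unitary_rep comult V" "i < dim_row V" "j < dim_row V" "V $$ (i, j) = word z x y"
proof -
  let ?T = "tuples (length z) :: 'n list set"
  define N where "N = card ?T"
  obtain idx where idx: "bij_betw idx {..<N} ?T"
    using ex_bij_betw_nat_finite[of ?T] by (auto simp: N_def lessThan_atLeast0)
  have len: "length (idx i) = length z" if "i < N" for i
    using bij_betwE[OF idx] that by auto
  have eq: "idx i = idx j \<longleftrightarrow> i = j" if "i < N" "j < N" for i j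
    using bij_betw_imp_inj_on[OF idx] that by (auto simp: inj_on_def)
  have sum: "(\<Sum>k<N. f (idx k)) = (\<Sum>a\<in>?T. f a)" for f :: "'n list \<Rightarrow> 'b::comm_monoid_add"
    by (rule sum.reindex_bij_betw[OF idx])
  define V where "V = mat N N (\<lambda>(i, j). word z (idx i) (idx j))"
  have V: "V \<in> carrier_mat N N" by (simp add: V_def)
  have "V * adj_mat V = 1\<^sub>m N"
  proof (rule eq_matI)
    fix i j assume "i < dim_row (1\<^sub>m N :: 'n pol_hyp mat)" "j < dim_col (1\<^sub>m N :: 'n pol_hyp mat)"
    then have ij: "i < N" "j < N" by auto
    have "(V * adj_mat V) $$ (i, j) = (\<Sum>k<N. word z (idx i) (idx k) * star (word z (idx j) (idx k)))"
      using ij by (simp add: V_def adj_mat_def scalar_prod_def lessThan_atLeast0)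
    also have "\<dots> = (\<Sum>a\<in>?T. word z (idx i) a * word (rev z) (rev (idx j)) (rev a))"
      unfolding sum[of "\<lambda>a. word z (idx i) a * star (word z (idx j) a)"]
      using len ij by (intro sum.cong refl) (simp add: star_word)
    finally show "(V * adj_mat V) $$ (i, j) = (1\<^sub>m N :: 'n pol_hyp mat) $$ (i, j)"
      using len ij eq by (simp add: word_cancel)
  qed (simp_all add: V_def)
  moreover have "adj_mat V * V = 1\<^sub>m N"
  proof (rule eq_matI)
    fix i j assume "i < dim_row (1\<^sub>m N :: 'n pol_hyp mat)" "j < dim_col (1\<^sub>m N :: 'n pol_hyp mat)"
    then have ij: "i < N" "j < N" by auto
    have "(adj_mat V * V) $$ (i, j) = (\<Sum>k<N. star (word z (idx k) (idx i)) * word z (idx k) (idx j))"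
      using ij by (simp add: V_def adj_mat_def scalar_prod_def lessThan_atLeast0)
    also have "\<dots> = (\<Sum>a\<in>?T. word (rev z) (rev a) (rev (idx i)) * word z a (idx j))"
      unfolding sum[of "\<lambda>a. star (word z a (idx i)) * word z a (idx j)"]
      using len ij by (intro sum.cong refl) (simp add: star_word)
    finally show "(adj_mat V * V) $$ (i, j) = (1\<^sub>m N :: 'n pol_hyp mat) $$ (i, j)"
      using len ij eq by (simp add: word_cancel_col)
  qed (simp_all add: V_def)
  moreover have "comult (V $$ (i, j)) = (\<Sum>k<N. V $$ (i, k) \<otimes>\<^sub>t V $$ (k, j))" if "i < N" "j < N" for i j
    using that len sum[of "\<lambda>a. word z (idx i) a \<otimes>\<^sub>t word z a (idx j)"] by (simp add: V_def comult_word)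
  ultimately have "unitary_rep comult V"
    using V by (simp add: unitary_rep_def unitary_mat_carrier)
  moreover obtain i where "i < N" "idx i = x"
    using bij_betw_imp_surj_on[OF idx] assms(1) by (metis (mono_tags) imageE lessThan_iff mem_Collect_eq)
  moreover obtain j where "j < N" "idx j = y"
    using bij_betw_imp_surj_on[OF idx] assms(2) by (metis (mono_tags) imageE lessThan_iff mem_Collect_eq)
  ultimately show thesis using that[of V i j] by (simp add: V_def)
qed

lemma central_imp_convolution_central:
  assumes "clinear \<phi>" "irr_representatives comult Irr" "central Irr \<phi>"
  shows "convolution_central \<phi>"
proof -
  have "commutes \<phi> x" for x
  proof (induction x rule: pol_hyp_induct)
    case (word z x y)
    then show ?case by (metis word_coefficient commutes_coefficient[OF assms])
  qed (simp_all add: commutes_add commutes_scale assms(1))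
  then show ?thesis using assms(1) by (simp add: convolution_central_def commutes_def)
qed


section \<open>The Haar state and the linear combination\<close>

lemma haar_convolution_central: "haar_state comult h \<Longrightarrow> convolution_central h"
  by (simp add: haar_state_def convolution_central_def)

text \<open>Invariance makes each column of values of \<open>h\<close> a fixed vector, hence
  noncrossing. Regarded as a pairing of \<open>z\<close> with the empty word it gives zero by
  \<open>nc_pairs\<close>, as the two words differ.\<close>

lemma haar_primitive:
  fixes h :: "'n::finite pol_hyp \<Rightarrow> complex"
  assumes h: "haar_state comult h" and "z \<noteq> []" "primitive z \<tau>" "length y = length z"
  shows "(\<Sum>x\<in>tuples (length z). \<tau> x * h (word z x y)) = 0"
proof -
  have lin: "clinear h" using h by (simp add: haar_state_def)
  let ?\<eta> = "\<lambda>x. h (word z x y)"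
  have fixed: "(\<Sum>a\<in>tuples (length z). ?\<eta> a *\<^sub>C word z x a) = ?\<eta> x *\<^sub>C 1" if "length x = length z" for x
  proof -
    have "slice_right h (comult (word z x y)) = h (word z x y) *\<^sub>C 1"
      using h by (simp add: haar_state_def)
    then show ?thesis
      using that assms(4)
      by (simp add: comult_word clinear_sum[OF slice_right(1)[OF lin]] slice_right(2)[OF lin])
  qed
  have zero: "(\<Sum>x\<in>tuples (length z). \<tau> x * of_real (nc_ker z x a)) = 0" for a
  proof -
    obtain c where "pairs0 z [] (\<lambda>x. nc_ker z x a) c"
      using nc_pairs[OF nc_nc_ker[of z a], THEN conjunct1, rule_format, of z "[]"] by auto
    moreover have "primitive [] (\<lambda>_. 1 :: complex)" by (simp add: primitive_def)
    ultimately have "(\<Sum>x\<in>tuples (length z). pair0 (length z) \<tau> (\<lambda>_. 1) x * of_real (nc_ker z x a)) = 0"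
      using assms(2,3) unfolding pairs0_def by fastforce
    then show ?thesis by (simp add: pair0_def)
  qed
  have "(\<Sum>x\<in>tuples (length z). \<tau> x * ?\<eta> x)
      = (\<Sum>x\<in>tuples (length z). \<Sum>a\<in>tuples (length z). \<tau> x * (?\<eta> a * of_real (nc_ker z x a)))"
    using fixed_vector_nc[OF fixed] by (intro sum.cong refl) (simp add: sum_distrib_left)
  also have "\<dots> = (\<Sum>a\<in>tuples (length z). ?\<eta> a * (\<Sum>x\<in>tuples (length z). \<tau> x * of_real (nc_ker z x a)))"
    by (subst sum.swap) (simp add: sum_distrib_left mult.left_commute)
  also have "\<dots> = 0" by (simp add: zero)
  finally show ?thesis .
qed

context six_points
begin

lemma scal_haar:
  fixes h :: "'n pol_hyp \<Rightarrow> complex"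
  assumes h: "haar_state comult h" and "z \<noteq> []"
  shows "scal h z = 0"
proof -
  have "0 < length z" using assms(2) by simp
  note prim = primitive_alt(1)[OF this, of z, OF refl]
  obtain y where y: "length y = length z" "prod_vec (alt True (length z)) y \<noteq> 0"
    using prod_vec_nonzero[of "alt True (length z)"] nonzero_alt by auto
  have "scal h z * prod_vec (alt True (length z)) y = 0"
    using scal(2)[OF haar_convolution_central[OF h] prim y(1)] haar_primitive[OF h assms(2) prim y(1)] by simp
  then show ?thesis using y(2) by simp
qed

theorem linear_combination:
  assumes h: "haar_state comult h"
  shows "\<exists>a b c. \<forall>x. \<phi> x = a * counit x + b * eps_alt x + c * h x"
proof -
  define A B where "A = scal \<phi> [False]" and "B = scal \<phi> [True]"
  \<comment> \<open>The solution of \<open>a + b = A\<close> for even words,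
    \<open>a - b = B\<close> for odd words and \<open>a + b + c = \<phi> 1\<close>; the Haar state
    corrects the value on the empty word.\<close>
  define a b c where "a = (A + B) / 2" and "b = (A - B) / 2" and "c = \<phi> 1 - A"
  define \<delta> where "\<delta> = (\<lambda>x. \<phi> x - (a * counit x + b * eps_alt x + c * h x))"
  have hlin: "clinear h" "h 1 = 1" using h by (simp_all add: haar_state_def)
  note lins = \<phi>_clinear star_hom_clinear[OF star_hom_counit] star_hom_clinear[OF star_hom_eps_alt] hlin(1)
  have \<delta>: "clinear \<delta>"
    unfolding clinear_def \<delta>_def
    by (simp add: lins[THEN clinear_add] lins[THEN clinear_scaleC] scaleC_complex_def algebra_simps)
  have van: "(\<Sum>y\<in>tuples (length z). \<tau> y * \<delta> (word z x y)) = 0"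
    if prim: "primitive z \<tau>" and x: "length x = length z" for z \<tau> x
  proof (cases "z = []")
    case True
    have "\<delta> 1 = 0"
      by (simp add: \<delta>_def hlin(2) star_hom_one[OF star_hom_counit] star_hom_one[OF star_hom_eps_alt] a_def b_def c_def field_simps)
    then show ?thesis using True x by simp
  next
    case False
    have e: "(\<Sum>y\<in>tuples (length z). \<tau> y * counit (word z x y)) = \<tau> x"
    proof -
      have "(\<Sum>y\<in>tuples (length z). \<tau> y * counit (word z x y)) = (\<Sum>y\<in>tuples (length z). if y = x then \<tau> y else 0)"
        using x by (intro sum.cong refl) (auto simp: counit_word)
      then show ?thesis using x by (simp add: sum_tuples_delta)
    qed
    have ea: "(\<Sum>y\<in>tuples (length z). \<tau> y * eps_alt (word z x y)) = (if parity z then -1 else 1) * \<tau> x"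
    proof -
      have "(\<Sum>y\<in>tuples (length z). \<tau> y * eps_alt (word z x y))
          = (\<Sum>y\<in>tuples (length z). if y = x then (if parity z then -1 else 1) * \<tau> y else 0)"
        using x by (intro sum.cong refl) (auto simp: eps_alt_word)
      then show ?thesis using x by (simp add: sum_tuples_delta)
    qed
    have hh: "(\<Sum>y\<in>tuples (length z). \<tau> y * h (word z x y)) = 0"
      using scal(1)[OF haar_convolution_central[OF h] prim x] scal_haar[OF h False] by simp
    have p: "(\<Sum>y\<in>tuples (length z). \<tau> y * \<phi> (word z x y)) = (if parity z then B else A) * \<tau> x"
      using scal(1)[OF central prim x] scal_parity[OF False] by (simp add: A_def B_def)
    have "(\<Sum>y\<in>tuples (length z). \<tau> y * \<delta> (word z x y))
        = (\<Sum>y\<in>tuples (length z). \<tau> y * \<phi> (word z x y))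
        - (a * (\<Sum>y\<in>tuples (length z). \<tau> y * counit (word z x y))
        + b * (\<Sum>y\<in>tuples (length z). \<tau> y * eps_alt (word z x y))
        + c * (\<Sum>y\<in>tuples (length z). \<tau> y * h (word z x y)))"
      by (simp add: \<delta>_def sum_distrib_left sum.distrib sum_subtractf algebra_simps)
    also have "\<dots> = 0" unfolding e ea hh p by (auto simp: a_def b_def field_simps)
    finally show ?thesis .
  qed
  have "\<delta> x = 0" for x
  proof (induction x rule: pol_hyp_induct)
    case (word z x y)
    then show ?case by (intro vanishes_if_vanishes_on_primitive[OF \<delta>] van)
  qed (simp_all add: clinear_add[OF \<delta>] clinear_scaleC[OF \<delta>])
  then have "\<phi> x = a * counit x + b * eps_alt x + c * h x" for x
    by (simp add: \<delta>_def)
  then show ?thesis by blast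
qed

end

section \<open>Bounded functionals on the universal C*-algebra\<close>

text \<open>Extension by continuity along Cauchy sequences: \<open>rep_cu\<close> selects a
  sequence, and the bound makes the limit independent of the selection.\<close>

lemma bounded_functional_extends:
  fixes \<theta> :: "'n::finite pol_hyp \<Rightarrow> complex"
  assumes lin: "clinear \<theta>" and K: "\<And>x. cmod (\<theta> x) \<le> K * unorm x"
  shows "\<exists>\<Phi> :: 'n cu_hyp \<Rightarrow> complex. clinear \<Phi> \<and> bounded_linear \<Phi> \<and> (\<forall>x. \<Phi> (to_cu x) = \<theta> x)"
proof -
  have K0: "0 \<le> K" using order_trans[OF norm_ge_zero K[of 1]] un_one[where 'n = 'n] by simp
  have diff: "\<theta> x - \<theta> y = \<theta> (x - y)" for x y by (simp add: clinear_diff[OF lin])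
  have conv: "convergent (\<lambda>n. \<theta> (X n))" if X: "un_Cauchy X" for X
  proof (rule Cauchy_convergent, rule metric_CauchyI)
    fix r :: real assume "0 < r"
    then have "0 < r / (K + 1)" using K0 by simp
    then obtain N where N: "\<And>m n. m \<ge> N \<Longrightarrow> n \<ge> N \<Longrightarrow> unorm (X m - X n) < r / (K + 1)"
      using X unfolding un_Cauchy_def by blast
    have "dist (\<theta> (X m)) (\<theta> (X n)) < r" if "m \<ge> N" "n \<ge> N" for m n
    proof -
      have "dist (\<theta> (X m)) (\<theta> (X n)) \<le> K * unorm (X m - X n)" by (simp add: dist_norm diff K)
      also have "\<dots> \<le> K * (r / (K + 1))" using N[OF that] K0 by (intro mult_left_mono) auto
      also have "\<dots> < r" using \<open>0 < r\<close> K0 by (simp add: field_simps)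
      finally show ?thesis .
    qed
    then show "\<exists>M. \<forall>m\<ge>M. \<forall>n\<ge>M. dist (\<theta> (X m)) (\<theta> (X n)) < r" by blast
  qed
  define \<Phi> where "\<Phi> = (\<lambda>y. lim (\<lambda>n. \<theta> (rep_cu y n)))"
  have lim: "(\<lambda>n. \<theta> (X n)) \<longlonglongrightarrow> \<Phi> (abs_cu X)" if X: "un_Cauchy X" for X
  proof -
    have rel: "un_rel (rep_cu (abs_cu X)) X"
      by (rule Quotient3_rep_abs[OF Quotient3_cu_hyp]) (rule un_rel_refl[OF X])
    then have "un_Cauchy (rep_cu (abs_cu X))" by (simp add: un_rel_def)
    then have 1: "(\<lambda>n. \<theta> (rep_cu (abs_cu X) n)) \<longlonglongrightarrow> \<Phi> (abs_cu X)"
      using conv convergent_LIMSEQ_iff by (auto simp: \<Phi>_def)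
    have "(\<lambda>n. K * unorm (rep_cu (abs_cu X) n - X n)) \<longlonglongrightarrow> 0"
      using rel by (auto simp: un_rel_def intro!: tendsto_mult_right_zero)
    then have "(\<lambda>n. cmod (\<theta> (rep_cu (abs_cu X) n) - \<theta> (X n))) \<longlonglongrightarrow> 0"
      by (rule null_squeeze) (simp_all add: diff K)
    then have "(\<lambda>n. \<theta> (rep_cu (abs_cu X) n) - \<theta> (X n)) \<longlonglongrightarrow> 0" by (rule tendsto_norm_zero_cancel)
    from tendsto_diff[OF 1 this] show ?thesis by simp
  qed
  have add: "\<Phi> (x + y) = \<Phi> x + \<Phi> y" for x y
  proof -
    obtain X where X: "un_Cauchy X" "x = abs_cu X" by (rule cu_exhaust)
    obtain Y where Y: "un_Cauchy Y" "y = abs_cu Y" by (rule cu_exhaust)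
    have "x + y = abs_cu (\<lambda>n. X n + Y n)" using X Y by (simp add: plus_cu_hyp.abs_eq un_rel_refl)
    then have "(\<lambda>n. \<theta> (X n) + \<theta> (Y n)) \<longlonglongrightarrow> \<Phi> (x + y)"
      using lim[OF un_Cauchy_ops(1)[OF X(1) Y(1)]] by (simp add: clinear_add[OF lin])
    with tendsto_add[OF lim[OF X(1)] lim[OF Y(1)]] show ?thesis
      using X(2) Y(2) LIMSEQ_unique by blast
  qed
  have scale: "\<Phi> (c *\<^sub>C x) = c * \<Phi> x" for c x
  proof -
    obtain X where X: "un_Cauchy X" "x = abs_cu X" by (rule cu_exhaust)
    have "c *\<^sub>C x = abs_cu (\<lambda>n. c *\<^sub>C X n)" using X by (simp add: scaleC_cu_hyp.abs_eq un_rel_refl)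
    then have "(\<lambda>n. c * \<theta> (X n)) \<longlonglongrightarrow> \<Phi> (c *\<^sub>C x)"
      using lim[OF un_Cauchy_ops(3)[OF X(1) X(1)]] by (simp add: clinear_scaleC[OF lin] scaleC_complex_def)
    with tendsto_mult_left[OF lim[OF X(1)], of c] show ?thesis
      using X(2) LIMSEQ_unique by blast
  qed
  have bound: "cmod (\<Phi> x) \<le> norm x * K" for x
  proof -
    obtain X where X: "un_Cauchy X" "x = abs_cu X" by (rule cu_exhaust)
    have "(\<lambda>n. cmod (\<theta> (X n))) \<longlonglongrightarrow> cmod (\<Phi> x)" unfolding X(2) by (intro tendsto_norm lim X)
    moreover have "(\<lambda>n. K * unorm (X n)) \<longlonglongrightarrow> K * norm x"
      unfolding X(2) by (intro tendsto_mult_left norm_abs_cu X)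
    ultimately have "cmod (\<Phi> x) \<le> K * norm x" by (rule LIMSEQ_le) (auto simp: K)
    then show ?thesis by (simp add: mult.commute)
  qed
  have "\<Phi> (to_cu x) = \<theta> x" for x
    using lim[OF un_Cauchy_const[of x]] LIMSEQ_unique[OF _ tendsto_const]
    by (simp add: to_cu.abs_eq LIMSEQ_const_iff)
  moreover have "clinear \<Phi>" by (simp add: clinear_def add scale scaleC_complex_def)
  moreover have "bounded_linear \<Phi>"
    by (rule bounded_linear_intro[of _ K])
      (simp_all add: add scale scaleR_cu_hyp_def bound scaleR_conv_of_real)
  ultimately show ?thesis by blast
qed

text \<open>The modulus of a character is itself one of the seminorms in the supremum
  \<open>unorm\<close>.\<close>

lemma character_bound:
  fixes \<rho> :: "'n::finite pol_hyp \<Rightarrow> complex"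
  assumes "star_hom \<rho>"
  shows "cmod (\<rho> x) \<le> unorm x"
proof (rule cs_le_unorm)
  show "cstar_seminorm (\<lambda>x. cmod (\<rho> x))"
    unfolding cstar_seminorm_def
    by (simp add: star_hom_mult[OF assms] star_hom_star[OF assms] star_hom_add[OF assms]
        clinear_scaleC[OF star_hom_clinear[OF assms]] scaleC_complex_def star_complex_def norm_mult
        norm_triangle_ineq power2_eq_square)
qed

section \<open>The GNS seminorm of a state\<close>

locale state =
  fixes h :: "'n::finite pol_hyp \<Rightarrow> complex"
  assumes lin: "clinear h" and one: "h 1 = 1" and nonneg: "\<And>a. h (star a * a) \<in> \<real>\<^sub>\<ge>\<^sub>0"
begin

definition snorm :: "'n pol_hyp \<Rightarrow> real" where
  "snorm a = sqrt (Re (h (star a * a)))"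

lemma Re_nonneg: "0 \<le> Re (h (star a * a))" and Im_zero: "Im (h (star a * a)) = 0"
  using nonneg[of a] by (auto simp: complex_nonneg_Reals_iff)

lemma snorm_sq: "(snorm a)\<^sup>2 = Re (h (star a * a))" and snorm_nonneg: "0 \<le> snorm a"
  by (simp_all add: snorm_def Re_nonneg)

lemmas h_simps = clinear_add[OF lin] clinear_scaleC[OF lin] clinear_diff[OF lin]
  star_add star_diff star_scaleC distrib_left distrib_right left_diff_distrib right_diff_distrib
  mult_scaleC_left mult_scaleC_right scaleC_complex_def

text \<open>Polarisation: the values at \<open>a + b\<close> and at
  \<open>a + \<i> *\<^sub>C b\<close> are real, which settles the imaginary and the real
  part.\<close>

lemma hermitian: "h (star b * a) = cnj (h (star a * b))"
proof -
  have "Im (h (star a * b)) + Im (h (star b * a)) = 0"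
    using Im_zero[of "a + b"] Im_zero[of a] Im_zero[of b] by (simp add: h_simps)
  moreover have "Re (h (star a * b)) - Re (h (star b * a)) = 0"
    using Im_zero[of "a + \<i> *\<^sub>C b"] Im_zero[of a] Im_zero[of b] by (simp add: h_simps)
  ultimately show ?thesis by (simp add: complex_eq_iff)
qed

lemma Cauchy_Schwarz: "cmod (h (star a * b)) \<le> snorm a * snorm b"
proof -
  define X A B where "X = h (star a * b)" and "A = Re (h (star a * a))" and "B = Re (h (star b * b))"
  \<comment> \<open>Positivity at \<open>a - l *\<^sub>C b\<close>, with the phase of
    \<open>l\<close> chosen to make both cross terms real. The free factor \<open>s\<close> is later
    \<open>1 / B\<close>, or a value large enough for a contradiction when
    \<open>B = 0\<close>.\<close>
  have *: "0 \<le> A - 2 * s * (cmod X)\<^sup>2 + s\<^sup>2 * (cmod X)\<^sup>2 * B" for s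
  proof -
    define l where "l = of_real s * cnj X"
    have "h (star (a - l *\<^sub>C b) * (a - l *\<^sub>C b)) = h (star a * a) - l * X - cnj l * cnj X + cnj l * l * h (star b * b)"
      using hermitian[of b a] by (simp add: h_simps X_def algebra_simps)
    moreover have "l * X = of_real (s * (cmod X)\<^sup>2)"
      by (simp add: l_def complex_norm_square mult.commute del: of_real_power)
    moreover have "cnj l * cnj X = of_real (s * (cmod X)\<^sup>2)"
      by (simp add: l_def complex_norm_square mult.commute del: of_real_power)
    moreover have "cnj l * l = of_real (s\<^sup>2 * (cmod X)\<^sup>2)"
    proof -
      have "cnj l * l = of_real (s\<^sup>2) * (X * cnj X)" by (simp add: l_def power2_eq_square mult_ac)
      then show ?thesis by (simp only: complex_norm_square[symmetric] of_real_mult)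
    qed
    ultimately have "Re (h (star (a - l *\<^sub>C b) * (a - l *\<^sub>C b)))
        = A - s * (cmod X)\<^sup>2 - s * (cmod X)\<^sup>2 + s\<^sup>2 * (cmod X)\<^sup>2 * B"
      by (simp add: A_def B_def)
    then show ?thesis using Re_nonneg[of "a - l *\<^sub>C b"] by simp
  qed
  have "(cmod X)\<^sup>2 \<le> A * B"
  proof (cases "B = 0")
    case True
    have "(cmod X)\<^sup>2 = 0"
    proof (rule ccontr)
      assume nz: "(cmod X)\<^sup>2 \<noteq> 0"
      have "0 \<le> A - 2 * ((A + 1) / (cmod X)\<^sup>2) * (cmod X)\<^sup>2" using *[of "(A + 1) / (cmod X)\<^sup>2"] True by simp
      then have "0 \<le> A - 2 * (A + 1)" using nz by simp
      then show False using Re_nonneg[of a] by (simp add: A_def)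
    qed
    then show ?thesis using True by simp
  next
    case False
    then have B: "0 < B" using Re_nonneg[of b] by (simp add: B_def)
    have "0 \<le> A - 2 * (1 / B) * (cmod X)\<^sup>2 + (1 / B)\<^sup>2 * (cmod X)\<^sup>2 * B" by (rule *)
    also have "\<dots> = A - (cmod X)\<^sup>2 / B" using B by (simp add: field_simps power2_eq_square)
    finally show ?thesis using B by (simp add: field_simps)
  qed
  then have "(cmod X)\<^sup>2 \<le> (snorm a * snorm b)\<^sup>2" by (simp add: power_mult_distrib snorm_sq A_def B_def)
  then show ?thesis
    unfolding X_def by (rule power2_le_imp_le) (simp add: snorm_nonneg)
qed

lemma snorm_add: "snorm (a + b) \<le> snorm a + snorm b"
proof (rule power2_le_imp_le)
  have "(snorm (a + b))\<^sup>2 = (snorm a)\<^sup>2 + Re (h (star a * b)) + Re (h (star b * a)) + (snorm b)\<^sup>2"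
    by (simp add: snorm_sq h_simps)
  also have "\<dots> \<le> (snorm a)\<^sup>2 + snorm a * snorm b + snorm b * snorm a + (snorm b)\<^sup>2"
    using Cauchy_Schwarz[of a b] Cauchy_Schwarz[of b a] complex_Re_le_cmod[of "h (star a * b)"]
      complex_Re_le_cmod[of "h (star b * a)"] by linarith
  also have "\<dots> = (snorm a + snorm b)\<^sup>2" by (simp add: power2_sum)
  finally show "(snorm (a + b))\<^sup>2 \<le> (snorm a + snorm b)\<^sup>2" .
qed (simp add: snorm_nonneg)

lemma snorm_scale: "snorm (c *\<^sub>C a) = cmod c * snorm a"
proof -
  have "h (star (c *\<^sub>C a) * (c *\<^sub>C a)) = of_real ((cmod c)\<^sup>2) * h (star a * a)"
    by (simp add: h_simps complex_norm_square mult_ac del: of_real_power)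
  then show ?thesis by (simp add: snorm_def real_sqrt_mult)
qed

definition op_bound :: "real \<Rightarrow> 'n pol_hyp \<Rightarrow> bool" where
  "op_bound K x \<longleftrightarrow> 0 \<le> K \<and> (\<forall>a. snorm (x * a) \<le> K * snorm a)"

text \<open>The squared norms of \<open>a\<close> and \<open>u_gen i j * a\<close> differ by the
  squared norm of \<open>(1 - ?p) * a\<close>, because \<open>1 - ?p\<close> is a projection and the
  self-adjoint \<open>u_gen i j\<close> has square \<open>?p\<close>.\<close>

lemma op_bound_u: "op_bound 1 (u_gen i j)"
  unfolding op_bound_def
proof (intro conjI allI)
  fix a
  let ?p = "(u_gen i j)\<^sup>2"
  have p: "star (1 - ?p) * (1 - ?p) = 1 - ?p"
  proof -
    have "star ?p = ?p" by (simp add: power2_eq_square star_mult star_u)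
    moreover have "?p * ?p = ?p" using p_row[of i j j] by simp
    ultimately show ?thesis by (simp only: star_diff star_one left_diff_distrib right_diff_distrib mult_1_left mult_1_right diff_self diff_zero)
  qed
  have "star ((1 - ?p) * a) * ((1 - ?p) * a) = star a * (star (1 - ?p) * (1 - ?p)) * a"
    by (simp only: star_mult mult.assoc)
  also have "\<dots> = star a * a - star (u_gen i j * a) * (u_gen i j * a)"
    unfolding p by (simp add: star_mult star_u power2_eq_square algebra_simps)
  finally have "(snorm (u_gen i j * a))\<^sup>2 \<le> (snorm a)\<^sup>2"
    using Re_nonneg[of "(1 - ?p) * a"] by (simp add: snorm_sq clinear_diff[OF lin])
  then show "snorm (u_gen i j * a) \<le> 1 * snorm a"
    using power2_le_imp_le[OF _ snorm_nonneg] by simp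
qed simp

lemma op_bound_mult: "op_bound K x \<Longrightarrow> op_bound L y \<Longrightarrow> op_bound (K * L) (x * y)"
  unfolding op_bound_def by (simp add: mult.assoc) (meson mult_left_mono order_trans)

lemma op_bound_add: "op_bound K x \<Longrightarrow> op_bound L y \<Longrightarrow> op_bound (K + L) (x + y)"
  unfolding op_bound_def by (simp add: distrib_right) (meson add_mono order_trans snorm_add)

lemma op_bound_scale: "op_bound K x \<Longrightarrow> op_bound (cmod c * K) (c *\<^sub>C x)"
  unfolding op_bound_def by (simp add: mult_scaleC_left snorm_scale mult_left_mono mult.assoc)

lemma op_bound_exists: "\<exists>K. op_bound K x"
proof (induction x rule: pol_hyp_induct)
  case (word z x y)
  have "op_bound 1 (word z x y)"
    using word
  proof (induction z arbitrary: x y)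
    case Nil
    then show ?case by (simp add: op_bound_def)
  next
    case (Cons t z)
    then obtain i x' j y' where "x = i # x'" "y = j # y'" by (metis length_Suc_conv length_Cons)
    moreover have "op_bound 1 (letter t i j)"
      using op_bound_u[of i j] op_bound_mult[OF op_bound_u op_bound_u, of i j i j]
      by (simp add: letter_def power2_eq_square)
    ultimately show ?case using Cons op_bound_mult[of 1 "letter t i j" 1 "word z x' y'"] by simp
  qed
  then show ?case ..
qed (blast intro: op_bound_add op_bound_scale)+

text \<open>The norm of left multiplication as an operator for \<open>snorm\<close>. It is formed on
  the polynomial algebra itself, since a C*-seminorm requires neither the quotient by null vectors
  nor a completion.\<close>

definition gns_norm :: "'n pol_hyp \<Rightarrow> real" where
  "gns_norm x = Inf {K. op_bound K x}"

lemma gns_norm_le: "op_bound K x \<Longrightarrow> gns_norm x \<le> K"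
  unfolding gns_norm_def by (rule cInf_lower) (auto simp: op_bound_def intro!: bdd_belowI[of _ 0])

lemma op_bound_gns_norm: "op_bound (gns_norm x) x"
proof -
  have ne: "{K. op_bound K x} \<noteq> {}" using op_bound_exists by blast
  have "0 \<le> gns_norm x"
    unfolding gns_norm_def by (rule cInf_greatest[OF ne]) (simp add: op_bound_def)
  moreover have "snorm (x * a) \<le> gns_norm x * snorm a" for a
  proof (cases "snorm a = 0")
    case True
    obtain K where "op_bound K x" using op_bound_exists by blast
    then have "snorm (x * a) \<le> K * snorm a" by (simp add: op_bound_def)
    then show ?thesis using True by simp
  next
    case False
    then have a: "0 < snorm a" using snorm_nonneg[of a] by simp
    have "snorm (x * a) / snorm a \<le> gns_norm x"
      unfolding gns_norm_def
      by (rule cInf_greatest[OF ne]) (use a in \<open>simp add: op_bound_def divide_le_eq\<close>)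
    then show ?thesis using a by (simp add: divide_le_eq)
  qed
  ultimately show ?thesis by (simp add: op_bound_def)
qed

lemma gns_norm_nonneg: "0 \<le> gns_norm x" and snorm_mult_le: "snorm (x * a) \<le> gns_norm x * snorm a"
  using op_bound_gns_norm[of x] by (simp_all add: op_bound_def)

text \<open>Cauchy-Schwarz after moving \<open>x\<close> across the inner product. It yields both
  the invariance under \<open>star\<close> and the lower half of the C*-identity.\<close>

lemma snorm_sq_le: "(snorm (x * a))\<^sup>2 \<le> snorm a * snorm (star x * (x * a))"
proof -
  have "(snorm (x * a))\<^sup>2 = Re (h (star a * (star x * (x * a))))"
    by (simp add: snorm_sq star_mult mult.assoc)
  also have "\<dots> \<le> cmod (h (star a * (star x * (x * a))))" by (rule complex_Re_le_cmod)
  also have "\<dots> \<le> snorm a * snorm (star x * (x * a))" by (rule Cauchy_Schwarz)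
  finally show ?thesis .
qed

lemma gns_norm_star_le: "gns_norm (star x) \<le> gns_norm x"
proof (rule gns_norm_le, unfold op_bound_def, intro conjI allI)
  fix a
  show "snorm (star x * a) \<le> gns_norm x * snorm a"
  proof (cases "snorm (star x * a) = 0")
    case True
    then show ?thesis by (simp add: gns_norm_nonneg snorm_nonneg)
  next
    case False
    then have pos: "0 < snorm (star x * a)" using snorm_nonneg[of "star x * a"] by simp
    have "snorm (star x * a) * snorm (star x * a) \<le> snorm a * snorm (x * (star x * a))"
      using snorm_sq_le[of "star x" a] by (simp add: power2_eq_square star_star)
    also have "\<dots> \<le> snorm a * (gns_norm x * snorm (star x * a))"
      by (intro mult_left_mono snorm_mult_le snorm_nonneg)
    finally have "snorm (star x * a) * snorm (star x * a) \<le> (gns_norm x * snorm a) * snorm (star x * a)"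
      by (simp add: mult_ac)
    then show ?thesis using pos by simp
  qed
qed (rule gns_norm_nonneg)

lemma cstar_seminorm_gns_norm: "cstar_seminorm gns_norm"
  unfolding cstar_seminorm_def
proof (intro conjI allI)
  fix x y and c :: complex
  show "gns_norm (x + y) \<le> gns_norm x + gns_norm y"
    by (intro gns_norm_le op_bound_add op_bound_gns_norm)
  show mult: "gns_norm (x * y) \<le> gns_norm x * gns_norm y" for x y
    by (intro gns_norm_le op_bound_mult op_bound_gns_norm)
  have scale: "gns_norm (c *\<^sub>C x) \<le> cmod c * gns_norm x" for c x
    by (intro gns_norm_le op_bound_scale op_bound_gns_norm)
  show "gns_norm (c *\<^sub>C x) = cmod c * gns_norm x"
  proof (cases "c = 0")
    case True
    then show ?thesis using scale[of 0 x] gns_norm_nonneg[of "c *\<^sub>C x"] by simp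
  next
    case False
    have "gns_norm x \<le> cmod (inverse c) * gns_norm (c *\<^sub>C x)"
      using scale[of "inverse c" "c *\<^sub>C x"] False by (simp add: scaleC_scaleC scaleC_one)
    from mult_left_mono[OF this, of "cmod c"] have "cmod c * gns_norm x \<le> gns_norm (c *\<^sub>C x)"
      using False by (simp add: norm_inverse mult.assoc[symmetric])
    with scale[of c x] show ?thesis by simp
  qed
  show "gns_norm (star x * x) = (gns_norm x)\<^sup>2"
  proof (rule antisym)
    have "gns_norm (star x * x) \<le> gns_norm (star x) * gns_norm x" by (rule mult)
    also have "\<dots> \<le> gns_norm x * gns_norm x"
      by (intro mult_right_mono gns_norm_star_le gns_norm_nonneg)
    finally show "gns_norm (star x * x) \<le> (gns_norm x)\<^sup>2" by (simp add: power2_eq_square)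
    have "op_bound (sqrt (gns_norm (star x * x))) x"
      unfolding op_bound_def
    proof (intro conjI allI)
      fix a
      have "(snorm (x * a))\<^sup>2 \<le> snorm a * snorm (star x * x * a)"
        using snorm_sq_le[of x a] by (simp add: mult.assoc)
      also have "\<dots> \<le> snorm a * (gns_norm (star x * x) * snorm a)"
        by (intro mult_left_mono snorm_mult_le snorm_nonneg)
      also have "\<dots> = (sqrt (gns_norm (star x * x)) * snorm a)\<^sup>2"
        by (simp add: power_mult_distrib gns_norm_nonneg power2_eq_square)
      finally show "snorm (x * a) \<le> sqrt (gns_norm (star x * x)) * snorm a"
        by (rule power2_le_imp_le) (simp add: gns_norm_nonneg snorm_nonneg)
    qed (simp add: gns_norm_nonneg)
    from gns_norm_le[OF this] show "(gns_norm x)\<^sup>2 \<le> gns_norm (star x * x)"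
      using gns_norm_nonneg by (metis power_mono real_sqrt_pow2)
  qed
qed

text \<open>The element \<open>1\<close> is a unit vector for \<open>snorm\<close>, so
  Cauchy-Schwarz bounds \<open>h x\<close> by the operator norm of \<open>x\<close>, and
  \<open>gns_norm\<close> takes part in the supremum \<open>unorm\<close>.\<close>

lemma state_bound: "cmod (h x) \<le> unorm x"
proof -
  have s1: "snorm 1 = 1" by (simp add: snorm_def one)
  have "cmod (h x) \<le> snorm (x * 1)" using Cauchy_Schwarz[of 1 x] by (simp add: s1)
  also have "\<dots> \<le> gns_norm x" using snorm_mult_le[of x 1] by (simp add: s1)
  also have "\<dots> \<le> unorm x" by (rule cs_le_unorm[OF cstar_seminorm_gns_norm])
  finally show ?thesis .
qed

end

theorem corollary6p7:
  fixes Irr :: "'n::finite pol_hyp mat set"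
    and h \<phi> :: "'n pol_hyp \<Rightarrow> complex"
  assumes "CARD('n) \<ge> 6"
    and "irr_representatives comult Irr"
    and "haar_state comult h"
    and "clinear \<phi>" and "tracial \<phi>" and "central Irr \<phi>"
  shows "(\<exists>a b c. \<forall>x. \<phi> x = a * counit x + b * eps_alt x + c * h x)
    \<and> (\<exists>\<Phi> :: 'n cu_hyp \<Rightarrow> complex. clinear \<Phi> \<and> bounded_linear \<Phi> \<and> (\<forall>x. \<Phi> (to_cu x) = \<phi> x))"
proof -
  have h: "haar_state comult h" by fact
  have "\<exists>e. e ` {2..<8::nat} \<subseteq> (UNIV :: 'n set) \<and> inj_on e {2..<8}"
    using \<open>CARD('n) \<ge> 6\<close> by (intro card_le_inj) simp_all
  then obtain e :: "nat \<Rightarrow> 'n" where e: "inj_on e {2..<8}" by blast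
  interpret six_points e \<phi>
    using e assms central_imp_convolution_central[of \<phi> Irr] by unfold_locales
  interpret state h
    using h by unfold_locales (simp_all add: haar_state_def)
  obtain a b c where abc: "\<phi> x = a * counit x + b * eps_alt x + c * h x" for x
    using linear_combination[OF h] by blast
  have "cmod (\<phi> x) \<le> (cmod a + cmod b + cmod c) * unorm x" for x
  proof -
    have "cmod (\<phi> x) \<le> cmod a * cmod (counit x) + cmod b * cmod (eps_alt x) + cmod c * cmod (h x)"
      unfolding abc by (intro order_trans[OF norm_triangle_ineq] add_mono) (simp_all add: norm_mult)
    also have "\<dots> \<le> cmod a * unorm x + cmod b * unorm x + cmod c * unorm x"
      by (intro add_mono mult_left_mono state_bound character_bound[OF star_hom_counit]
          character_bound[OF star_hom_eps_alt] norm_ge_zero)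
    finally show ?thesis by (simp add: algebra_simps)
  qed
  from bounded_functional_extends[OF \<open>clinear \<phi>\<close> this] show ?thesis using abc by blast
qed

end
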